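(* Let $n,k\in\mathbb Z^+$ and let $\lambda$ be a partition with $\widetilde\lambda_1\le n$. 1. $\mathbf I_k(n+1)=\mathbf I_k(n)+\mathbf I_k(n+1)^0$, where $\mathbf I_k(n)\in\boldsymbol\zeta(n)$ and $\mathbf I_k(n+1)^0:=\mathbf I_k(n+1)-\mathbf I_k(n)\in\mathcal I(n+1)^0$ (so this is the Olshanski decomposition of $\mathbf I_k(n+1)$). Then $\boldsymbol\pi_{n,n+1}(\mathbf I_k(n+1))=\mathbf I_k(n)$. 2. $\mathbf S_\lambda(n+1)=\mathbf S_\lambda(n)+\mathbf S_\lambda(n+1)^0$, where $\mathbf S_\lambda(n)\in\boldsymbol\zeta(n)$ and $\mathbf S_\lambda(n+1)^0:=\mathbf S_\lambda(n+1)-\mathbf S_\lambda(n)\in\mathcal I(n+1)^0$ (so this is the Olshanski decomposition of $\mathbf S_\lambda(n+1)$). Then $\boldsymbol\pi_{n,n+1}(\mathbf S_\lambda(n+1))=\mathbf S_\lambda(n)$.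
   Context: $\boldsymbol\zeta(n)$ is the center of $\mathbf U(gl(n))$ (over $\mathbb C$), and $gl(n)\subset gl(n+1)$ in the standard way. Let $\mathbf U(gl(n+1))^0$ be the centralizer of $e_{n+1,n+1}$ in $\mathbf U(gl(n+1))$, $\mathcal I(n+1)$ the left ideal of $\mathbf U(gl(n+1))$ generated by $e_{i,n+1}$, $i=1,\dots,n+1$, and $\mathcal I(n+1)^0=\mathcal I(n+1)\cap\mathbf U(gl(n+1))^0$. Then $\mathbf U(gl(n+1))^0=\mathbf U(gl(n))\oplus\mathcal I(n+1)^0$; the Olshanski decomposition of an element of $\boldsymbol\zeta(n+1)$ is its decomposition in this direct sum (the first component lies in $\boldsymbol\zeta(n)$). Virtual symbols. Let $\mathcal L=\{1,\dots,n\}$, and let $\mathcal A_0=\{\alpha_1,\dots,\alpha_{m_0}\}$, $\mathcal A_1=\{\beta_1,\dots,\beta_{m_1}\}$ be finite sets of auxiliary (virtual) symbols, with $m_0,m_1$ sufficiently large. Put $|a|=0\in\mathbb Z_2$ for $a\in\mathcal A_0$ and $|a|=1\in\mathbb Z_2$ for $a\in\mathcal A_1\cup\mathcal L$. Let $gl(m_0|m_1+n)$ be the complex Lie superalgebra with basis $e_{a,b}$, $a,b\in\mathcal A_0\cup\mathcal A_1\cup\mathcal L$, $|e_{a,b}|=|a|+|b|$, and superbracket $[e_{a,b},e_{c,d}]=\delta_{bc}e_{a,d}-(-1)^{(|a|+|b|)(|c|+|d|)}\delta_{ad}e_{c,b}$. Its enveloping superalgebra $\mathbf U(gl(m_0|m_1+n))$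 contains $\mathbf U(gl(n))$ as the subalgebra generated by $e_{i,j}$, $i,j\in\mathcal L$. Devirtualization. A product $e_{a_m,b_m}\cdots e_{a_1,b_1}$ is irregular if there are $i\le m$ and a virtual symbol $\gamma\in\mathcal A_0\cup\mathcal A_1$ with $\#\{j\le i: b_j=\gamma\}>\#\{j<i: a_j=\gamma\}$. Let $\mathbf{Irr}$ be the left ideal of $\mathbf U(gl(m_0|m_1+n))$ generated by the irregular products. The sum $Virt=\mathbf U(gl(n))+\mathbf{Irr}$ is direct and is a subalgebra, in which $\mathbf{Irr}$ is a two-sided ideal; $\mathfrak p:Virt\to\mathbf U(gl(n))$ denotes the projection with kernel $\mathbf{Irr}$ (an algebra epimorphism). Tableaux. A Young tableau of shape $\lambda$ over an alphabet is any filling of the cells of the Ferrers diagram of $\lambda$ (rows of lengths $\lambda_1\ge\lambda_2\ge\cdots$). For tableaux $S,T$ of the same shape, $e_{S,T}$ is the product of the $e_{S(c),T(c)}$ over the cells $c$, read row by row from top to bottom, left to right in each row. $D^*_\lambda$ is the tableau of shape $\lambda$ whose $r$-th row is $\beta_1\beta_2\cdots\beta_{\lambda_r}$, and $C^*_\lambda$ the tableau of shape $\lambda$ whose $r$-th row is $\alpha_r\alpha_r\cdots\alpha_r$ (the $\alpha$'s and $\beta$'s being arbitrary distinct positive, resp. negative, virtual symbols). For tableaux $S,T$ of shape $\lambda$ over $\mathcal L$, the double Young-Capelli bitableau is $[\,\boxed{S\,|\,T}\,]=\mathfrak p\big(e_{S,C^*_\lambda}e_{C^*_\lambda,D^*_\lambda}e_{D^*_\lambda,C^*_\lambda}e_{C^*_\lambda,T}\big)\in\mathbf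 U(gl(n))$; the argument of $\mathfrak p$ lies in $Virt$ and the result does not depend on the choice of virtual symbols. Schur elements: $\widetilde\lambda$ is the conjugate partition, $H(\lambda)=H(\widetilde\lambda)$ the product of all hook lengths; for $\widetilde\lambda_1\le n$, $\mathbf S_\lambda(n)=\frac1{H(\widetilde\lambda)}\sum_S[\,\boxed{S\,|\,S}\,]$, the sum over all tableaux $S$ of shape $\widetilde\lambda$ on $\{1,\dots,n\}$ with strictly increasing rows (no condition on columns); $\mathbf S_\emptyset(n)=\mathbf 1$. Capelli elements: for $\alpha\in\mathcal A_0$, $\mathbf H_k(n)=\sum_{1\le i_1<\cdots<i_k\le n}\mathfrak p\big(e_{i_k,\alpha}\cdots e_{i_1,\alpha}e_{\alpha,i_1}\cdots e_{\alpha,i_k}\big)$, $k=1,\dots,n$ (algebraically independent generators of $\boldsymbol\zeta(n)$). Nazarov elements: for $\beta\in\mathcal A_1$, $\mathbf I_k(n)=\sum_{h_1+\cdots+h_n=k}\frac1{h_1!\cdots h_n!}\,\mathfrak p\big(e_{n,\beta}^{h_n}\cdots e_{1,\beta}^{h_1}e_{\beta,1}^{h_1}\cdots e_{\beta,n}^{h_n}\big)$, $k\in\mathbb Z^+$ (sum over $n$-tuples of nonnegative integers). $\boldsymbol\pi_{n,n+1}:\boldsymbol\zeta(n+1)\to\boldsymbol\zeta(n)$ is the algebra epimorphism with $\boldsymbol\pi_{n,n+1}(\mathbf H_k(n+1))=\mathbf H_k(n)$ for $k\le n$ and $\boldsymbol\pi_{n,n+1}(\mathbf H_{n+1}(n+1))=0$;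 it coincides with the projection on the first component of the Olshanski decomposition. *)

theory Defs
  imports Complex_Main "HOL-Library.Poly_Mapping" "HOL-Library.FuncSet"
begin

section \<open>The enveloping superalgebra\<close>

text \<open>
  \<open>Pos s\<close> is the positive virtual symbol alpha_s, \<open>Neg s\<close> the negative virtual symbol beta_s
  and \<open>Prop i\<close> the proper symbol i; all indices start at 1.
\<close>

datatype symbol = Pos nat | Neg nat | Prop nat

fun parity :: "symbol \<Rightarrow> nat" where
  "parity (Pos s) = 0"
| "parity (Neg s) = 1"
| "parity (Prop i) = 1"

text \<open>
  The free unital associative complex algebra on the letters (a, b) is the algebra of finitely
  supported functions on the free monoid of words, with the convolution product of
  \<open>Poly_Mapping\<close>. The monoid of words is written additively because that product expects it.
\<close>

datatype word = Word (letters: "(symbol \<times> symbol) list")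

instantiation word :: monoid_add
begin
definition "0 = Word []"
definition "u + v = Word (letters u @ letters v)"
instance by standard (auto simp: zero_word_def plus_word_def)
end

type_synonym free_alg = "word \<Rightarrow>\<^sub>0 complex"

definition free_gen :: "symbol \<Rightarrow> symbol \<Rightarrow> free_alg" where
  "free_gen a b = Poly_Mapping.single (Word [(a, b)]) 1"

definition gl_rel :: "symbol \<Rightarrow> symbol \<Rightarrow> symbol \<Rightarrow> symbol \<Rightarrow> free_alg" where
  "gl_rel a b c d =
     (free_gen a b * free_gen c d
        - (- 1) ^ ((parity a + parity b) * (parity c + parity d)) * (free_gen c d * free_gen a b))
     - ((if b = c then free_gen a d else 0)
        - (- 1) ^ ((parity a + parity b) * (parity c + parity d))
            * (if a = d then free_gen c b else 0))"

inductive_set gl_ideal :: "free_alg set" where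
  zero: "0 \<in> gl_ideal"
| rel: "x * gl_rel a b c d * y \<in> gl_ideal"
| add: "x \<in> gl_ideal \<Longrightarrow> y \<in> gl_ideal \<Longrightarrow> x + y \<in> gl_ideal"

lemma gl_ideal_mult_left: "x \<in> gl_ideal \<Longrightarrow> z * x \<in> gl_ideal"
  by (induction rule: gl_ideal.induct)
     (simp_all add: gl_ideal.intros distrib_left mult.assoc[symmetric])

lemma gl_ideal_mult_right: "x \<in> gl_ideal \<Longrightarrow> x * z \<in> gl_ideal"
  by (induction rule: gl_ideal.induct)
     (simp_all add: gl_ideal.intros distrib_right mult.assoc gl_ideal.rel[unfolded mult.assoc])

lemma gl_ideal_uminus: "x \<in> gl_ideal \<Longrightarrow> - x \<in> gl_ideal"
  using gl_ideal_mult_left[of x "- 1"] by simp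

lemma gl_ideal_diff: "x \<in> gl_ideal \<Longrightarrow> y \<in> gl_ideal \<Longrightarrow> x - y \<in> gl_ideal"
  using gl_ideal.add[of x "- y"] gl_ideal_uminus by simp

lemma word_add_eq_0: "u + v = 0 \<longleftrightarrow> u = 0 \<and> v = (0 :: word)"
  by (cases u; cases v) (auto simp: zero_word_def plus_word_def)

lemma lookup_mult_0:
  "Poly_Mapping.lookup (x * y :: free_alg) 0 = Poly_Mapping.lookup x 0 * Poly_Mapping.lookup y 0"
proof -
  have *: "(\<Sum>q. (Poly_Mapping.lookup y q when 0 = l + q)) = (Poly_Mapping.lookup y 0 when l = 0)"
    for l :: word
  proof (cases "l = 0")
    case False
    then have "0 \<noteq> l + q" for q using word_add_eq_0 by metis
    with False show ?thesis by simp
  qed (simp add: when_def)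
  show ?thesis by (simp only: lookup_mult * mult_when) simp
qed

lemma one_notin_gl_ideal: "1 \<notin> gl_ideal"
proof -
  have g: "Poly_Mapping.lookup (free_gen a b) 0 = 0" for a b
    by (simp add: free_gen_def lookup_single zero_word_def when_def)
  have r: "Poly_Mapping.lookup (gl_rel a b c d) 0 = 0" for a b c d
    by (simp add: gl_rel_def lookup_minus lookup_mult_0 g)
  have "Poly_Mapping.lookup x 0 = 0" if "x \<in> gl_ideal" for x
    using that by induction (simp_all add: lookup_add lookup_mult_0 r)
  then show ?thesis by (metis lookup_one_zero zero_neq_one)
qed

definition gl_cong :: "free_alg \<Rightarrow> free_alg \<Rightarrow> bool" where
  "gl_cong x y \<longleftrightarrow> x - y \<in> gl_ideal"

text \<open>
  The type \<open>env\<close> is the enveloping superalgebra of the general linear Lie superalgebra on all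
  symbols, the union of the algebras U(gl(m0|m1+n)) over all m0, m1 and n. By the
  Poincare-Birkhoff-Witt theorem, the enveloping superalgebra of the Lie superalgebra on an
  alphabet A is the subalgebra generated by the e a b with a and b in A; this realizes U(gl(n))
  inside U(gl(n+1)) and inside U(gl(m0|m1+n)) as honest subalgebras.
\<close>

quotient_type env = free_alg / gl_cong
proof (rule equivpI)
  show "reflp gl_cong"
    by (rule reflpI) (simp add: gl_cong_def gl_ideal.zero)
  show "symp gl_cong"
    by (rule sympI) (metis gl_cong_def gl_ideal_uminus minus_diff_eq)
  show "transp gl_cong"
  proof (rule transpI)
    fix x y z assume "gl_cong x y" "gl_cong y z"
    then show "gl_cong x z" using gl_ideal.add[of "x - y" "y - z"] by (simp add: gl_cong_def)
  qed
qed

lemma gl_cong_add: "gl_cong x x' \<Longrightarrow> gl_cong y y' \<Longrightarrow> gl_cong (x + y) (x' + y')"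
  using gl_ideal.add[of "x - x'" "y - y'"] by (simp add: gl_cong_def algebra_simps)

lemma gl_cong_diff: "gl_cong x x' \<Longrightarrow> gl_cong y y' \<Longrightarrow> gl_cong (x - y) (x' - y')"
  using gl_ideal_diff[of "x - x'" "y - y'"] by (simp add: gl_cong_def algebra_simps)

lemma gl_cong_uminus: "gl_cong x x' \<Longrightarrow> gl_cong (- x) (- x')"
  using gl_ideal_uminus[of "x - x'"] by (simp add: gl_cong_def)

lemma gl_cong_mult:
  assumes "gl_cong x x'" "gl_cong y y'"
  shows "gl_cong (x * y) (x' * y')"
proof -
  have "x * y - x' * y' = (x - x') * y + x' * (y - y')" by (simp add: algebra_simps)
  then show ?thesis
    using assms gl_ideal.add gl_ideal_mult_left gl_ideal_mult_right unfolding gl_cong_def by metis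
qed

instantiation env :: ring_1
begin

lift_definition zero_env :: env is 0 .
lift_definition one_env :: env is 1 .
lift_definition plus_env :: "env \<Rightarrow> env \<Rightarrow> env" is "(+)" by (rule gl_cong_add)
lift_definition minus_env :: "env \<Rightarrow> env \<Rightarrow> env" is "(-)" by (rule gl_cong_diff)
lift_definition uminus_env :: "env \<Rightarrow> env" is uminus by (rule gl_cong_uminus)
lift_definition times_env :: "env \<Rightarrow> env \<Rightarrow> env" is "(*)" by (rule gl_cong_mult)

lemmas env_abs_simps =
  zero_env.abs_eq one_env.abs_eq plus_env.abs_eq minus_env.abs_eq uminus_env.abs_eq times_env.abs_eq

instance
proof
  fix x y z :: env
  show "x * y * z = x * (y * z)"
    by (induct x, induct y, induct z) (simp add: env_abs_simps mult.assoc)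
  show "x + y + z = x + (y + z)"
    by (induct x, induct y, induct z) (simp add: env_abs_simps add.assoc)
  show "x + y = y + x"
    by (induct x, induct y) (simp add: env_abs_simps add.commute)
  show "(x + y) * z = x * z + y * z"
    by (induct x, induct y, induct z) (simp add: env_abs_simps distrib_right)
  show "x * (y + z) = x * y + x * z"
    by (induct x, induct y, induct z) (simp add: env_abs_simps distrib_left)
  show "0 + x = x" "- x + x = 0" "1 * x = x" "x * 1 = x"
    by (induct x, simp add: env_abs_simps)+
  show "x - y = x + - y"
    by (induct x, induct y) (simp add: env_abs_simps)
  show "(0 :: env) \<noteq> 1"
    unfolding env_abs_simps env.abs_eq_iff gl_cong_def
    using gl_ideal_uminus one_notin_gl_ideal by fastforce
qed

end

lift_definition env_scale :: "complex \<Rightarrow> env \<Rightarrow> env" is "\<lambda>c x. Poly_Mapping.single 0 c * x"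
  by (rule gl_cong_mult) (simp_all add: gl_cong_def gl_ideal.zero)

interpretation env: vector_space env_scale
proof
  fix a b :: complex and x y :: env
  show "env_scale a (x + y) = env_scale a x + env_scale a y"
    by (induct x, induct y) (simp add: env_scale.abs_eq env_abs_simps distrib_left)
  show "env_scale (a + b) x = env_scale a x + env_scale b x"
    by (induct x) (simp add: env_scale.abs_eq env_abs_simps single_add distrib_right)
  show "env_scale a (env_scale b x) = env_scale (a * b) x"
    by (induct x) (simp add: env_scale.abs_eq mult.assoc[symmetric] mult_single)
  show "env_scale 1 x = x"
    by (induct x) (simp add: env_scale.abs_eq)
qed

lift_definition e :: "symbol \<Rightarrow> symbol \<Rightarrow> env" is free_gen .

lemma e_superbracket:
  "e a b * e c d - (- 1) ^ ((parity a + parity b) * (parity c + parity d)) * (e c d * e a b)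
   = (if b = c then e a d else 0)
     - (- 1) ^ ((parity a + parity b) * (parity c + parity d)) * (if a = d then e c b else 0)"
proof -
  have pow: "abs_env ((- 1) ^ k) = (- 1) ^ k" for k :: nat
    by (induction k) (simp_all flip: one_env.abs_eq uminus_env.abs_eq)
  have "gl_rel a b c d \<in> gl_ideal" using gl_ideal.rel[of 1 a b c d 1] by simp
  then have "abs_env (gl_rel a b c d) = 0"
    by (simp add: zero_env.abs_eq env.abs_eq_iff gl_cong_def)
  moreover have "(if P then e a' b' else 0) = abs_env (if P then free_gen a' b' else 0)" for P a' b'
    by (simp add: e.abs_eq zero_env.abs_eq)
  ultimately show ?thesis
    by (simp only: gl_rel_def e.abs_eq pow[symmetric] minus_env.abs_eq[symmetric] times_env.abs_eq[symmetric]
        right_minus_eq)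
qed

inductive_set subalgebra_gen :: "env set \<Rightarrow> env set" for X :: "env set" where
  one: "1 \<in> subalgebra_gen X"
| gen: "x \<in> X \<Longrightarrow> x \<in> subalgebra_gen X"
| add: "x \<in> subalgebra_gen X \<Longrightarrow> y \<in> subalgebra_gen X \<Longrightarrow> x + y \<in> subalgebra_gen X"
| mult: "x \<in> subalgebra_gen X \<Longrightarrow> y \<in> subalgebra_gen X \<Longrightarrow> x * y \<in> subalgebra_gen X"
| scale: "x \<in> subalgebra_gen X \<Longrightarrow> env_scale c x \<in> subalgebra_gen X"

definition left_ideal_gen :: "env set \<Rightarrow> env set \<Rightarrow> env set" where
  "left_ideal_gen A X = env.span {u * x | u x. u \<in> A \<and> x \<in> X}"

definition proper_symbols :: "nat \<Rightarrow> symbol set" where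
  "proper_symbols n = Prop ` {1..n}"

definition virtual_symbols :: "nat \<Rightarrow> nat \<Rightarrow> symbol set" where
  "virtual_symbols m0 m1 = Pos ` {1..m0} \<union> Neg ` {1..m1}"

definition U_on :: "symbol set \<Rightarrow> env set" where
  "U_on A = subalgebra_gen {e a b | a b. a \<in> A \<and> b \<in> A}"

definition U_gl :: "nat \<Rightarrow> env set" where
  "U_gl n = U_on (proper_symbols n)"

definition U_super :: "nat \<Rightarrow> nat \<Rightarrow> nat \<Rightarrow> env set" where
  "U_super m0 m1 n = U_on (virtual_symbols m0 m1 \<union> proper_symbols n)"

definition zeta :: "nat \<Rightarrow> env set" where
  "zeta n = {z \<in> U_gl n. \<forall>u \<in> U_gl n. z * u = u * z}"


section \<open>The Olshanski decomposition\<close>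

definition U_gl_0 :: "nat \<Rightarrow> env set" where
  "U_gl_0 N = {u \<in> U_gl N. u * e (Prop N) (Prop N) = e (Prop N) (Prop N) * u}"

definition ideal_I :: "nat \<Rightarrow> env set" where
  "ideal_I N = left_ideal_gen (U_gl N) {e (Prop i) (Prop N) | i. i \<in> {1..N}}"

definition ideal_I_0 :: "nat \<Rightarrow> env set" where
  "ideal_I_0 N = ideal_I N \<inter> U_gl_0 N"

definition olshanski_decomposition :: "nat \<Rightarrow> env \<Rightarrow> env \<Rightarrow> env \<Rightarrow> bool" where
  "olshanski_decomposition n z x y \<longleftrightarrow>
     z \<in> zeta (n + 1) \<and> z = x + y \<and> x \<in> U_gl n \<and> y \<in> ideal_I_0 (n + 1)"


section \<open>Devirtualization\<close>

definition e_word :: "(symbol \<times> symbol) list \<Rightarrow> env" where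
  "e_word w = prod_list (map (\<lambda>(a, b). e a b) w)"

text \<open>
  Factors of a product are numbered from the right, so the first \<open>i\<close> factors of a word \<open>w\<close> are
  the first \<open>i\<close> entries of \<open>rev w\<close>.
\<close>

definition irregular :: "nat \<Rightarrow> nat \<Rightarrow> (symbol \<times> symbol) list \<Rightarrow> bool" where
  "irregular m0 m1 w \<longleftrightarrow>
     (\<exists>i \<in> {1..length w}. \<exists>\<gamma> \<in> virtual_symbols m0 m1.
        length (filter (\<lambda>(a, b). b = \<gamma>) (take i (rev w)))
          > length (filter (\<lambda>(a, b). a = \<gamma>) (take (i - 1) (rev w))))"

definition Irr :: "nat \<Rightarrow> nat \<Rightarrow> nat \<Rightarrow> env set" where
  "Irr m0 m1 n = left_ideal_gen (U_super m0 m1 n)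
     {e_word w | w. irregular m0 m1 w
        \<and> set w \<subseteq> (virtual_symbols m0 m1 \<union> proper_symbols n)
                  \<times> (virtual_symbols m0 m1 \<union> proper_symbols n)}"

text \<open>
  The projection of Virt = U(gl(n)) + Irr onto U(gl(n)) with kernel Irr; its value outside Virt
  is irrelevant.
\<close>

definition devirt :: "nat \<Rightarrow> nat \<Rightarrow> nat \<Rightarrow> env \<Rightarrow> env" where
  "devirt m0 m1 n x = (THE y. y \<in> U_gl n \<and> x - y \<in> Irr m0 m1 n)"


section \<open>Partitions and tableaux\<close>

definition is_partition :: "nat list \<Rightarrow> bool" where
  "is_partition lam \<longleftrightarrow> sorted_wrt (\<ge>) lam \<and> (\<forall>r \<in> set lam. 0 < r)"

definition part :: "nat list \<Rightarrow> nat \<Rightarrow> nat" where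
  "part lam i = (if i \<in> {1..length lam} then lam ! (i - 1) else 0)"

definition conjugate :: "nat list \<Rightarrow> nat list" where
  "conjugate lam = map (\<lambda>j. card {i \<in> {1..length lam}. j \<le> part lam i}) [1..<part lam 1 + 1]"

text \<open>Arm length plus leg length plus one, over the cells (i, j); no subtraction truncates.\<close>

definition hook_product :: "nat list \<Rightarrow> nat" where
  "hook_product lam =
     (\<Prod>i = 1..length lam. \<Prod>j = 1..part lam i.
        (part lam i - j) + (part (conjugate lam) j - i) + 1)"

text \<open>
  A tableau is the list of its rows, so \<open>concat\<close> yields its reading word and its shape is the
  list of the row lengths.
\<close>

definition e_tab :: "symbol list list \<Rightarrow> symbol list list \<Rightarrow> env" where
  "e_tab S T = e_word (zip (concat S) (concat T))"

definition Dstar :: "nat list \<Rightarrow> symbol list list" where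
  "Dstar mu = map (\<lambda>r. map Neg [1..<part mu r + 1]) [1..<length mu + 1]"

definition Cstar :: "nat list \<Rightarrow> symbol list list" where
  "Cstar mu = map (\<lambda>r. replicate (part mu r) (Pos r)) [1..<length mu + 1]"

definition double_bitableau ::
    "nat \<Rightarrow> nat \<Rightarrow> nat \<Rightarrow> nat list \<Rightarrow> nat list list \<Rightarrow> nat list list \<Rightarrow> env" where
  "double_bitableau m0 m1 n mu S T =
     devirt m0 m1 n
       (e_tab (map (map Prop) S) (Cstar mu) * e_tab (Cstar mu) (Dstar mu)
        * e_tab (Dstar mu) (Cstar mu) * e_tab (Cstar mu) (map (map Prop) T))"

definition row_strict_tableaux :: "nat \<Rightarrow> nat list \<Rightarrow> nat list list set" where
  "row_strict_tableaux n mu =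
     {S. map length S = mu \<and> (\<forall>row \<in> set S. sorted_wrt (<) row \<and> set row \<subseteq> {1..n})}"


section \<open>Schur, Capelli and Nazarov elements\<close>

text \<open>
  For the empty partition the sum below has the single term given by the empty tableau, which is
  the devirtualization of the empty product.
\<close>

definition schur_S :: "nat \<Rightarrow> nat \<Rightarrow> nat \<Rightarrow> nat list \<Rightarrow> env" where
  "schur_S m0 m1 n lam =
     env_scale (1 / of_nat (hook_product (conjugate lam)))
       (\<Sum>S \<in> row_strict_tableaux n (conjugate lam). double_bitableau m0 m1 n (conjugate lam) S S)"

definition capelli_H :: "nat \<Rightarrow> nat \<Rightarrow> nat \<Rightarrow> nat \<Rightarrow> env" where
  "capelli_H m0 m1 n k =
     (\<Sum>is \<in> {is. length is = k \<and> sorted_wrt (<) is \<and> set is \<subseteq> {1..n}}.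
        devirt m0 m1 n
          (e_word (map (\<lambda>i. (Prop i, Pos 1)) (rev is))
           * e_word (map (\<lambda>i. (Pos 1, Prop i)) is)))"

definition nazarov_I :: "nat \<Rightarrow> nat \<Rightarrow> nat \<Rightarrow> nat \<Rightarrow> env" where
  "nazarov_I m0 m1 n k =
     (\<Sum>h \<in> {h \<in> {1..n} \<rightarrow>\<^sub>E UNIV. (\<Sum>i = 1..n. h i) = k}.
        env_scale (1 / (\<Prod>i = 1..n. fact (h i)))
          (devirt m0 m1 n
            (prod_list (map (\<lambda>i. e (Prop i) (Neg 1) ^ h i) (rev [1..<n + 1]))
             * prod_list (map (\<lambda>i. e (Neg 1) (Prop i) ^ h i) [1..<n + 1]))))"

definition algebra_epi :: "env set \<Rightarrow> env set \<Rightarrow> (env \<Rightarrow> env) \<Rightarrow> bool" where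
  "algebra_epi A B f \<longleftrightarrow>
     f ` A = B \<and> f 1 = 1
     \<and> (\<forall>x \<in> A. \<forall>y \<in> A. f (x + y) = f x + f y \<and> f (x * y) = f x * f y)
     \<and> (\<forall>c. \<forall>x \<in> A. f (env_scale c x) = env_scale c (f x))"

text \<open>Functions on \<open>zeta (n + 1)\<close> are represented extensionally, which makes the map unique.\<close>

definition capelli_pi :: "nat \<Rightarrow> nat \<Rightarrow> nat \<Rightarrow> env \<Rightarrow> env" where
  "capelli_pi m0 m1 n =
     (THE f. f \<in> extensional (zeta (n + 1))
        \<and> algebra_epi (zeta (n + 1)) (zeta n) f
        \<and> (\<forall>k \<in> {1..n}. f (capelli_H m0 m1 (n + 1) k) = capelli_H m0 m1 n k)
        \<and> f (capelli_H m0 m1 (n + 1) (n + 1)) = 0)"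

end

theory Submission
  imports Defs "HOL-Library.Countable" "HOL-Combinatorics.Multiset_Permutations"
begin

text \<open>
  Let gl act on the supersymmetric algebra in variables \<open>Y(a,j)\<close>, with \<open>a\<close> any symbol and \<open>j\<close>
  one of the columns \<open>1..n\<close>, by \<open>e a b = Y(a,b) + (\<Sum>j. Y(a,j) \<partial>(b,j))\<close>, where \<open>Y(a,b) = 0\<close> unless
  \<open>b\<close> is a column. By the Poincare-Birkhoff-Witt argument, \<open>x \<mapsto> x 1\<close> has as its kernel the left
  ideal generated by the \<open>e a b\<close> such that \<open>b\<close> is not a column. With virtual symbols outside the
  columns this kernel is \<open>Irr\<close>, so devirtualization is evaluation at \<open>1\<close>; with \<open>n + 1\<close> outside the
  columns it is \<open>\<I>(n+1)\<close>, so the Olshanski projection is evaluation at \<open>1\<close> as well.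

  Up to nonzero factors, the Nazarov, Capelli and Schur elements are represented by nested sums
  \<open>\<Sum>i. e i c \<cdots> e c i\<close> over \<open>i = 1..n\<close>. Such sums commute with gl(n), and the terms with
  \<open>i = n + 1\<close> vanish at \<open>1\<close>. Hence these elements are central and compatible with the projection.

  The map \<open>capelli_pi\<close> is well defined because the Capelli elements generate the center: central
  elements correspond to conjugation invariant polynomials, an invariant polynomial is determined by
  its values on companion matrices, and there the leading parts of the Capelli elements are, up to
  sign, the free coordinates.
\<close>

section \<open>Super creation and annihilation operators\<close>

text \<open>With t the sum of Y(j,j) over the columns j, the operator of e a b is formally exp(-t) P
  exp(t), where P = \<Sum>j. Y(a,j) \<partial>(b,j): conjugation adds 1 to \<partial>(b,j) when b =
  j. This is the origin of the term Y(a,b) and the reason why the relations of gl persist. Plain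
  polarizations annihilate 1; after the shift, evaluation at 1 separates the ordered monomials in
  the letters whose second index is a column. Right polarizations, conjugated in the same way, give
  right multiplication, and the difference of left and right is infinitesimal conjugation of
  matrices.

  The set of columns is independent of the alphabet that acts. An element built with n + 1 proper
  symbols and virtual ones can still be evaluated with n columns only, and this freedom compares the
  families for n and n + 1.

  \<open>devirt\<close> is a definite description. The kernel of evaluation at 1 must therefore be
  known exactly, and a preimage in U(gl(n)) must be found for each product that is devirtualized; it
  exists because each virtual symbol occurs equally often as first and as second index.\<close>

instance symbol :: countable
  by countable_datatype

type_synonym var = "symbol \<times> symbol"
type_synonym vec = "var multiset \<Rightarrow> complex"

definition odd_var :: "var \<Rightarrow> bool" where
  "odd_var v \<longleftrightarrow> odd (parity (fst v) + parity (snd v))"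

text \<open>The Jordan-Wigner sign: the cost of moving \<open>v\<close> past the odd variables of
  \<open>m\<close> that precede it in a fixed order, here the one given by \<open>to_nat\<close>.
  Copies of \<open>v\<close> itself are not counted, so creation and annihilation of
  \<open>v\<close> carry the same sign.\<close>

definition vsgn :: "var \<Rightarrow> var multiset \<Rightarrow> complex" where
  "vsgn v m = (if odd_var v then (- 1) ^ size {#u \<in># m. odd_var u \<and> to_nat u < to_nat v#} else 1)"

text \<open>The factor by which \<open>vsgn v\<close> changes when \<open>u\<close> joins the
  monomial.\<close>

definition veta :: "var \<Rightarrow> var \<Rightarrow> complex" where
  "veta u v = (if odd_var u \<and> odd_var v \<and> to_nat u < to_nat v then - 1 else 1)"

definition veps :: "var \<Rightarrow> var \<Rightarrow> complex" where
  "veps u v = (if odd_var u \<and> odd_var v then - 1 else 1)"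

text \<open>An odd variable may have any multiplicity: 2k and 2k + 1 serve as empty and occupied,
  and creation on an occupied place gives 0. The canonical relations then hold on all functions,
  without a quotient by the squares of the odd variables.\<close>

definition cr :: "var \<Rightarrow> vec \<Rightarrow> vec" where
  "cr v f m = (if v \<in># m \<and> (odd_var v \<longrightarrow> odd (count m v)) then vsgn v m * f (m - {#v#}) else 0)"

definition ancoef :: "var \<Rightarrow> var multiset \<Rightarrow> complex" where
  "ancoef v m = (if odd_var v then (if even (count m v) then vsgn v m else 0) else of_nat (count m v + 1))"

definition an :: "var \<Rightarrow> vec \<Rightarrow> vec" where
  "an v f m = ancoef v m * f (add_mset v m)"

lemma vsgn_add: "vsgn v (add_mset u m) = veta u v * vsgn v m"
  by (auto simp: vsgn_def veta_def)

lemma veta_refl [simp]: "veta v v = 1"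
  by (simp add: veta_def)

lemma vsgn_sq: "vsgn v m * vsgn v m = 1"
  by (auto simp: vsgn_def simp flip: power_add mult_2)

lemma vsgn_sq': "vsgn v m * (vsgn v m * x) = x"
  using vsgn_sq[of v m] by (simp flip: mult.assoc)

lemma vsgn_even [simp]: "\<not> odd_var v \<Longrightarrow> vsgn v m = 1"
  by (simp add: vsgn_def)

lemma veta_swap: "u \<noteq> v \<Longrightarrow> veta u v = veps u v * veta v u"
proof -
  assume "u \<noteq> v"
  then have "to_nat u \<noteq> to_nat v" by (metis from_nat_to_nat)
  then show ?thesis by (auto simp: veta_def veps_def)
qed

lemma veps_commute: "veps u v = veps v u"
  by (auto simp: veps_def)

lemma veta_sq: "veta u v * veta u v = 1"
  by (auto simp: veta_def)

lemma veps_sq [simp]: "veps u v * veps u v = 1" "veps u v * (veps u v * x) = x"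
  by (auto simp: veps_def)

lemma cr_add_mset: "cr v f (add_mset v m) = (if odd_var v \<longrightarrow> even (count m v) then vsgn v m * f m else 0)"
  by (simp add: cr_def vsgn_add)

lemma cr_notin: "v \<notin># m \<Longrightarrow> cr v f m = 0"
  by (simp add: cr_def)

text \<open>Of two distinct odd variables exactly one, the later one, counts the other in its sign,
  so the two orders differ by \<open>veps\<close>. For an odd u = v both sides are 0.\<close>

lemma cr_cr: "cr u (cr v f) = (\<lambda>m. veps u v * cr v (cr u f) m)"
proof
  fix m
  show "cr u (cr v f) m = veps u v * cr v (cr u f) m"
  proof (cases "u = v")
    case True
    then show ?thesis by (auto simp: veps_def cr_def)
  next
    case False
    show ?thesis
    proof (cases "u \<in># m \<and> v \<in># m")
      case True
      then obtain m' where m: "m = add_mset u (add_mset v m')"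
        using False by (metis insert_noteq_member mset_add)
      have m2: "m = add_mset v (add_mset u m')" by (simp add: m add_mset_commute)
      have l: "cr u (cr v f) m = (if (odd_var u \<longrightarrow> even (count m' u)) \<and> (odd_var v \<longrightarrow> even (count m' v))
        then veta v u * vsgn u m' * vsgn v m' * f m' else 0)"
        unfolding m using False by (simp add: cr_add_mset vsgn_add)
      have r: "cr v (cr u f) m = (if (odd_var u \<longrightarrow> even (count m' u)) \<and> (odd_var v \<longrightarrow> even (count m' v))
        then veta u v * vsgn u m' * vsgn v m' * f m' else 0)"
        unfolding m2 using False by (simp add: cr_add_mset vsgn_add)
      show ?thesis unfolding l r using False by (simp add: veta_swap[of v u] veps_commute[of v u])
    next
      case F: False
      then show ?thesis using False by (auto simp: cr_def dest: in_diffD)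
    qed
  qed
qed

lemma an_an: "an u (an v f) = (\<lambda>m. veps u v * an v (an u f) m)"
proof
  fix m
  show "an u (an v f) m = veps u v * an v (an u f) m"
  proof (cases "u = v")
    case True
    then show ?thesis by (auto simp: veps_def an_def ancoef_def)
  next
    case False
    have "ancoef u m * ancoef v (add_mset u m) = veps u v * (ancoef v m * ancoef u (add_mset v m))"
      using False by (simp add: ancoef_def vsgn_add veta_swap[of u v]) (auto simp: veps_def veta_def)
    then show ?thesis by (simp add: an_def add_mset_commute flip: mult.assoc)
  qed
qed

text \<open>The canonical relations. For an odd u = v, annihilation after creation is the identity
  on even multiplicities and 0 on odd ones, and creation after annihilation is the reverse, so that
  the sum is the identity.\<close>

lemma an_cr: "an u (cr v f) = (\<lambda>m. (if u = v then f m else 0) + veps u v * cr v (an u f) m)"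
proof
  fix m
  show "an u (cr v f) m = (if u = v then f m else 0) + veps u v * cr v (an u f) m"
  proof (cases "u = v")
    case True
    show ?thesis
    proof (cases "v \<in># m")
      case v: True
      then obtain m' where "m = add_mset v m'" by (metis mset_add)
      then show ?thesis using True
        by (simp add: an_def ancoef_def cr_add_mset vsgn_add vsgn_sq' veps_def algebra_simps)
    next
      case False
      then have "count m v = 0" by (simp add: not_in_iff)
      with True False show ?thesis
        by (simp add: an_def ancoef_def cr_add_mset cr_notin vsgn_sq vsgn_sq')
    qed
  next
    case False
    show ?thesis
    proof (cases "v \<in># m")
      case True
      then obtain m' where m: "m = add_mset v m'" by (metis mset_add)
      have "cr v f (add_mset u m) = (if odd_var v \<longrightarrow> even (count m' v)
          then veta u v * vsgn v m' * f (add_mset u m') else 0)"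
        unfolding m by (subst add_mset_commute) (use False in \<open>simp add: cr_add_mset vsgn_add\<close>)
      then show ?thesis
        using False veta_swap[of u v] veta_sq[of v u]
        by (simp add: m an_def cr_add_mset ancoef_def vsgn_add) (auto simp: veps_def veta_def)
    next
      case F: False
      then show ?thesis using False by (auto simp: an_def cr_def)
    qed
  qed
qed

section \<open>Linear operators on coefficient functions\<close>

definition lin :: "(vec \<Rightarrow> vec) \<Rightarrow> bool" where
  "lin T \<longleftrightarrow> (\<forall>f g c. T (\<lambda>m. f m + c * g m) = (\<lambda>m. T f m + c * T g m))"

lemma linI: "(\<And>f g c m. T (\<lambda>m. f m + c * g m) m = T f m + c * T g m) \<Longrightarrow> lin T"
  by (auto simp: lin_def)

lemma lin_zero: "lin T \<Longrightarrow> T (\<lambda>m. 0) = (\<lambda>m. 0)"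
  \<comment> \<open>With c = -1 and zero arguments, linearity reads T 0 = T 0 - T 0.\<close>
  using fun_cong[OF lin_def[THEN iffD1, rule_format, of T "\<lambda>m. 0" "-1" "\<lambda>m. 0"]] by auto

lemma lin_add: "lin T \<Longrightarrow> T (\<lambda>m. f m + g m) = (\<lambda>m. T f m + T g m)"
  using lin_def[THEN iffD1, rule_format, of T f 1 g] by simp

lemma lin_scale: "lin T \<Longrightarrow> T (\<lambda>m. c * f m) = (\<lambda>m. c * T f m)"
  using lin_def[THEN iffD1, rule_format, of T "\<lambda>m. 0" c f] lin_zero[of T] by simp

lemma lin_diff: "lin T \<Longrightarrow> T (\<lambda>m. f m - g m) = (\<lambda>m. T f m - T g m)"
  using lin_def[THEN iffD1, rule_format, of T f "-1" g] by simp

lemma lin_sum: "lin T \<Longrightarrow> T (\<lambda>m. \<Sum>i\<in>I. f i m) = (\<lambda>m. \<Sum>i\<in>I. T (f i) m)"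
proof (induction I rule: infinite_finite_induct)
  case (insert i I)
  then show ?case using lin_add[of T "f i" "\<lambda>m. \<Sum>i\<in>I. f i m"] by simp
qed (simp_all add: lin_zero)

lemma lin_comp: "lin S \<Longrightarrow> lin T \<Longrightarrow> lin (\<lambda>f. S (T f))"
  by (simp add: lin_def)

lemma lin_plus: "lin S \<Longrightarrow> lin T \<Longrightarrow> lin (\<lambda>f m. S f m + T f m)"
  by (simp add: lin_def algebra_simps)

lemma lin_minus: "lin S \<Longrightarrow> lin T \<Longrightarrow> lin (\<lambda>f m. S f m - T f m)"
  by (simp add: lin_def algebra_simps)

lemma lin_setsum: "(\<And>i. i \<in> I \<Longrightarrow> lin (S i)) \<Longrightarrow> lin (\<lambda>f m. \<Sum>i\<in>I. S i f m)"
  by (simp add: lin_def sum.distrib sum_distrib_left)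

lemma lin_cr: "lin (cr v)"
  by (rule linI) (auto simp: cr_def algebra_simps)

lemma lin_an: "lin (an v)"
  by (rule linI) (simp add: an_def algebra_simps)

section \<open>Polarization operators and the relations of gl\<close>

definition cols :: "nat \<Rightarrow> symbol set" where
  "cols n = Prop ` {1..n}"

lemma finite_cols [simp]: "finite (cols n)"
  by (simp add: cols_def)

lemma parity_cols: "c \<in> cols n \<Longrightarrow> parity c = 1"
  by (auto simp: cols_def)

definition pol :: "nat \<Rightarrow> symbol \<Rightarrow> symbol \<Rightarrow> vec \<Rightarrow> vec" where
  "pol n a b f = (\<lambda>m. \<Sum>j\<in>cols n. cr (a, j) (an (b, j) f) m)"

definition E :: "nat \<Rightarrow> symbol \<Rightarrow> symbol \<Rightarrow> vec \<Rightarrow> vec" where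
  "E n a b f = (\<lambda>m. (if b \<in> cols n then cr (a, b) f m else 0) + pol n a b f m)"

lemma lin_pol: "lin (pol n a b)"
  unfolding pol_def by (intro lin_setsum lin_comp[OF lin_cr] lin_an)

lemma lin_E: "lin (E n a b)"
  unfolding E_def
  by (intro lin_plus lin_pol, cases "b \<in> cols n") (use lin_cr in \<open>simp_all add: lin_def\<close>)

definition ssgn :: "symbol \<Rightarrow> symbol \<Rightarrow> symbol \<Rightarrow> symbol \<Rightarrow> complex" where
  "ssgn a b c d = (- 1) ^ ((parity a + parity b) * (parity c + parity d))"

lemma veps_cols:
  assumes "j \<in> cols n" "l \<in> cols n"
  shows "veps (a, j) (c, l) = (- 1) ^ ((parity a + 1) * (parity c + 1))"
  using assms by (auto simp: veps_def odd_var_def parity_cols)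

text \<open>Columns are odd, so Y(a,j) has parity |a| + 1. The sign for moving Y(a,j)
  \<partial>(b,j) past Y(c,l) then depends on a and b only through |a| + |b|, the parity of e a
  b.\<close>

lemma veps_mult_cols:
  assumes "j \<in> cols n" "l \<in> cols n" "k \<in> cols n"
  shows "veps (a, j) (c, l) * veps (b, k) (c, l) = (- 1) ^ ((parity a + parity b) * (parity c + 1))"
  by (cases a; cases b; cases c) (simp_all add: veps_cols[OF assms(1,2)] veps_cols[OF assms(3,2)])

text \<open>A polarization is a superderivation that replaces row b by row a.\<close>

lemma pol_cr:
  assumes d: "d \<in> cols n"
  shows "pol n a b (cr (c, d) f) =
    (\<lambda>m. (if b = c then cr (a, d) f m else 0) + ssgn a b c d * cr (c, d) (pol n a b f) m)"
proof
  fix m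
  have *: "cr (a, j) (an (b, j) (cr (c, d) f)) m =
     (if b = c \<and> j = d then cr (a, d) f m else 0) + ssgn a b c d * cr (c, d) (cr (a, j) (an (b, j) f)) m"
    if j: "j \<in> cols n" for j
  proof -
    have "cr (a, j) (an (b, j) (cr (c, d) f)) m =
      cr (a, j) (\<lambda>m. (if (b,j) = (c,d) then f m else 0)) m + veps (b, j) (c, d) * cr (a, j) (cr (c, d) (an (b, j) f)) m"
      unfolding an_cr by (simp only: lin_add[OF lin_cr] lin_scale[OF lin_cr])
    also have "cr (a, j) (cr (c, d) (an (b, j) f)) m = veps (a, j) (c, d) * cr (c, d) (cr (a, j) (an (b, j) f)) m"
      by (simp only: cr_cr[of "(a, j)"])
    also have "veps (b, j) (c, d) * (veps (a, j) (c, d) * cr (c, d) (cr (a, j) (an (b, j) f)) m) =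
       ssgn a b c d * cr (c, d) (cr (a, j) (an (b, j) f)) m"
      using veps_mult_cols[OF j d j, of b c a] parity_cols[OF d]
      by (simp add: ssgn_def add.commute mult.assoc[symmetric])
    also have "cr (a, j) (\<lambda>m. (if (b,j) = (c,d) then f m else 0)) m = (if b = c \<and> j = d then cr (a, d) f m else 0)"
      using lin_zero[OF lin_cr, of "(a, j)"] by auto
    finally show ?thesis .
  qed
  show "pol n a b (cr (c, d) f) m =
    (if b = c then cr (a, d) f m else 0) + ssgn a b c d * cr (c, d) (pol n a b f) m"
    unfolding pol_def lin_sum[OF lin_cr] using d
    by (simp add: * sum.distrib sum_distrib_left flip: sum_distrib_left)
qed

lemma an_pol:
  assumes j: "j \<in> cols n"
  shows "an (d, j) (pol n a b f) =
    (\<lambda>m. (if d = a then an (b, j) f m else 0) + ssgn a b d j * pol n a b (an (d, j) f) m)"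
proof
  fix m
  have *: "an (d, j) (cr (a, l) (an (b, l) f)) m =
     (if d = a \<and> j = l then an (b, j) f m else 0) + ssgn a b d j * cr (a, l) (an (b, l) (an (d, j) f)) m"
    if l: "l \<in> cols n" for l
  proof -
    have "an (d, j) (cr (a, l) (an (b, l) f)) m =
      (if (d, j) = (a, l) then an (b, l) f m else 0) + veps (d, j) (a, l) * cr (a, l) (an (d, j) (an (b, l) f)) m"
      by (simp only: an_cr)
    also have "cr (a, l) (an (d, j) (an (b, l) f)) m = veps (d, j) (b, l) * cr (a, l) (an (b, l) (an (d, j) f)) m"
      by (simp only: an_an[of "(d, j)"] lin_scale[OF lin_cr])
    also have "veps (d, j) (a, l) * (veps (d, j) (b, l) * cr (a, l) (an (b, l) (an (d, j) f)) m) =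
       ssgn a b d j * cr (a, l) (an (b, l) (an (d, j) f)) m"
      using veps_mult_cols[OF l j l, of a d b] parity_cols[OF j]
      by (simp add: ssgn_def veps_commute[of "(d, j)"] mult.assoc[symmetric])
    finally show ?thesis by auto
  qed
  show "an (d, j) (pol n a b f) m =
    (if d = a then an (b, j) f m else 0) + ssgn a b d j * pol n a b (an (d, j) f) m"
    unfolding pol_def lin_sum[OF lin_an] using j
    by (simp add: * sum.distrib sum_distrib_left flip: sum_distrib_left)
qed

lemma ssgn_sq [simp]: "ssgn a b c d * ssgn a b c d = 1" "ssgn a b c d * (ssgn a b c d * x) = x"
  by (simp_all add: ssgn_def flip: mult.assoc power_add mult_2)

lemma ssgn_commute: "ssgn a b c d = ssgn c d a b"
  by (simp add: ssgn_def mult.commute)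

lemma pol_pol:
  "pol n a b (pol n c d f) m = (if b = c then pol n a d f m else 0)
     - ssgn a b c d * (if a = d then pol n c b f m else 0) + ssgn a b c d * pol n c d (pol n a b f) m"
proof -
  have *: "pol n a b (cr (c, j) (an (d, j) f)) m = (if b = c then cr (a, j) (an (d, j) f) m else 0)
     - ssgn a b c d * (if a = d then cr (c, j) (an (b, j) f) m else 0)
     + ssgn a b c d * cr (c, j) (an (d, j) (pol n a b f)) m" if j: "j \<in> cols n" for j
  proof -
    have s: "ssgn a b c j = ssgn a b c d * ssgn a b d j"
      using parity_cols[OF j] by (cases a; cases b; cases c; cases d) (simp_all add: ssgn_def)
    have "pol n a b (an (d, j) f) = (\<lambda>m. ssgn a b d j * an (d, j) (pol n a b f) m
        - ssgn a b d j * (if d = a then an (b, j) f m else 0))"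
      by (simp only: an_pol[OF j]) (simp add: algebra_simps)
    then have "cr (c, j) (pol n a b (an (d, j) f)) m = ssgn a b d j * cr (c, j) (an (d, j) (pol n a b f)) m
        - ssgn a b d j * cr (c, j) (\<lambda>m. if d = a then an (b, j) f m else 0) m"
      by (simp only: lin_diff[OF lin_cr] lin_scale[OF lin_cr])
    moreover have "cr (c, j) (\<lambda>m. if d = a then an (b, j) f m else 0) m = (if a = d then cr (c, j) (an (b, j) f) m else 0)"
      using lin_zero[OF lin_cr, of "(c, j)"] by auto
    ultimately have "ssgn a b c j * cr (c, j) (pol n a b (an (d, j) f)) m = ssgn a b c d * (ssgn a b d j *
       (ssgn a b d j * (cr (c, j) (an (d, j) (pol n a b f)) m - (if a = d then cr (c, j) (an (b, j) f) m else 0))))"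
      by (simp only: s right_diff_distrib mult.assoc)
    then show ?thesis
      unfolding pol_cr[OF j] by (simp only: ssgn_sq right_diff_distrib) simp
  qed
  have "pol n a b (pol n c d f) m = (\<Sum>j\<in>cols n. pol n a b (cr (c, j) (an (d, j) f)) m)"
    by (subst (2) pol_def) (simp only: lin_sum[OF lin_pol])
  also have "\<dots> = (if b = c then pol n a d f m else 0)
     - ssgn a b c d * (if a = d then pol n c b f m else 0) + ssgn a b c d * pol n c d (pol n a b f) m"
    by (simp add: * sum.distrib sum_subtractf pol_def[of n _ _ f] pol_def[of n c d] sum_distrib_left)
  finally show ?thesis .
qed

text \<open>Creations supercommute, polarizations satisfy the relations of gl among themselves, and
  the mixed terms supply exactly the creation parts of \<open>E n a d\<close> and
  \<open>E n c b\<close>.\<close>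

lemma E_E:
  "E n a b (E n c d f) m = ssgn a b c d * E n c d (E n a b f) m
     + (if b = c then E n a d f m else 0) - ssgn a b c d * (if a = d then E n c b f m else 0)"
proof -
  have z: "cr v (\<lambda>m. 0) m = 0" "pol n a b (\<lambda>m. 0) m = 0" for v a b
    by (simp_all add: lin_zero lin_cr lin_pol)
  have 1: "cr (a, b) (cr (c, d) f) m = ssgn a b c d * cr (c, d) (cr (a, b) f) m"
    if "b \<in> cols n" "d \<in> cols n"
    using fun_cong[OF cr_cr[of "(a, b)" "(c, d)" f], of m] veps_cols[OF that, of a c] parity_cols[OF that(1)] parity_cols[OF that(2)]
    by (simp add: ssgn_def)
  have 2: "cr (a, b) (pol n c d f) m = ssgn a b c d * pol n c d (cr (a, b) f) m
      - ssgn a b c d * (if d = a then cr (c, b) f m else 0)" if "b \<in> cols n"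
    using pol_cr[OF that, of c d a f] ssgn_commute[of c d a b] by (simp add: algebra_simps)
  have 3: "pol n a b (cr (c, d) f) m = (if b = c then cr (a, d) f m else 0) + ssgn a b c d * cr (c, d) (pol n a b f) m"
     if "d \<in> cols n"
    by (simp only: pol_cr[OF that])
  have Ed: "E n c d f = (\<lambda>m. (if d \<in> cols n then cr (c, d) f m else 0) + pol n c d f m)" for c d f
    by (simp add: E_def)
  have l: "E n a b (E n c d f) m =
     (if b \<in> cols n then (if d \<in> cols n then cr (a, b) (cr (c, d) f) m else 0) + cr (a, b) (pol n c d f) m else 0)
     + (if d \<in> cols n then pol n a b (cr (c, d) f) m else 0) + pol n a b (pol n c d f) m" for a b c d f
    unfolding Ed[of a] Ed[of c] lin_add[OF lin_cr] lin_add[OF lin_pol] by (simp add: z)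
  show ?thesis
    unfolding l E_def[of n a d f] E_def[of n c b f] pol_pol[of n a b c d]
    by (cases "b \<in> cols n"; cases "d \<in> cols n") (auto simp: 1 2 3 algebra_simps)
qed

lemma free_alg_induct [case_names single add]:
  assumes single: "\<And>w c. P (Poly_Mapping.single w c)" and add: "\<And>x y. P x \<Longrightarrow> P y \<Longrightarrow> P (x + y)"
  shows "P (x :: free_alg)"
proof (induction x rule: update_induct)
  case const
  show ?case using single[of 0 0] by simp
next
  case (update f a b)
  have "Poly_Mapping.update a b f = Poly_Mapping.single a b + f"
  proof (rule poly_mapping_eqI)
    fix k
    show "Poly_Mapping.lookup (Poly_Mapping.update a b f) k = Poly_Mapping.lookup (Poly_Mapping.single a b + f) k"
      using update by (cases "k = a") (auto simp: lookup_update lookup_add lookup_single in_keys_iff)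
  qed
  then show ?case using single add update by metis
qed

section \<open>The action of the enveloping superalgebra\<close>

definition act_word :: "nat \<Rightarrow> (symbol \<times> symbol) list \<Rightarrow> vec \<Rightarrow> vec" where
  "act_word n w f = foldr (\<lambda>(a, b). E n a b) w f"

lemma act_word_Nil [simp]: "act_word n [] f = f"
  by (simp add: act_word_def)

lemma act_word_Cons: "act_word n ((a, b) # w) f = E n a b (act_word n w f)"
  by (simp add: act_word_def)

lemma act_word_append: "act_word n (v @ w) f = act_word n v (act_word n w f)"
  by (simp add: act_word_def)

lemma lin_act_word: "lin (act_word n w)"
proof (induction w)
  case Nil
  show ?case by (simp add: lin_def)
next
  case (Cons l w)
  obtain a b where l: "l = (a, b)" by force
  have "act_word n (l # w) = (\<lambda>f. E n a b (act_word n w f))"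
    by (rule ext) (simp add: l act_word_Cons)
  then show ?case using lin_comp[OF lin_E Cons] by simp
qed

definition act_free :: "nat \<Rightarrow> free_alg \<Rightarrow> vec \<Rightarrow> vec" where
  "act_free n x f = (\<lambda>m. \<Sum>w\<in>Poly_Mapping.keys x. Poly_Mapping.lookup x w * act_word n (letters w) f m)"

lemma act_free_superset:
  assumes "finite S" "Poly_Mapping.keys x \<subseteq> S"
  shows "act_free n x f m = (\<Sum>w\<in>S. Poly_Mapping.lookup x w * act_word n (letters w) f m)"
  unfolding act_free_def by (rule sum.mono_neutral_left) (use assms in \<open>auto simp: in_keys_iff\<close>)

lemma act_free_single: "act_free n (Poly_Mapping.single w c) f m = c * act_word n (letters w) f m"
  by (simp add: act_free_def)

lemma act_free_add: "act_free n (x + y) f m = act_free n x f m + act_free n y f m"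
proof -
  let ?S = "Poly_Mapping.keys x \<union> Poly_Mapping.keys y"
  have "act_free n z f m = (\<Sum>w\<in>?S. Poly_Mapping.lookup z w * act_word n (letters w) f m)"
    if "z \<in> {x, y, x + y}" for z
    by (rule act_free_superset) (use that keys_add[of x y] in auto)
  then show ?thesis by (simp add: lookup_add algebra_simps sum.distrib)
qed

lemma act_free_zero: "act_free n 0 f m = 0"
  by (simp add: act_free_def)

lemma act_free_diff: "act_free n (x - y) f m = act_free n x f m - act_free n y f m"
  using act_free_add[of n "x - y" y f m] by simp

lemma lin_act_free: "lin (act_free n x)"
  unfolding act_free_def
proof (rule lin_setsum)
  fix w
  show "lin (\<lambda>f m. Poly_Mapping.lookup x w * act_word n (letters w) f m)"
    using lin_act_word[of n "letters w"] by (simp add: lin_def algebra_simps)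
qed

lemma act_free_mult: "act_free n (x * y) f = act_free n x (act_free n y f)"
proof
  fix m
  show "act_free n (x * y) f m = act_free n x (act_free n y f) m"
  proof (induction x rule: free_alg_induct)
    case (single v c)
    have "act_free n (Poly_Mapping.single v c * y) f m = c * act_word n (letters v) (act_free n y f) m"
    proof (induction y rule: free_alg_induct)
      case (single w d)
      have "act_free n (Poly_Mapping.single w d) f = (\<lambda>m. d * act_word n (letters w) f m)"
        by (rule ext) (simp add: act_free_single)
      then show ?case
        by (simp add: mult_single act_free_single plus_word_def act_word_append lin_scale[OF lin_act_word])
    next
      case (add x y)
      have "act_free n (x + y) f = (\<lambda>m. act_free n x f m + act_free n y f m)"
        by (rule ext) (simp add: act_free_add)
      with add show ?case
        by (simp add: distrib_left act_free_add lin_add[OF lin_act_word])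
    qed
    then show ?case by (simp add: act_free_single)
  next
    case (add x y)
    then show ?case by (simp add: distrib_right act_free_add)
  qed
qed

lemma act_free_gen: "act_free n (free_gen a b) f = E n a b f"
  by (rule ext) (simp add: free_gen_def act_free_single act_word_Cons)

lemma act_free_gl_rel: "act_free n (gl_rel a b c d) f m = 0"
proof -
  have s: "(- 1) ^ k = (Poly_Mapping.single 0 ((- 1) ^ k) :: free_alg)" for k :: nat
    by (induction k) (simp_all add: single_uminus)
  have [simp]: "act_free n (Poly_Mapping.single 0 k) g m = k * g m" for k g
    by (simp add: act_free_single zero_word_def)
  have i: "act_free n (if P then x else 0) f m = (if P then act_free n x f m else 0)" for P x
    by (simp add: act_free_zero)
  show ?thesis
    unfolding gl_rel_def s
    by (simp add: act_free_diff act_free_mult act_free_gen i act_free_zero E_E[of n a b c d] ssgn_def[symmetric])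
qed

lemma act_free_gl_ideal: "x \<in> gl_ideal \<Longrightarrow> act_free n x f = (\<lambda>m. 0)"
proof (induction rule: gl_ideal.induct)
  case (rel x a b c d y)
  have "act_free n (gl_rel a b c d) g = (\<lambda>m. 0)" for g
    by (rule ext) (rule act_free_gl_rel)
  then show ?case by (simp add: act_free_mult lin_zero[OF lin_act_free])
qed (auto simp: act_free_zero act_free_add)

lift_definition act :: "nat \<Rightarrow> env \<Rightarrow> vec \<Rightarrow> vec" is act_free
proof -
  fix n x y
  assume "gl_cong x y"
  then have "act_free n (x - y) f m = 0" for f m
    by (simp add: gl_cong_def act_free_gl_ideal)
  then have "act_free n x f m = act_free n y f m" for f m
    by (metis act_free_diff right_minus_eq)
  then show "act_free n x = act_free n y" by (intro ext)
qed

lemma act_add: "act n (x + y) f = (\<lambda>m. act n x f m + act n y f m)"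
  by (rule ext, transfer) (rule act_free_add)

lemma act_diff: "act n (x - y) f = (\<lambda>m. act n x f m - act n y f m)"
  by (rule ext, transfer) (rule act_free_diff)

lemma act_zero [simp]: "act n 0 f = (\<lambda>m. 0)"
  by (rule ext, transfer) (rule act_free_zero)

lemma act_mult: "act n (x * y) f = act n x (act n y f)"
  by transfer (rule act_free_mult)

lemma act_one [simp]: "act n 1 f = f"
  by (transfer, rule ext) (simp add: act_free_single zero_word_def flip: single_one)

lemma act_e: "act n (e a b) f = E n a b f"
  by transfer (rule act_free_gen)

lemma act_scale: "act n (env_scale c x) f = (\<lambda>m. c * act n x f m)"
  by (transfer, rule ext) (simp add: act_free_mult act_free_single zero_word_def)

lemma act_sum: "act n (\<Sum>i\<in>I. x i) f = (\<lambda>m. \<Sum>i\<in>I. act n (x i) f m)"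
  by (induction I rule: infinite_finite_induct) (simp_all add: act_add)

lemma lin_act: "lin (act n x)"
  by transfer (rule lin_act_free)

lemma e_word_Nil [simp]: "e_word [] = 1"
  by (simp add: e_word_def)

lemma e_word_Cons: "e_word ((a, b) # w) = e a b * e_word w"
  by (simp add: e_word_def)

lemma e_word_append: "e_word (v @ w) = e_word v * e_word w"
  by (simp add: e_word_def)

lemma act_e_word: "act n (e_word w) f = act_word n w f"
proof (induction w)
  case (Cons l w)
  then show ?case by (cases l) (simp add: e_word_Cons act_word_Cons act_mult act_e)
qed simp

lemma env_scale_mult_left [simp]: "env_scale c x * y = env_scale c (x * y)"
  by transfer (simp add: mult.assoc gl_cong_def gl_ideal.zero)

lemma single_zero_commute: "x * Poly_Mapping.single 0 c = (Poly_Mapping.single 0 c * x :: free_alg)"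
  by (induction x rule: free_alg_induct) (simp_all add: mult_single distrib_left distrib_right mult.commute)

lemma env_scale_mult_right [simp]: "x * env_scale c y = env_scale c (x * y)"
  by transfer (simp add: single_zero_commute gl_cong_def gl_ideal.zero flip: mult.assoc)

lemma env_scale_minus_one_power: "env_scale ((- 1) ^ k) x = (- 1) ^ k * x"
  by (induction k) (simp_all add: env.scale_minus_left flip: env.scale_scale)

lemma e_e:
  "e a b * e c d = env_scale (ssgn a b c d) (e c d * e a b)
     + (if b = c then e a d else 0) - env_scale (ssgn a b c d) (if a = d then e c b else 0)"
  using e_superbracket[of a b c d] unfolding ssgn_def env_scale_minus_one_power
  by (simp add: algebra_simps)

lemma span_mult_closed:
  assumes "x \<in> env.span X" "y \<in> env.span Y" "\<And>u v. u \<in> X \<Longrightarrow> v \<in> Y \<Longrightarrow> u * v \<in> env.span Z"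
  shows "x * y \<in> env.span Z"
  using assms(1)
proof (induction rule: env.span_induct_alt)
  case base
  then show ?case by (simp add: env.span_zero)
next
  case (step c u x)
  have "u * y \<in> env.span Z"
    using assms(2)
  proof (induction rule: env.span_induct_alt)
    case (step c v y)
    then show ?case using assms(3) step(1) \<open>u \<in> X\<close>
      by (simp add: distrib_left env.span_add env.span_scale)
  qed (simp add: env.span_zero)
  with step show ?case by (simp add: distrib_right env.span_add env.span_scale)
qed

lemma U_on_mult: "x \<in> U_on A \<Longrightarrow> y \<in> U_on A \<Longrightarrow> x * y \<in> U_on A"
  by (simp add: U_on_def subalgebra_gen.mult)

lemma e_in_U_on: "a \<in> A \<Longrightarrow> b \<in> A \<Longrightarrow> e a b \<in> U_on A"
  by (auto simp: U_on_def intro!: subalgebra_gen.gen)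

lemma one_in_U_on: "1 \<in> U_on A"
  by (simp add: U_on_def subalgebra_gen.one)

lemma e_word_in_U_on: "set w \<subseteq> A \<times> A \<Longrightarrow> e_word w \<in> U_on A"
proof (induction w)
  case (Cons l w)
  obtain a b where l: "l = (a, b)" by force
  with Cons show ?case unfolding l e_word_Cons by (intro U_on_mult e_in_U_on Cons.IH) auto
qed (simp add: one_in_U_on)

lemma subalgebra_gen_zero: "0 \<in> subalgebra_gen X"
  using subalgebra_gen.scale[OF subalgebra_gen.one, where c = 0] by simp

lemma subspace_subalgebra_gen: "env.subspace (subalgebra_gen X)"
  unfolding env.subspace_def
  using subalgebra_gen_zero by (auto intro: subalgebra_gen.intros)

lemma U_on_span: "U_on A = env.span {e_word w | w. set w \<subseteq> A \<times> A}" (is "_ = env.span ?W")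
proof (intro equalityI subsetI)
  fix x assume "x \<in> U_on A"
  then show "x \<in> env.span ?W"
    unfolding U_on_def
  proof (induction rule: subalgebra_gen.induct)
    case one
    have "1 \<in> ?W" by (rule CollectI, rule exI[of _ "[]"]) simp
    then show ?case by (rule env.span_base)
  next
    case (gen x)
    then obtain a b where "x = e_word [(a, b)]" "a \<in> A" "b \<in> A" by (auto simp: e_word_Cons)
    then show ?case by (intro env.span_base) force
  next
    case (mult x y)
    show ?case
    proof (rule span_mult_closed[OF mult.IH])
      fix u v assume "u \<in> ?W" "v \<in> ?W"
      then obtain w w' where "u * v = e_word (w @ w')" "set (w @ w') \<subseteq> A \<times> A"
        by (auto simp: e_word_append)
      then show "u * v \<in> env.span ?W" by (intro env.span_base) blast
    qed
  qed (simp_all add: env.span_add env.span_scale)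
next
  fix x assume "x \<in> env.span ?W"
  then show "x \<in> U_on A"
  proof (rule env.span_induct[of _ _ "\<lambda>x. x \<in> U_on A"])
    show "env.subspace {x. x \<in> U_on A}"
      by (simp add: U_on_def subspace_subalgebra_gen)
  qed (auto simp: e_word_in_U_on)
qed

lemma subspace_U_on: "env.subspace (U_on A)"
  by (simp add: U_on_def subspace_subalgebra_gen)

lemma U_on_mono: "A \<subseteq> B \<Longrightarrow> U_on A \<subseteq> U_on B"
  unfolding U_on_span by (rule env.span_mono) blast

definition vac :: vec where
  "vac m = (if m = {#} then 1 else 0)"

section \<open>The Poincare-Birkhoff-Witt theorem\<close>

definition supported :: "vec \<Rightarrow> var set \<Rightarrow> nat \<Rightarrow> bool" where
  "supported f V d \<longleftrightarrow> (\<forall>m. f m \<noteq> 0 \<longrightarrow> set_mset m \<subseteq> V \<and> size m \<le> d)"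

lemma cr_nonzero: "cr v f m \<noteq> 0 \<Longrightarrow> v \<in># m \<and> f (m - {#v#}) \<noteq> 0"
  by (auto simp: cr_def split: if_splits)

lemma pol_nonzero:
  assumes "pol n a b f m \<noteq> 0"
  obtains j where "j \<in> cols n" "(a, j) \<in># m" "f (add_mset (b, j) (m - {#(a, j)#})) \<noteq> 0"
proof -
  have "\<exists>j\<in>cols n. cr (a, j) (an (b, j) f) m \<noteq> 0"
    using assms unfolding pol_def by (meson sum.neutral)
  then show ?thesis
    using that by (auto dest!: cr_nonzero simp: an_def)
qed

lemma E_nonzero:
  assumes "E n a b f m \<noteq> 0"
  obtains (cr) "b \<in> cols n" "(a, b) \<in># m" "f (m - {#(a, b)#}) \<noteq> 0"
  | (pol) j where "j \<in> cols n" "(a, j) \<in># m" "f (add_mset (b, j) (m - {#(a, j)#})) \<noteq> 0"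
proof -
  have "b \<in> cols n \<and> cr (a, b) f m \<noteq> 0 \<or> pol n a b f m \<noteq> 0"
    using assms by (auto simp: E_def split: if_splits)
  then show ?thesis
    using that by (metis cr_nonzero pol_nonzero)
qed

lemma in_diff_single: "x \<in># m \<Longrightarrow> x = v \<or> x \<in># m - {#v#}"
  by (metis add_mset_remove_trivial_If diff_single_trivial in_diffD insert_DiffM insert_noteq_member)

lemma supported_E:
  assumes f: "supported f (A \<times> B) d" and "a \<in> A" "b \<in> cols n \<Longrightarrow> b \<in> B"
  shows "supported (E n a b f) (A \<times> B) (Suc d)"
  unfolding supported_def
proof (intro allI impI)
  fix m assume "E n a b f m \<noteq> 0"
  then show "set_mset m \<subseteq> A \<times> B \<and> size m \<le> Suc d"
  proof (cases rule: E_nonzero)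
    case cr
    then have "set_mset (m - {#(a, b)#}) \<subseteq> A \<times> B" "size (m - {#(a, b)#}) \<le> d"
      using f by (auto simp: supported_def)
    then show ?thesis using cr assms in_diff_single[of _ m "(a, b)"]
      by (auto simp: size_Diff_singleton)
  next
    case (pol j)
    then have "set_mset (add_mset (b, j) (m - {#(a, j)#})) \<subseteq> A \<times> B" "size (add_mset (b, j) (m - {#(a, j)#})) \<le> d"
      using f by (auto simp only: supported_def)
    then show ?thesis using pol assms in_diff_single[of _ m "(a, j)"]
      by (auto simp: size_Diff_singleton)
  qed
qed

lemma supported_vac: "supported vac V d"
  by (simp add: supported_def vac_def)

lemma supported_act_word:
  assumes "set w \<subseteq> A \<times> B"
  shows "supported (act_word n w vac) (A \<times> (B \<inter> cols n)) (length w)"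
  using assms
proof (induction w)
  case (Cons l w)
  then show ?case by (cases l) (auto simp: act_word_Cons intro!: supported_E)
qed (simp add: supported_vac)

text \<open>Only the creation part of \<open>E\<close> raises the degree, and each letter raises it
  by at most 1. Degree \<open>length w\<close> is therefore reached only by creating every
  letter.\<close>

lemma act_word_leading:
  assumes "act_word n w vac m \<noteq> 0" "length w \<le> size m"
  shows "m = mset w"
  using assms
proof (induction w arbitrary: m)
  case Nil
  then show ?case by (simp add: vac_def split: if_splits)
next
  case (Cons l w)
  obtain a b where l: "l = (a, b)" by force
  from Cons.prems(1) have "E n a b (act_word n w vac) m \<noteq> 0" by (simp add: l act_word_Cons)
  then show ?case
  proof (cases rule: E_nonzero)
    case cr
    then have "m - {#(a, b)#} = mset w"
      using Cons by (intro Cons.IH) (auto simp: size_Diff_singleton)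
    then show ?thesis using cr l by (metis insert_DiffM mset.simps(2))
  next
    case (pol j)
    have "size (add_mset (b, j) (m - {#(a, j)#})) = size m"
      using pol(2) by (metis size_add_mset insert_DiffM)
    moreover from pol Cons.prems(2) this have "add_mset (b, j) (m - {#(a, j)#}) = mset w"
      by (intro Cons.IH) auto
    ultimately show ?thesis using Cons.prems(2) by (metis Suc_n_not_le_n length_Cons size_mset)
  qed
qed

text \<open>Along the leading term each letter is created at the cost of a sign, which is trivial
  for even letters. A repeated odd letter would be created on an occupied place and give 0, hence
  the condition on multiplicities.\<close>

lemma act_word_leading_coeff:
  assumes "snd ` set w \<subseteq> cols n" "\<forall>v \<in> set w. odd_var v \<longrightarrow> count (mset w) v = 1"
  shows "act_word n w vac (mset w) \<noteq> 0" "\<forall>v\<in>set w. \<not> odd_var v \<Longrightarrow> act_word n w vac (mset w) = 1"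
proof -
  have "act_word n w vac (mset w) \<noteq> 0 \<and> ((\<forall>v\<in>set w. \<not> odd_var v) \<longrightarrow> act_word n w vac (mset w) = 1)"
    using assms
  proof (induction w)
    case Nil
    then show ?case by (simp add: vac_def)
  next
    case (Cons l w)
    obtain a b where l: "l = (a, b)" by force
    let ?f = "act_word n w vac" and ?m = "mset (l # w)"
    have "pol n a b ?f ?m = 0"
    proof (rule ccontr)
      assume "pol n a b ?f ?m \<noteq> 0"
      then show False
      proof (cases rule: pol_nonzero)
        case (1 j)
        have s: "size (add_mset (b, j) (?m - {#(a, j)#})) = size ?m"
          using 1(2) by (metis size_add_mset insert_DiffM)
        then have "add_mset (b, j) (?m - {#(a, j)#}) = mset w"
          using 1(3) by (intro act_word_leading) auto
        then show False using s by (metis length_Cons n_not_Suc_n size_mset)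
      qed
    qed
    then have e: "act_word n (l # w) vac ?m = cr l ?f ?m"
      using Cons.prems(1) by (simp add: l act_word_Cons E_def)
    have IH: "?f (mset w) \<noteq> 0" "(\<forall>v\<in>set w. \<not> odd_var v) \<longrightarrow> ?f (mset w) = 1"
    proof -
      have "odd_var v \<longrightarrow> count (mset w) v = 1" if "v \<in> set w" for v
        using Cons.prems(2) that by (auto split: if_splits)
      then show "?f (mset w) \<noteq> 0" "(\<forall>v\<in>set w. \<not> odd_var v) \<longrightarrow> ?f (mset w) = 1"
        using Cons by auto
    qed
    have "odd_var l \<longrightarrow> count (mset w) l = 0"
      using Cons.prems(2) by auto
    then have "odd_var l \<longrightarrow> even (count (mset w) l)"
      by (metis dvd_0_right)
    then have "act_word n (l # w) vac ?m = vsgn l (mset w) * ?f (mset w)"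
      unfolding e by (simp add: cr_add_mset)
    moreover have "vsgn l (mset w) \<noteq> 0" using vsgn_sq[of l "mset w"] by auto
    ultimately show ?case using IH by simp
  qed
  then show "act_word n w vac (mset w) \<noteq> 0" "\<forall>v\<in>set w. \<not> odd_var v \<Longrightarrow> act_word n w vac (mset w) = 1"
    by auto
qed

lemma left_ideal_gen_base: "u \<in> A \<Longrightarrow> x \<in> X \<Longrightarrow> u * x \<in> left_ideal_gen A X"
  unfolding left_ideal_gen_def by (rule env.span_base) blast

lemma subspace_left_ideal_gen: "env.subspace (left_ideal_gen A X)"
  by (simp add: left_ideal_gen_def env.subspace_span)

lemma act_left_ideal:
  assumes "x \<in> left_ideal_gen A X" "\<And>y. y \<in> X \<Longrightarrow> act n y f = (\<lambda>m. 0)"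
  shows "act n x f = (\<lambda>m. 0)"
  using assms(1) unfolding left_ideal_gen_def
proof (induction rule: env.span_induct_alt)
  case (step c u x)
  then have "act n u f = (\<lambda>m. 0)"
    using assms(2) by (auto simp: act_mult lin_zero[OF lin_act])
  with step show ?case by (simp add: act_add act_scale)
qed simp

lemma e_word_swap:
  "e_word (r @ (a, b) # (c, d) # s) = env_scale (ssgn a b c d) (e_word (r @ (c, d) # (a, b) # s))
     + (if b = c then e_word (r @ (a, d) # s) else 0)
     - env_scale (ssgn a b c d) (if a = d then e_word (r @ (c, b) # s) else 0)"
proof -
  have "e_word (r @ (a, b) # (c, d) # s) = e_word r * (e a b * e c d) * e_word s"
    by (simp add: e_word_append e_word_Cons mult.assoc)
  also have "\<dots> = e_word r * (env_scale (ssgn a b c d) (e c d * e a b)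
     + (if b = c then e a d else 0) - env_scale (ssgn a b c d) (if a = d then e c b else 0)) * e_word s"
    by (simp only: e_e[of a b c d])
  also have "\<dots> = env_scale (ssgn a b c d) (e_word r * (e c d * e a b) * e_word s)
     + e_word r * (if b = c then e a d else 0) * e_word s
     - env_scale (ssgn a b c d) (e_word r * (if a = d then e c b else 0) * e_word s)"
    by (simp only: distrib_left distrib_right right_diff_distrib left_diff_distrib
      env_scale_mult_left env_scale_mult_right)
  also have "e_word r * (e c d * e a b) * e_word s = e_word (r @ (c, d) # (a, b) # s)"
    by (simp add: e_word_append e_word_Cons mult.assoc)
  also have "e_word r * (if b = c then e a d else 0) * e_word s = (if b = c then e_word (r @ (a, d) # s) else 0)"
    by (simp add: e_word_append e_word_Cons mult.assoc)
  also have "e_word r * (if a = d then e c b else 0) * e_word s = (if a = d then e_word (r @ (c, b) # s) else 0)"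
    by (simp add: e_word_append e_word_Cons mult.assoc)
  finally show ?thesis .
qed

text \<open>Reordering a word only costs a sign and shorter words.\<close>

locale short_words =
  fixes A :: "symbol set" and d :: nat and L :: "env set"
  assumes subspace: "env.subspace L"
    and short: "set w \<subseteq> A \<times> A \<Longrightarrow> length w \<le> d \<Longrightarrow> e_word w \<in> L"
begin

lemma swap:
  assumes "set (r @ x # y # s) \<subseteq> A \<times> A" "length (r @ x # y # s) = Suc d" "e_word (r @ y # x # s) \<in> L"
  shows "e_word (r @ x # y # s) \<in> L"
proof -
  obtain a b where x: "x = (a, b)" by force
  obtain c d' where y: "y = (c, d')" by force
  have ad: "set (r @ (a, d') # s) \<subseteq> A \<times> A" "length (r @ (a, d') # s) \<le> d"
    and cb: "set (r @ (c, b) # s) \<subseteq> A \<times> A" "length (r @ (c, b) # s) \<le> d"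
    using assms(1,2) by (simp_all add: x y)
  have "(if b = c then e_word (r @ (a, d') # s) else 0) \<in> L"
    using short[OF ad] env.subspace_0[OF subspace] by simp
  moreover have "(if a = d' then e_word (r @ (c, b) # s) else 0) \<in> L"
    using short[OF cb] env.subspace_0[OF subspace] by simp
  ultimately have "env_scale (ssgn a b c d') (e_word (r @ y # x # s)) + (if b = c then e_word (r @ (a, d') # s) else 0)
     - env_scale (ssgn a b c d') (if a = d' then e_word (r @ (c, b) # s) else 0) \<in> L"
    using assms(3) by (intro env.subspace_diff[OF subspace] env.subspace_add[OF subspace] env.subspace_scale[OF subspace])
  then show ?thesis unfolding x y e_word_swap[of r a b c d' s] .
qed

lemma move:
  assumes "set (r @ x # u @ s) \<subseteq> A \<times> A" "length (r @ x # u @ s) = Suc d"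
  shows "e_word (r @ x # u @ s) \<in> L \<longleftrightarrow> e_word (r @ u @ x # s) \<in> L"
  using assms
proof (induction u arbitrary: r)
  case (Cons y u)
  have "e_word (r @ x # (y # u) @ s) \<in> L \<longleftrightarrow> e_word (r @ y # x # u @ s) \<in> L"
    using swap[of r x y "u @ s"] swap[of r y x "u @ s"] Cons.prems by auto
  also have "\<dots> \<longleftrightarrow> e_word (r @ (y # u) @ x # s) \<in> L"
    using Cons.IH[of "r @ [y]"] Cons.prems by auto
  finally show ?case .
qed simp

lemma perm:
  assumes "mset w = mset w'" "set (r @ w) \<subseteq> A \<times> A" "length (r @ w) = Suc d"
  shows "e_word (r @ w) \<in> L \<longleftrightarrow> e_word (r @ w') \<in> L"
  using assms
proof (induction w arbitrary: r w')
  case (Cons x u)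
  then have "x \<in> set w'" by (metis list.set_intros(1) mset_eq_setD)
  then obtain p q where w': "w' = p @ x # q" by (metis split_list)
  with Cons.prems have m: "mset u = mset (p @ q)" by simp
  have s: "set (p @ q) = set u" "length (p @ q) = length u"
    using m by (metis mset_eq_setD, metis mset_eq_length)
  have "e_word (r @ x # u) \<in> L \<longleftrightarrow> e_word ((r @ [x]) @ p @ q) \<in> L"
    using Cons.IH[OF m, of "r @ [x]"] Cons.prems by auto
  also have "\<dots> \<longleftrightarrow> e_word (r @ p @ x # q) \<in> L"
    using move[of r x p q] Cons.prems s by auto
  finally show ?case by (simp add: w')
qed simp

end

section \<open>Ordered monomials modulo a left ideal\<close>

definition col_ideal :: "nat \<Rightarrow> symbol set \<Rightarrow> env set" where
  "col_ideal n A = left_ideal_gen (U_on A) {e a b | a b. a \<in> A \<and> b \<in> A - cols n}"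

definition word_of :: "var multiset \<Rightarrow> (symbol \<times> symbol) list" where
  "word_of m = (SOME w. mset w = m)"

lemma mset_word_of [simp]: "mset (word_of m) = m"
  unfolding word_of_def by (rule someI_ex) (rule ex_mset)

lemma set_word_of [simp]: "set (word_of m) = set_mset m"
  by (metis mset_word_of set_mset_mset)

lemma length_word_of [simp]: "length (word_of m) = size m"
  by (metis mset_word_of size_mset)

text \<open>The basis modulo \<open>col_ideal\<close>: a letter whose second index is no column can
  be moved to the right end, into the ideal, and an odd letter occurs once because its square
  vanishes.\<close>

definition pbw :: "nat \<Rightarrow> symbol set \<Rightarrow> var multiset set" where
  "pbw n A = {m. set_mset m \<subseteq> A \<times> (A \<inter> cols n) \<and> (\<forall>v \<in># m. odd_var v \<longrightarrow> count m v = 1)}"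

text \<open>The superbracket of an odd letter with itself is twice its square, and it is 0 because
  an odd letter has a \<noteq> b.\<close>

lemma e_square_odd: "odd_var (a, b) \<Longrightarrow> e a b * e a b = 0"
proof -
  assume "odd_var (a, b)"
  then have "a \<noteq> b" "ssgn a b a b = - 1" by (auto simp: odd_var_def ssgn_def)
  then have "e a b * e a b = env_scale (- 1) (e a b * e a b)"
    using e_e[of a b a b] by simp
  then have "env_scale 2 (e a b * e a b) = 0"
    by (metis add.left_inverse env.scale_minus_left env.scale_one env.scale_left_distrib one_add_one)
  then show ?thesis by simp
qed

lemma words_in_pbw_span:
  assumes "set w \<subseteq> A \<times> A" "length w \<le> d"
  shows "e_word w \<in> env.span (col_ideal n A \<union> {e_word (word_of m) | m. m \<in> pbw n A \<and> size m \<le> d})"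
  using assms
proof (induction d arbitrary: w)
  case 0
  have "{#} \<in> pbw n A" by (simp add: pbw_def)
  moreover have "w = word_of {#}" using 0(2) length_word_of[of "{#}"] by (metis le_zero_eq length_0_conv size_empty)
  ultimately show ?case by (intro env.span_base) auto
next
  case (Suc d)
  let ?L = "\<lambda>d. env.span (col_ideal n A \<union> {e_word (word_of m) | m. m \<in> pbw n A \<and> size m \<le> d})"
  have mono: "?L d \<subseteq> ?L (Suc d)" by (rule env.span_mono) (auto simp: le_SucI)
  interpret short_words A d "?L (Suc d)"
    using mono Suc.IH by unfold_locales (auto simp: env.subspace_span)
  show ?case
  proof (cases "length w = Suc d")
    case False
    then show ?thesis using Suc.prems short by simp
  next
    case len: True
    note perm' = perm[of w _ "[]", simplified, OF _ Suc.prems(1) len]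
    \<comment> \<open>Since the order of the letters is irrelevant modulo shorter words, an
      offending letter may be placed where it helps: at the right end in the first case, next to its
      twin in the second.\<close>
    consider (virtual) a b where "(a, b) \<in> set w" "b \<notin> cols n"
      | (rep) v where "v \<in> set w" "odd_var v" "count (mset w) v \<noteq> 1"
      | (pbw) "mset w \<in> pbw n A"
      using Suc.prems(1) by (fastforce simp: pbw_def)
    then show ?thesis
    proof cases
      case virtual
      then obtain p q where w: "w = p @ (a, b) # q" by (metis split_list)
      have "e_word (p @ q) * e a b \<in> col_ideal n A"
        unfolding col_ideal_def
        by (rule left_ideal_gen_base) (use Suc.prems(1) virtual w in \<open>auto intro!: e_word_in_U_on\<close>)
      then have "e_word ((p @ q) @ [(a, b)]) \<in> ?L (Suc d)"
        unfolding e_word_append[of "p @ q"] by (intro env.span_base) (simp add: e_word_Cons)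
      then show ?thesis using perm'[of "(p @ q) @ [(a, b)]"] w by simp
    next
      case rep
      then have "count (mset w) v > 1"
        by (metis One_nat_def Suc_lessI count_greater_zero_iff set_mset_mset)
      then have "{#v, v#} \<subseteq># mset w" by (auto simp: subseteq_mset_def)
      then obtain m where m: "mset w = {#v, v#} + m" by (metis subset_mset.add_diff_inverse)
      obtain u where u: "mset u = m" by (metis ex_mset)
      have "e_word (v # v # u) = 0"
        using e_square_odd[of "fst v" "snd v"] rep(2)
        by (cases v) (simp add: e_word_Cons flip: mult.assoc)
      then show ?thesis using perm'[of "v # v # u"] m u by (simp add: env.span_zero)
    next
      case pbw
      have "e_word (word_of (mset w)) \<in> ?L (Suc d)"
        by (intro env.span_base UnI2 CollectI exI[of _ "mset w"]) (simp add: pbw len)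
      then show ?thesis using perm'[of "word_of (mset w)"] by simp
    qed
  qed
qed

lemma an_vac [simp]: "an v vac = (\<lambda>m. 0)"
  by (simp add: an_def vac_def fun_eq_iff)

lemma E_vac: "E n i j vac = (\<lambda>m. if j \<in> cols n then cr (i, j) vac m else 0)"
  by (simp add: E_def pol_def lin_zero[OF lin_cr])

lemma act_col_ideal: "x \<in> col_ideal n A \<Longrightarrow> act n x vac = (\<lambda>m. 0)"
  unfolding col_ideal_def by (erule act_left_ideal) (auto simp: act_e E_vac)

text \<open>Modulo the ideal, \<open>x\<close> is a combination of ordered monomials. Among those
  with nonzero coefficient take one of maximal size: by \<open>act_word_leading\<close> no other
  contributes to its leading term, so the image at 1 cannot vanish.\<close>

lemma kernel_vac:
  assumes "x \<in> U_on A" "act n x vac = (\<lambda>m. 0)"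
  shows "x \<in> col_ideal n A"
proof -
  let ?B = "{e_word (word_of m) | m. m \<in> pbw n A}"
  have "x \<in> env.span (col_ideal n A \<union> ?B)"
  proof -
    have "env.span {e_word w | w. set w \<subseteq> A \<times> A} \<subseteq> env.span (col_ideal n A \<union> ?B)"
    proof (rule env.span_minimal)
      show "{e_word w | w. set w \<subseteq> A \<times> A} \<subseteq> env.span (col_ideal n A \<union> ?B)"
      proof clarify
        fix w :: "(symbol \<times> symbol) list" assume "set w \<subseteq> A \<times> A"
        from words_in_pbw_span[OF this order_refl, of n]
        show "e_word w \<in> env.span (col_ideal n A \<union> ?B)"
          by (rule set_mp[OF env.span_mono, rotated]) auto
      qed
    qed (rule env.subspace_span)
    then show ?thesis using assms(1) by (auto simp: U_on_span)
  qed
  then obtain j y where x: "x = j + y" and "j \<in> env.span (col_ideal n A)" and y: "y \<in> env.span ?B"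
    unfolding env.span_Un by auto
  then have j: "j \<in> col_ideal n A"
    by (simp add: col_ideal_def left_ideal_gen_def env.span_span)
  from y obtain t r where t: "finite t" "t \<subseteq> ?B" and ys: "y = (\<Sum>u\<in>t. env_scale (r u) u)"
    unfolding env.span_explicit by auto
  have yv: "act n y vac = (\<lambda>m. 0)"
    using assms(2) act_col_ideal[OF j] by (simp add: x act_add)
  have "\<forall>u\<in>t. \<exists>m. u = e_word (word_of m) \<and> m \<in> pbw n A" using t(2) by auto
  then obtain mu where mu: "\<And>u. u \<in> t \<Longrightarrow> u = e_word (word_of (mu u))" "\<And>u. u \<in> t \<Longrightarrow> mu u \<in> pbw n A"
    by metis
  have "r u = 0" if "u \<in> t" for u
  proof (rule ccontr)
    assume "r u \<noteq> 0"
    define t' where "t' = {u \<in> t. r u \<noteq> 0}"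
    have "finite t'" "t' \<noteq> {}" using t \<open>u \<in> t\<close> \<open>r u \<noteq> 0\<close> by (auto simp: t'_def)
    then have "Max ((\<lambda>u. size (mu u)) ` t') \<in> (\<lambda>u. size (mu u)) ` t'" by (intro Max_in) auto
  then obtain v where "v \<in> t'" and max: "Max ((\<lambda>u. size (mu u)) ` t') = size (mu v)" by blast
  then have v: "v \<in> t'" "\<forall>u\<in>t'. size (mu u) \<le> size (mu v)"
    using \<open>finite t'\<close> by (auto simp flip: max)
  have vt: "v \<in> t" "r v \<noteq> 0" using v by (auto simp: t'_def)
    have "act n y vac (mu v) = (\<Sum>u\<in>t. r u * act n u vac (mu v))"
      by (simp add: ys act_sum act_scale)
    also have "\<dots> = (\<Sum>u\<in>t. if u = v then r v * act n v vac (mu v) else 0)"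
    proof (rule sum.cong[OF refl])
      fix u assume u: "u \<in> t"
      show "r u * act n u vac (mu v) = (if u = v then r v * act n v vac (mu v) else 0)"
      proof (cases "u = v \<or> r u = 0")
        case False
        then have "size (mu u) \<le> size (mu v)" using v u by (auto simp: t'_def)
        moreover have "mu v \<noteq> mu u" using mu(1)[OF u] mu(1)[OF vt(1)] False by auto
        ultimately have "act_word n (word_of (mu u)) vac (mu v) = 0"
          using act_word_leading[of n "word_of (mu u)" "mu v"] by auto
        then have "act n u vac (mu v) = 0" by (subst mu(1)[OF u]) (simp only: act_e_word)
        then show ?thesis using False by simp
      qed auto
    qed
    also have "\<dots> = r v * act n v vac (mu v)" using t vt by simp
    finally have "act n v vac (mu v) = 0" using yv vt by simp
    then have "act_word n (word_of (mu v)) vac (mset (word_of (mu v))) = 0"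
      by (subst (asm) mu(1)[OF vt(1)]) (simp add: act_e_word)
    moreover have "act_word n (word_of (mu v)) vac (mset (word_of (mu v))) \<noteq> 0"
      by (rule act_word_leading_coeff) (use mu(2)[OF vt(1)] in \<open>auto simp: pbw_def\<close>)
    ultimately show False by simp
  qed
  then have "y = 0" by (simp add: ys)
  then show ?thesis using j x by simp
qed

section \<open>Devirtualization as evaluation at the vacuum\<close>

lemma proper_symbols_cols: "proper_symbols n = cols n"
  by (simp add: proper_symbols_def cols_def)

lemma U_gl_def': "U_gl n = U_on (cols n)"
  by (simp add: U_gl_def proper_symbols_cols)

text \<open>For the alphabet \<open>cols n\<close> every second index is a column, so the generating
  set of \<open>col_ideal\<close> is empty and the kernel is 0.\<close>

lemma U_gl_inj:
  assumes "x \<in> U_gl n" "y \<in> U_gl n" "act n x vac = act n y vac"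
  shows "x = y"
proof -
  have "x - y \<in> col_ideal n (cols n)"
    using assms by (intro kernel_vac) (auto simp: U_gl_def' act_diff env.subspace_diff subspace_U_on)
  then show ?thesis by (simp add: col_ideal_def left_ideal_gen_def)
qed

section \<open>Conservation of rows and irregular products\<close>

definition row_count :: "symbol \<Rightarrow> var multiset \<Rightarrow> nat" where
  "row_count c m = size {#v \<in># m. fst v = c#}"

lemma row_count_simps [simp]:
  "row_count c {#} = 0"
  "row_count c (add_mset v m) = (if fst v = c then Suc (row_count c m) else row_count c m)"
  by (simp_all add: row_count_def)

lemma row_count_zero_iff: "row_count c m = 0 \<longleftrightarrow> (\<forall>v\<in>#m. fst v \<noteq> c)"
  by (auto simp: row_count_def simp flip: set_mset_eq_empty_iff)

text \<open>A row c that is no column is produced by letters e c b and consumed by letters e a c.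
  For a column c the count would fail, because e a c can then create Y(a,c) without consuming
  anything.\<close>

lemma act_word_row_count:
  assumes "act_word n w vac m \<noteq> 0" "c \<notin> cols n"
  shows "row_count c m + length (filter (\<lambda>(a, b). b = c) w) = length (filter (\<lambda>(a, b). a = c) w)"
  using assms(1)
proof (induction w arbitrary: m)
  case Nil
  then show ?case by (simp add: vac_def split: if_splits)
next
  case (Cons l w)
  obtain a b where l: "l = (a, b)" by force
  from Cons.prems(1) have "E n a b (act_word n w vac) m \<noteq> 0" by (simp add: l act_word_Cons)
  then show ?case
  proof (cases rule: E_nonzero)
    case cr
    have "row_count c m = row_count c (add_mset (a, b) (m - {#(a, b)#}))" using cr(2) by simp
    then show ?thesis using Cons.IH[OF cr(3)] cr(1) assms(2) by (auto simp: l)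
  next
    case (pol j)
    have "row_count c m = row_count c (add_mset (a, j) (m - {#(a, j)#}))" using pol(2) by simp
    then show ?thesis using Cons.IH[OF pol(3)] by (auto simp: l split: if_splits)
  qed
qed

text \<open>Some suffix of the word consumes a virtual row more often than it has been produced.
  When a letter acts, only the letters to its right have produced rows, hence the comparison of
  \<open>i\<close> second indices with \<open>i - 1\<close> first indices.\<close>

lemma act_irregular:
  assumes "irregular m0 m1 w"
  shows "act_word n w vac = (\<lambda>m. 0)"
proof -
  obtain i c where i: "i \<in> {1..length w}" and c: "c \<in> virtual_symbols m0 m1"
    and irr: "length (filter (\<lambda>(a, b). b = c) (take i (rev w))) > length (filter (\<lambda>(a, b). a = c) (take (i - 1) (rev w)))"
    using assms by (auto simp: irregular_def)
  have cc: "c \<notin> cols n" using c by (auto simp: virtual_symbols_def cols_def)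
  define k where "k = length w - i"
  have "k < length w" using i by (auto simp: k_def)
  then obtain a b u where u: "drop k w = (a, b) # u" by (metis Cons_nth_drop_Suc surj_pair)
  have "take i (rev w) = rev (drop k w)" using i by (simp add: k_def take_rev)
  moreover have "drop (length w - (i - 1)) w = u"
  proof -
    have "length w - (i - 1) = Suc k" using i by (auto simp: k_def)
    then show ?thesis using u by (metis drop_Suc list.sel(3) tl_drop)
  qed
  then have "take (i - 1) (rev w) = rev u" by (simp add: take_rev)
  ultimately have lt: "length (filter (\<lambda>(a, b). b = c) ((a, b) # u)) > length (filter (\<lambda>(a, b). a = c) u)"
    using irr by (simp add: u rev_filter[symmetric] split: if_splits)
  have "act_word n ((a, b) # u) vac = (\<lambda>m. 0)"
  proof (rule ext, rule ccontr)
    fix m assume "act_word n ((a, b) # u) vac m \<noteq> 0"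
    then have "E n a b (act_word n u vac) m \<noteq> 0" by (simp add: act_word_Cons)
    then show False
    proof (cases rule: E_nonzero)
      case cr
      then show ?thesis using act_word_row_count[OF cr(3) cc] lt cc by (auto split: if_splits)
    next
      case (pol j)
      then show ?thesis using act_word_row_count[OF pol(3) cc] lt by (auto split: if_splits)
    qed
  qed
  then have "act_word n (take k w @ drop k w) vac = (\<lambda>m. 0)"
    unfolding act_word_append u by (simp add: lin_zero[OF lin_act_word])
  then show ?thesis by simp
qed

text \<open>The number \<open>n\<close> of columns is independent of the number \<open>N\<close> of
  proper symbols, because virtual symbols are never columns. The application has N = n + 1.\<close>

lemma act_Irr: "x \<in> Irr m0 m1 N \<Longrightarrow> act n x vac = (\<lambda>m. 0)"
  unfolding Irr_def by (erule act_left_ideal) (auto simp: act_e_word act_irregular)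

lemma subspace_Irr: "env.subspace (Irr m0 m1 n)"
  by (simp add: Irr_def subspace_left_ideal_gen)

text \<open>A single letter with virtual second index is already irregular: nothing has been
  produced before it acts.\<close>

lemma col_ideal_subset_Irr: "col_ideal n (virtual_symbols m0 m1 \<union> proper_symbols n) \<subseteq> Irr m0 m1 n"
  unfolding col_ideal_def Irr_def U_super_def left_ideal_gen_def
proof (rule env.span_mono, clarify)
  fix u a b
  let ?A = "virtual_symbols m0 m1 \<union> proper_symbols n"
  assume u: "u \<in> U_on ?A" "a \<in> ?A" "b \<in> ?A" "b \<notin> cols n"
  then have "irregular m0 m1 [(a, b)]"
    by (auto simp: irregular_def proper_symbols_cols intro!: bexI[of _ b])
  moreover have "e a b = e_word [(a, b)]" "set [(a, b)] \<subseteq> ?A \<times> ?A" using u by (auto simp: e_word_Cons)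
  ultimately show "\<exists>u' x. u * e a b = u' * x \<and> u' \<in> U_on ?A \<and>
      x \<in> {e_word w | w. irregular m0 m1 w \<and> set w \<subseteq> ?A \<times> ?A}"
    using u(1) by blast
qed

lemma Irr_iff:
  assumes "x \<in> U_super m0 m1 n"
  shows "x \<in> Irr m0 m1 n \<longleftrightarrow> act n x vac = (\<lambda>m. 0)"
  using act_Irr kernel_vac col_ideal_subset_Irr assms unfolding U_super_def by blast

lemma U_gl_subset_U_super: "U_gl n \<subseteq> U_super m0 m1 n"
  unfolding U_gl_def U_super_def by (rule U_on_mono) simp

lemma devirt_unique:
  assumes y: "y \<in> U_gl n" and x: "x \<in> U_super m0 m1 n" and eq: "act n x vac = act n y vac"
  shows "devirt m0 m1 n x = y"
  unfolding devirt_def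
proof (rule the_equality)
  have "x - y \<in> U_super m0 m1 n"
    using x y U_gl_subset_U_super[of n m0 m1] by (auto simp: U_super_def intro!: env.subspace_diff subspace_U_on)
  then show "y \<in> U_gl n \<and> x - y \<in> Irr m0 m1 n"
    using y eq by (simp add: Irr_iff act_diff)
next
  fix z assume z: "z \<in> U_gl n \<and> x - z \<in> Irr m0 m1 n"
  then have "act n x vac = act n z vac"
    using act_Irr[of "x - z" m0 m1 n n] by (auto simp: act_diff fun_eq_iff)
  then show "z = y" using U_gl_inj y z eq by metis
qed

section \<open>Degree filtration and surjectivity of evaluation at 1\<close>

definition U_le :: "nat \<Rightarrow> nat \<Rightarrow> env set" where
  "U_le n d = env.span {e_word w | w. set w \<subseteq> cols n \<times> cols n \<and> length w \<le> d}"

lemma U_le_subset: "U_le n d \<subseteq> U_gl n"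
  unfolding U_le_def U_gl_def' U_on_span by (rule env.span_mono) blast

lemma U_le_mono: "d \<le> d' \<Longrightarrow> U_le n d \<subseteq> U_le n d'"
  unfolding U_le_def by (rule env.span_mono) fastforce

lemma finite_multisets: "finite V \<Longrightarrow> finite {m. set_mset m \<subseteq> V \<and> size m \<le> d}"
proof -
  assume "finite V"
  then have "finite (mset ` {xs. set xs \<subseteq> V \<and> length xs \<le> d})"
    by (intro finite_imageI finite_lists_length_le)
  moreover have "{m. set_mset m \<subseteq> V \<and> size m \<le> d} \<subseteq> mset ` {xs. set xs \<subseteq> V \<and> length xs \<le> d}"
  proof clarify
    fix m assume "set_mset m \<subseteq> V" "size m \<le> d"
    then show "m \<in> mset ` {xs. set xs \<subseteq> V \<and> length xs \<le> d}"
      using ex_mset[of m] by (metis (mono_tags, lifting) image_eqI mem_Collect_eq set_mset_mset size_mset)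
  qed
  ultimately show ?thesis by (rule rev_finite_subset)
qed

lemma not_odd_var_cols: "v \<in> cols n \<times> cols n \<Longrightarrow> \<not> odd_var v"
  by (auto simp: odd_var_def parity_cols)

text \<open>Words weighted by the top coefficients of \<open>f\<close> reproduce its top part, since
  all letters are even and the leading coefficients are 1. The difference has lower degree.\<close>

lemma U_le_surj:
  assumes "supported f (cols n \<times> cols n) d"
  obtains y where "y \<in> U_le n d" "act n y vac = f"
proof -
  have "\<exists>y\<in>U_le n d. act n y vac = f" using assms
  proof (induction d arbitrary: f)
    case 0
    have "f = (\<lambda>m. f {#} * vac m)"
      using 0 by (auto simp: supported_def vac_def fun_eq_iff)
    then have "act n (env_scale (f {#}) 1) vac = f" by (simp add: act_scale)
    moreover have "1 \<in> {e_word w | w. set w \<subseteq> cols n \<times> cols n \<and> length w \<le> 0}"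
      by (rule CollectI, rule exI[of _ "[]"]) simp
    then have "env_scale (f {#}) 1 \<in> U_le n 0"
      unfolding U_le_def by (intro env.span_scale env.span_base)
    ultimately show ?case by blast
  next
    case (Suc d)
    define M where "M = {m. set_mset m \<subseteq> cols n \<times> cols n \<and> size m \<le> Suc d \<and> size m = Suc d}"
    have "finite M" unfolding M_def
      by (rule finite_subset[OF _ finite_multisets[of "cols n \<times> cols n" "Suc d"]]) auto
    define z where "z = (\<Sum>m\<in>M. env_scale (f m) (e_word (word_of m)))"
    have z: "z \<in> U_le n (Suc d)"
      unfolding z_def U_le_def
      by (intro env.span_sum env.span_scale env.span_base) (force simp: M_def)
    have word: "act_word n (word_of m) vac m' = (if m' = m then 1 else 0)"
      if "m \<in> M" "size m' \<ge> Suc d" for m m'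
    proof (cases "m' = m")
      case True
      have "act_word n (word_of m) vac (mset (word_of m)) = 1"
        using that not_odd_var_cols by (intro act_word_leading_coeff) (auto simp: M_def)
      then show ?thesis using True by simp
    next
      case False
      then show ?thesis using act_word_leading[of n "word_of m" m'] that by (auto simp: M_def)
    qed
    have zsupp: "supported (act_word n (word_of m) vac) (cols n \<times> cols n) (Suc d)" if "m \<in> M" for m
      using supported_act_word[of "word_of m" "cols n" "cols n" n] that by (auto simp: M_def)
    have az: "act n z vac m' = (\<Sum>m\<in>M. f m * act_word n (word_of m) vac m')" for m'
      by (simp add: z_def act_sum act_scale act_e_word)
    have "supported (\<lambda>m. f m - act n z vac m) (cols n \<times> cols n) d"
      unfolding supported_def
    proof (intro allI impI)
      fix m' assume nz: "f m' - act n z vac m' \<noteq> 0"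
      show "set_mset m' \<subseteq> cols n \<times> cols n \<and> size m' \<le> d"
      proof (cases "f m' = 0")
        case True
        then have "act n z vac m' \<noteq> 0" using nz by simp
        then obtain m where m: "m \<in> M" "f m * act_word n (word_of m) vac m' \<noteq> 0"
          unfolding az by (meson sum.not_neutral_contains_not_neutral)
        then have "set_mset m' \<subseteq> cols n \<times> cols n" using zsupp by (auto simp: supported_def)
        moreover have "m' \<noteq> m" using m True by auto
        then have "\<not> Suc d \<le> size m'" using word[OF m(1), of m'] m(2) by auto
        ultimately show ?thesis by auto
      next
        case False
        then have m': "set_mset m' \<subseteq> cols n \<times> cols n" "size m' \<le> Suc d" using Suc.prems by (auto simp: supported_def)
        have "size m' \<noteq> Suc d"
        proof
          assume s: "size m' = Suc d"
          then have "m' \<in> M" using m' by (simp add: M_def)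
          then have "act n z vac m' = f m'"
          proof -
            have "act n z vac m' = (\<Sum>m\<in>M. if m' = m then f m' else 0)"
              unfolding az by (rule sum.cong) (use s word in auto)
            then show ?thesis using \<open>finite M\<close> \<open>m' \<in> M\<close> by simp
          qed
          then show False using nz by simp
        qed
        with m' show ?thesis by simp
      qed
    qed
    from Suc.IH[OF this] obtain y where y: "y \<in> U_le n d" "act n y vac = (\<lambda>m. f m - act n z vac m)" by blast
    have "y + z \<in> U_le n (Suc d)"
      using y(1) z U_le_mono[of d "Suc d" n] by (auto simp: U_le_def intro!: env.span_add)
    moreover have "act n (y + z) vac = f" by (simp add: act_add y)
    ultimately show ?case by blast
  qed
  then show ?thesis using that by blast
qed

definition balanced :: "nat \<Rightarrow> nat \<Rightarrow> (symbol \<times> symbol) list \<Rightarrow> bool" where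
  "balanced m0 m1 w \<longleftrightarrow> (\<forall>c \<in> virtual_symbols m0 m1.
     length (filter (\<lambda>(a, b). a = c) w) = length (filter (\<lambda>(a, b). b = c) w))"

text \<open>By conservation of rows, balance leaves no virtual row in the image at 1. The image is
  thus a polynomial in the Y(i,j) with proper i and has a preimage in U(gl(n)); this is the
  existence half of the definite description.\<close>

lemma devirt_balanced:
  assumes w: "set w \<subseteq> (virtual_symbols m0 m1 \<union> proper_symbols n) \<times> (virtual_symbols m0 m1 \<union> proper_symbols n)"
    and bal: "balanced m0 m1 w"
  shows "devirt m0 m1 n (e_word w) \<in> U_gl n"
    and "act n (devirt m0 m1 n (e_word w)) vac = act_word n w vac"
    and "e_word w - devirt m0 m1 n (e_word w) \<in> Irr m0 m1 n"
proof -
  let ?A = "virtual_symbols m0 m1 \<union> proper_symbols n"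
  have "supported (act_word n w vac) (cols n \<times> cols n) (length w)"
    unfolding supported_def
  proof (intro allI impI)
    fix m assume nz: "act_word n w vac m \<noteq> 0"
    then have s: "set_mset m \<subseteq> ?A \<times> (?A \<inter> cols n)" "size m \<le> length w"
      using supported_act_word[OF w, of n] by (auto simp: supported_def)
    have "fst v \<in> cols n" if "v \<in># m" for v
    proof (rule ccontr)
      assume "fst v \<notin> cols n"
      moreover have "fst v \<in> ?A" using s(1) that by auto
      ultimately have c: "fst v \<in> virtual_symbols m0 m1" "fst v \<notin> cols n" by (auto simp: proper_symbols_cols)
      then have "row_count (fst v) m = 0"
        using act_word_row_count[OF nz c(2)] bal by (simp add: balanced_def)
      then show False using that by (auto simp: row_count_zero_iff)
    qed
    then show "set_mset m \<subseteq> cols n \<times> cols n \<and> size m \<le> length w"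
      using s by fastforce
  qed
  then obtain y where y: "y \<in> U_le n (length w)" "act n y vac = act_word n w vac"
    by (rule U_le_surj)
  then have yU: "y \<in> U_gl n" using U_le_subset by blast
  have wU: "e_word w \<in> U_super m0 m1 n" unfolding U_super_def by (rule e_word_in_U_on[OF w])
  have d: "devirt m0 m1 n (e_word w) = y"
    by (rule devirt_unique[OF yU wU]) (simp add: y act_e_word)
  show "devirt m0 m1 n (e_word w) \<in> U_gl n" "act n (devirt m0 m1 n (e_word w)) vac = act_word n w vac"
    by (simp_all add: d yU y)
  have "e_word w - y \<in> U_super m0 m1 n"
    using wU yU U_gl_subset_U_super[of n m0 m1] by (auto simp: U_super_def intro!: env.subspace_diff subspace_U_on)
  then show "e_word w - devirt m0 m1 n (e_word w) \<in> Irr m0 m1 n"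
    by (simp add: d Irr_iff act_diff act_e_word y)
qed

section \<open>Nested sums\<close>

definition sand :: "symbol \<Rightarrow> nat \<Rightarrow> env \<Rightarrow> env" where
  "sand c i z = e (Prop i) c * z * e c (Prop i)"

fun nest :: "nat \<Rightarrow> symbol list \<Rightarrow> env \<Rightarrow> env" where
  "nest n [] z = z"
| "nest n (c # cs) z = (\<Sum>i\<in>{1..n}. sand c i (nest n cs z))"

lemma sand_sum: "sand c i (\<Sum>t\<in>T. f t) = (\<Sum>t\<in>T. sand c i (f t))"
  by (simp add: sand_def sum_distrib_left sum_distrib_right)

lemma sand_scale: "sand c i (env_scale k z) = env_scale k (sand c i z)"
  by (simp add: sand_def)

lemma nest_append: "nest n (cs @ ds) z = nest n cs (nest n ds z)"
  by (induction cs) simp_all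

lemma ssgn_proper [simp]: "ssgn (Prop i) (Prop j) c d = 1" "ssgn c d (Prop i) (Prop j) = 1"
  by (simp_all add: ssgn_def flip: mult_2 mult_2_right)

definition virtual :: "symbol \<Rightarrow> bool" where
  "virtual c \<longleftrightarrow> c \<notin> range Prop"

lemma virtual_neq [simp]: "virtual c \<Longrightarrow> c \<noteq> Prop i" "virtual c \<Longrightarrow> Prop i \<noteq> c"
  by (auto simp: virtual_def)

lemma virtual_Pos: "virtual (Pos s)" and virtual_Neg: "virtual (Neg s)"
  by (auto simp: virtual_def)

text \<open>The sum contracts a vector with a dual vector. Commuting e i j from the left yields an
  extra term at l = j, from the right one at l = i, and both are e i c z e c j. No signs occur
  because e i j is even.\<close>

lemma sum_sand_commutes:
  assumes c: "virtual c" and ij: "i \<in> {1..n}" "j \<in> {1..n}"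
    and z: "e (Prop i) (Prop j) * z = z * e (Prop i) (Prop j)"
  shows "e (Prop i) (Prop j) * (\<Sum>l\<in>{1..n}. sand c l z) = (\<Sum>l\<in>{1..n}. sand c l z) * e (Prop i) (Prop j)"
proof -
  let ?g = "e (Prop i) (Prop j)"
  let ?s = "\<lambda>l. e (Prop l) c * ?g * z * e c (Prop l)"
  have "?g * sand c l z = ?s l + (if l = j then e (Prop i) c * z * e c (Prop j) else 0)" for l
  proof -
    have x: "?g * e (Prop l) c = e (Prop l) c * ?g + (if l = j then e (Prop i) c else 0)"
      using e_e[of "Prop i" "Prop j" "Prop l" c] c by auto
    have "?g * sand c l z = (?g * e (Prop l) c) * z * e c (Prop l)"
      by (simp only: sand_def mult.assoc)
    also have "\<dots> = ?s l + (if l = j then e (Prop i) c * z * e c (Prop j) else 0)"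
      unfolding x by (simp add: distrib_right)
    finally show ?thesis .
  qed
  then have l: "?g * (\<Sum>l\<in>{1..n}. sand c l z) = (\<Sum>l\<in>{1..n}. ?s l) + e (Prop i) c * z * e c (Prop j)"
    using ij by (simp add: sum_distrib_left sum.distrib)
  have "sand c l z * ?g = ?s l + (if l = i then e (Prop i) c * z * e c (Prop j) else 0)" for l
  proof -
    have x: "e c (Prop l) * ?g = ?g * e c (Prop l) + (if l = i then e c (Prop j) else 0)"
      using e_e[of c "Prop l" "Prop i" "Prop j"] c by auto
    have "sand c l z * ?g = e (Prop l) c * z * (e c (Prop l) * ?g)"
      by (simp only: sand_def mult.assoc)
    also have "\<dots> = e (Prop l) c * (z * ?g) * e c (Prop l) + (if l = i then e (Prop l) c * z * e c (Prop j) else 0)"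
      unfolding x by (simp add: distrib_left mult.assoc)
    also have "\<dots> = ?s l + (if l = i then e (Prop i) c * z * e c (Prop j) else 0)"
      unfolding z[symmetric] by (simp add: mult.assoc)
    finally show ?thesis .
  qed
  then have r: "(\<Sum>l\<in>{1..n}. sand c l z) * ?g = (\<Sum>l\<in>{1..n}. ?s l) + e (Prop i) c * z * e c (Prop j)"
    using ij by (simp add: sum_distrib_right sum.distrib)
  show ?thesis unfolding l r ..
qed

lemma nest_commutes:
  assumes "\<forall>c \<in> set cs. virtual c" "i \<in> {1..n}" "j \<in> {1..n}"
    and "e (Prop i) (Prop j) * z = z * e (Prop i) (Prop j)"
  shows "e (Prop i) (Prop j) * nest n cs z = nest n cs z * e (Prop i) (Prop j)"
  using assms(1)
proof (induction cs)
  case (Cons c cs)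
  then show ?case unfolding nest.simps by (intro sum_sand_commutes) (use assms in auto)
qed (use assms in simp)

section \<open>Evaluating nested sums with fewer columns\<close>

definition no_rows_above :: "nat \<Rightarrow> vec \<Rightarrow> bool" where
  "no_rows_above n f \<longleftrightarrow> (\<forall>m i. f m \<noteq> 0 \<longrightarrow> n < i \<longrightarrow> row_count (Prop i) m = 0)"

lemma no_rows_above_vac: "no_rows_above n vac"
  by (simp add: no_rows_above_def vac_def)

lemma no_rows_above_E:
  assumes "no_rows_above n f" "virtual c" "i \<le> n"
  shows "no_rows_above n (E n c (Prop i) f)"
  unfolding no_rows_above_def
proof (intro allI impI)
  fix m l assume "E n c (Prop i) f m \<noteq> 0" "n < l"
  from this(1) show "row_count (Prop l) m = 0"
  proof (cases rule: E_nonzero)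
    case cr
    then have "row_count (Prop l) (m - {#(c, Prop i)#}) = 0"
      using assms(1) \<open>n < l\<close> by (auto simp: no_rows_above_def)
    moreover have "m = add_mset (c, Prop i) (m - {#(c, Prop i)#})" using cr by simp
    ultimately show ?thesis using assms(2) by (metis row_count_simps(2) fst_conv virtual_neq(1))
  next
    case (pol j)
    then have "row_count (Prop l) (add_mset (Prop i, j) (m - {#(c, j)#})) = 0"
      using assms(1) \<open>n < l\<close> by (auto simp only: no_rows_above_def)
    then have "row_count (Prop l) (m - {#(c, j)#}) = 0" by (simp split: if_splits)
    moreover have "m = add_mset (c, j) (m - {#(c, j)#})" using pol by simp
    ultimately show ?thesis using assms(2) by (metis row_count_simps(2) fst_conv virtual_neq(1))
  qed
qed

text \<open>For n < i the symbol i is no column, so nothing is created, and there is no row i to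
  polarize.\<close>

lemma E_no_rows:
  assumes "no_rows_above n f" "n < i"
  shows "E n c (Prop i) f = (\<lambda>m. 0)"
proof (rule ext, rule ccontr)
  fix m assume "E n c (Prop i) f m \<noteq> 0"
  then show False
  proof (cases rule: E_nonzero)
    case cr
    then show ?thesis using assms by (auto simp: cols_def)
  next
    case (pol j)
    then have "row_count (Prop i) (add_mset (Prop i, j) (m - {#(c, j)#})) = 0"
      using assms by (auto simp only: no_rows_above_def)
    then show False by simp
  qed
qed

text \<open>The right factor e c i of the outermost sandwich acts first. It kills \<open>f\<close>
  for i > n; for i \<le> n it brings in only the virtual row c, so the argument repeats for the
  inner sandwich.\<close>

lemma act_nest_mono:
  assumes "n \<le> N" "\<forall>c \<in> set cs. virtual c" "no_rows_above n f"
  shows "act n (nest N cs z) f = act n (nest n cs z) f"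
  using assms(2,3)
proof (induction cs arbitrary: f)
  case (Cons c cs)
  have s: "act n (sand c i x) f = act n (e (Prop i) c) (act n x (E n c (Prop i) f))" for i x
    by (simp add: sand_def act_mult act_e)
  have "act n (nest N (c # cs) z) f = (\<lambda>m. \<Sum>i\<in>{1..N}. act n (sand c i (nest N cs z)) f m)"
    by (simp add: act_sum)
  also have "\<dots> = (\<lambda>m. \<Sum>i\<in>{1..n}. act n (sand c i (nest N cs z)) f m)"
  proof (intro ext sum.mono_neutral_right ballI)
    fix m i assume "i \<in> {1..N} - {1..n}"
    then have "E n c (Prop i) f = (\<lambda>m. 0)" using Cons.prems by (intro E_no_rows) auto
    then show "act n (sand c i (nest N cs z)) f m = 0" unfolding s by (simp add: lin_zero[OF lin_act])
  qed (use assms(1) in auto)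
  also have "\<dots> = (\<lambda>m. \<Sum>i\<in>{1..n}. act n (sand c i (nest n cs z)) f m)"
  proof (intro ext sum.cong refl)
    fix m i assume "i \<in> {1..n}"
    then have "act n (nest N cs z) (E n c (Prop i) f) = act n (nest n cs z) (E n c (Prop i) f)"
      using Cons.prems by (intro Cons.IH no_rows_above_E) auto
    then show "act n (sand c i (nest N cs z)) f m = act n (sand c i (nest n cs z)) f m" by (simp add: s)
  qed
  also have "\<dots> = act n (nest n (c # cs) z) f"
    by (simp add: act_sum)
  finally show ?case .
qed simp

text \<open>The relation behind \<open>devirt\<close>, freed from the definite description: it is
  visibly linear in \<open>y\<close> and \<open>x\<close> together.\<close>

definition represents :: "nat \<Rightarrow> nat \<Rightarrow> nat \<Rightarrow> env \<Rightarrow> env \<Rightarrow> bool" where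
  "represents m0 m1 n y x \<longleftrightarrow> y \<in> U_gl n \<and> x \<in> U_super m0 m1 n \<and> x - y \<in> Irr m0 m1 n"

lemma represents_act: "represents m0 m1 n y x \<Longrightarrow> act k y vac = act k x vac"
  using act_Irr[of "x - y" m0 m1 n k] by (auto simp: represents_def act_diff fun_eq_iff)

lemma represents_scale: "represents m0 m1 n y x \<Longrightarrow> represents m0 m1 n (env_scale c y) (env_scale c x)"
  unfolding represents_def U_gl_def U_super_def
  by (auto simp: env.subspace_scale subspace_U_on subspace_Irr simp flip: env.scale_right_diff_distrib)

lemma represents_zero: "represents m0 m1 n 0 0"
  unfolding represents_def U_gl_def U_super_def
  by (auto simp: env.subspace_0 subspace_U_on subspace_Irr)

lemma represents_add:
  assumes "represents m0 m1 n y x" "represents m0 m1 n y' x'"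
  shows "represents m0 m1 n (y + y') (x + x')"
proof -
  have "(x - y) + (x' - y') \<in> Irr m0 m1 n"
    using assms by (intro env.subspace_add[OF subspace_Irr]) (auto simp: represents_def)
  moreover have "(x - y) + (x' - y') = x + x' - (y + y')" by simp
  ultimately show ?thesis
    using assms unfolding represents_def U_gl_def U_super_def
    by (auto intro!: env.subspace_add[OF subspace_U_on])
qed

lemma represents_sum:
  "(\<And>t. t \<in> T \<Longrightarrow> represents m0 m1 n (y t) (x t)) \<Longrightarrow> represents m0 m1 n (\<Sum>t\<in>T. y t) (\<Sum>t\<in>T. x t)"
  by (induction T rule: infinite_finite_induct) (auto intro: represents_zero represents_add)

lemma represents_devirt:
  assumes "set w \<subseteq> (virtual_symbols m0 m1 \<union> proper_symbols n) \<times> (virtual_symbols m0 m1 \<union> proper_symbols n)"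
    and "balanced m0 m1 w"
  shows "represents m0 m1 n (devirt m0 m1 n (e_word w)) (e_word w)"
  using devirt_balanced[OF assms] e_word_in_U_on[OF assms(1)] by (simp add: represents_def U_super_def)

lemma U_gl_commutes:
  assumes "u \<in> U_gl n" "\<And>i j. i \<in> {1..n} \<Longrightarrow> j \<in> {1..n} \<Longrightarrow> e (Prop i) (Prop j) * y = y * e (Prop i) (Prop j)"
  shows "u * y = y * u"
proof -
  have word: "e_word w * y = y * e_word w" if "set w \<subseteq> cols n \<times> cols n" for w
    using that
  proof (induction w)
    case (Cons l w)
    obtain a b where l: "l = (a, b)" by force
    then have "e a b * y = y * e a b" using Cons.prems assms(2) by (auto simp: cols_def)
    then show ?case using Cons by (simp add: l e_word_Cons) (metis mult.assoc)
  qed simp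
  show ?thesis using assms(1) unfolding U_gl_def' U_on_span
  proof (induction rule: env.span_induct_alt)
    case (step c x z)
    then show ?case using word by (auto simp: distrib_left distrib_right)
  qed simp
qed

lemma zetaI:
  assumes "y \<in> U_gl n" "\<And>i j. i \<in> {1..n} \<Longrightarrow> j \<in> {1..n} \<Longrightarrow> e (Prop i) (Prop j) * y = y * e (Prop i) (Prop j)"
  shows "y \<in> zeta n"
  using assms U_gl_commutes[of _ n y] by (auto simp: zeta_def)

lemma U_gl_mono: "n \<le> N \<Longrightarrow> U_gl n \<subseteq> U_gl N"
  unfolding U_gl_def' by (rule U_on_mono) (auto simp: cols_def)

lemma e_in_U_gl: "i \<in> {1..n} \<Longrightarrow> j \<in> {1..n} \<Longrightarrow> e (Prop i) (Prop j) \<in> U_gl n"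
  unfolding U_gl_def' by (rule e_in_U_on) (auto simp: cols_def)

text \<open>Moving a generator e a b past e i j gives no term e a j, since b \<noteq> i, and each
  remaining term has a rightmost letter with second index b, which kills 1. So the kernel is stable
  under right multiplication by gl(n).\<close>

lemma act_col_ideal_E:
  assumes "x \<in> col_ideal n A" "i \<in> {1..n}"
  shows "act n x (E n (Prop i) (Prop j) vac) = (\<lambda>m. 0)"
  using assms(1) unfolding col_ideal_def
proof (rule act_left_ideal)
  fix y assume "y \<in> {e a b | a b. a \<in> A \<and> b \<in> A - cols n}"
  then obtain a b where y: "y = e a b" "b \<notin> cols n" by auto
  then have "b \<noteq> Prop i" using assms(2) by (auto simp: cols_def)
  then show "act n y (E n (Prop i) (Prop j) vac) = (\<lambda>m. 0)"
    using y(2) E_vac[of n _ b] by (intro ext) (simp add: y(1) act_e E_E[of n a b] lin_zero[OF lin_E])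
qed

text \<open>For g = e i j, the products y g and x g agree at 1 by stability of the kernel, and g x
  and g y agree because x and y do. Commutation of x with g passes to y by injectivity on
  U(gl(n)).\<close>

lemma represents_zeta:
  assumes r: "represents m0 m1 n y x"
    and comm: "\<And>i j. i \<in> {1..n} \<Longrightarrow> j \<in> {1..n} \<Longrightarrow> e (Prop i) (Prop j) * x = x * e (Prop i) (Prop j)"
  shows "y \<in> zeta n"
proof (rule zetaI)
  show y: "y \<in> U_gl n" using r by (simp add: represents_def)
  fix i j assume ij: "i \<in> {1..n}" "j \<in> {1..n}"
  let ?g = "e (Prop i) (Prop j)"
  have "x - y \<in> U_super m0 m1 n"
    using r U_gl_subset_U_super[of n m0 m1]
    by (auto simp: represents_def U_super_def intro!: env.subspace_diff[OF subspace_U_on])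
  then have "x - y \<in> col_ideal n (virtual_symbols m0 m1 \<union> proper_symbols n)"
    unfolding U_super_def by (rule kernel_vac) (use r act_Irr[of "x - y" m0 m1 n n] in \<open>simp add: represents_def\<close>)
  then have "act n (x - y) (E n (Prop i) (Prop j) vac) = (\<lambda>m. 0)" by (rule act_col_ideal_E[OF _ ij(1)])
  then have "act n (y * ?g) vac = act n (x * ?g) vac"
    by (simp add: act_mult act_e act_diff fun_eq_iff)
  also have "\<dots> = act n (?g * x) vac" using comm[OF ij] by simp
  also have "\<dots> = act n (?g * y) vac" using represents_act[OF r, of n] by (simp add: act_mult)
  finally show "?g * y = y * ?g"
    using y e_in_U_gl[OF ij] by (intro U_gl_inj[of _ n]) (auto simp: U_gl_def intro: U_on_mult)
qed

lemma ideal_I_eq: "ideal_I (n + 1) = col_ideal n (cols (n + 1))"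
proof -
  have d: "cols (n + 1) - cols n = {Prop (n + 1)}"
    by (auto simp: cols_def)
  have "{e (Prop i) (Prop (n + 1)) | i. i \<in> {1..n + 1}} = {e a b | a b. a \<in> cols (n + 1) \<and> b \<in> cols (n + 1) - cols n}"
    unfolding d by (auto simp: cols_def)
  then show ?thesis by (simp add: ideal_I_def col_ideal_def U_gl_def')
qed

lemma U_gl_commutes_last:
  assumes "y \<in> U_gl n"
  shows "y * e (Prop (n + 1)) (Prop (n + 1)) = e (Prop (n + 1)) (Prop (n + 1)) * y"
proof (rule U_gl_commutes[OF assms])
  fix i j assume "i \<in> {1..n}" "j \<in> {1..n}"
  then show "e (Prop i) (Prop j) * e (Prop (n + 1)) (Prop (n + 1)) = e (Prop (n + 1)) (Prop (n + 1)) * e (Prop i) (Prop j)"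
    using e_e[of "Prop i" "Prop j" "Prop (n + 1)" "Prop (n + 1)"] by auto
qed

lemma ideal_I_0I:
  assumes "z \<in> zeta (n + 1)" "x \<in> U_gl n" "act n z vac = act n x vac"
  shows "z - x \<in> ideal_I_0 (n + 1)"
proof -
  have U: "z - x \<in> U_gl (n + 1)"
    using assms(1,2) U_gl_mono[of n "n + 1"] by (auto simp: zeta_def U_gl_def intro!: env.subspace_diff[OF subspace_U_on])
  then have "z - x \<in> ideal_I (n + 1)"
    unfolding ideal_I_eq U_gl_def' by (rule kernel_vac) (use assms(3) in \<open>simp add: act_diff\<close>)
  moreover have "z * e (Prop (n + 1)) (Prop (n + 1)) = e (Prop (n + 1)) (Prop (n + 1)) * z"
    using assms(1) e_in_U_gl[of "n + 1" "n + 1" "n + 1"] by (simp add: zeta_def)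
  ultimately show ?thesis
    using U U_gl_commutes_last[OF assms(2)]
    by (simp add: ideal_I_0_def U_gl_0_def left_diff_distrib right_diff_distrib)
qed

text \<open>The factor \<open>k\<close>, the symbols \<open>cs\<close> and the core \<open>z\<close>
  are the same for all n; only the range of the summation indices changes. Evaluating the element
  for n + 1 with n columns cuts this range down to that of n.\<close>

lemma nest_family:
  assumes rep: "\<And>n. represents m0 m1 n (y n) (env_scale k (nest n cs z))"
    and cs: "\<forall>c \<in> set cs. virtual c"
    and z: "\<And>i j. e (Prop i) (Prop j) * z = z * e (Prop i) (Prop j)"
  shows "y n \<in> zeta n" "act n (y (n + 1)) vac = act n (y n) vac"
    "y (n + 1) - y n \<in> ideal_I_0 (n + 1)"
proof -
  show zeta: "y n \<in> zeta n" for n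
    by (rule represents_zeta[OF rep]) (use nest_commutes[OF cs _ _ z] in auto)
  show act: "act n (y (n + 1)) vac = act n (y n) vac"
    by (simp only: represents_act[OF rep] act_scale act_nest_mono[OF le_add1 cs no_rows_above_vac])
  show "y (n + 1) - y n \<in> ideal_I_0 (n + 1)"
    by (rule ideal_I_0I[OF zeta _ act]) (use zeta[of n] in \<open>simp add: zeta_def\<close>)
qed

section \<open>Capelli, Nazarov and Schur elements as nested sums\<close>

definition sand_word :: "(nat \<times> symbol) list \<Rightarrow> env \<Rightarrow> env" where
  "sand_word ps z = foldr (\<lambda>(i, c). sand c i) ps z"

lemma sand_word_simps [simp]:
  "sand_word [] z = z" "sand_word ((i, c) # ps) z = sand c i (sand_word ps z)"
  by (simp_all add: sand_word_def)

lemma sand_word_append: "sand_word (ps @ qs) z = sand_word ps (sand_word qs z)"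
  by (simp add: sand_word_def)

lemma sand_word_e_word:
  "sand_word ps (e_word w) =
     e_word (map (\<lambda>(i, c). (Prop i, c)) ps @ w @ rev (map (\<lambda>(i, c). (c, Prop i)) ps))"
proof (induction ps)
  case (Cons p ps)
  then show ?case by (cases p) (simp add: sand_def e_word_append e_word_Cons mult.assoc)
qed simp

text \<open>Exchanging the left factors and exchanging the right factors cost the same sign, which
  cancels.\<close>

lemma sand_commute:
  assumes "virtual c"
  shows "sand c i (sand c j z) = sand c j (sand c i z)"
proof -
  let ?s = "ssgn (Prop i) c (Prop j) c"
  have x: "e (Prop i) c * e (Prop j) c = env_scale ?s (e (Prop j) c * e (Prop i) c)"
    using e_e[of "Prop i" c "Prop j" c] assms by simp
  have "ssgn c (Prop j) c (Prop i) = ?s"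
    by (simp add: ssgn_def add.commute)
  then have y: "e c (Prop j) * e c (Prop i) = env_scale ?s (e c (Prop i) * e c (Prop j))"
    using e_e[of c "Prop j" c "Prop i"] assms by simp
  have "sand c i (sand c j z) = (e (Prop i) c * e (Prop j) c) * z * (e c (Prop j) * e c (Prop i))"
    by (simp only: sand_def mult.assoc)
  also have "\<dots> = (e (Prop j) c * e (Prop i) c) * z * (e c (Prop i) * e c (Prop j))"
    unfolding x y by simp
  finally show ?thesis by (simp only: sand_def mult.assoc)
qed

lemma sand_sand_odd: "parity c = 0 \<Longrightarrow> sand c i (sand c i z) = 0"
proof -
  assume "parity c = 0"
  then have "e (Prop i) c * e (Prop i) c = 0" by (intro e_square_odd) (simp add: odd_var_def)
  moreover have "sand c i (sand c i z) = (e (Prop i) c * e (Prop i) c) * z * (e c (Prop i) * e c (Prop i))"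
    by (simp only: sand_def mult.assoc)
  ultimately show ?thesis by simp
qed

lemma sand_foldr_mset:
  assumes "virtual c" "mset xs = mset ys"
  shows "foldr (sand c) xs z = foldr (sand c) ys z"
proof -
  have "fold (sand c) (rev xs) = fold (sand c) (rev ys)"
    using assms by (intro fold_multiset_equiv) (auto simp: sand_commute fun_eq_iff)
  then show ?thesis by (simp add: foldr_conv_fold)
qed

lemma sand_word_const: "sand_word (map (\<lambda>i. (i, c)) is) z = foldr (sand c) is z"
  by (induction "is") simp_all

lemma env_scale_of_nat: "env_scale (of_nat k) x = of_nat k * x"
  by (induction k) (simp_all add: env.scale_left_distrib distrib_right)

lemma nest_replicate_words:
  "nest n (replicate k c) z = (\<Sum>ws\<in>{ws. set ws \<subseteq> {1..n} \<and> length ws = k}. foldr (sand c) ws z)"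
proof (induction k)
  case 0
  have "{ws. set ws \<subseteq> {1..n} \<and> length ws = 0} = {[]}" by auto
  then show ?case by simp
next
  case (Suc k)
  let ?L = "\<lambda>k. {ws. set ws \<subseteq> {1..n} \<and> length ws = k}"
  have "nest n (replicate (Suc k) c) z = (\<Sum>i\<in>{1..n}. \<Sum>ws\<in>?L k. foldr (sand c) (i # ws) z)"
    by (simp add: Suc sand_sum)
  also have "\<dots> = (\<Sum>(i, ws)\<in>{1..n} \<times> ?L k. foldr (sand c) (i # ws) z)"
    by (rule sum.cartesian_product)
  also have "\<dots> = (\<Sum>ws\<in>?L (Suc k). foldr (sand c) ws z)"
    by (rule sum.reindex_bij_witness[of _ "\<lambda>ws. (hd ws, tl ws)" "\<lambda>(i, ws). i # ws"])
      (auto simp: length_Suc_conv)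
  finally show ?case .
qed

text \<open>Sandwiches with the same \<open>c\<close> commute, so a term depends only on the
  multiset of its indices, whose orderings are counted by a multinomial coefficient. After division
  by k! this is the weight 1/(h1! ... hn!) of the Nazarov elements.\<close>

lemma nest_replicate:
  assumes "virtual c"
  shows "nest n (replicate k c) z =
    (\<Sum>M\<in>{M. set_mset M \<subseteq> {1..n} \<and> size M = k}.
       env_scale (fact k / (\<Prod>x\<in>set_mset M. fact (count M x))) (foldr (sand c) (sorted_list_of_multiset M) z))"
proof -
  let ?L = "{ws. set ws \<subseteq> {1..n} \<and> length ws = k}" and ?T = "{M. set_mset M \<subseteq> {1..n} \<and> size M = k}"
  have fin: "finite ?L" by (rule finite_lists_length_eq) simp
  have finT: "finite ?T" by (rule finite_subset[OF _ finite_multisets[of "{1..n}" k]]) auto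
  have "nest n (replicate k c) z = (\<Sum>M\<in>?T. \<Sum>ws\<in>{ws \<in> ?L. mset ws = M}. foldr (sand c) ws z)"
    unfolding nest_replicate_words by (rule sum.group[symmetric, OF fin finT]) auto
  also have "\<dots> = (\<Sum>M\<in>?T. env_scale (fact k / (\<Prod>x\<in>set_mset M. fact (count M x)))
      (foldr (sand c) (sorted_list_of_multiset M) z))"
  proof (rule sum.cong[OF refl])
    fix M assume M: "M \<in> ?T"
    then have "{ws \<in> ?L. mset ws = M} = permutations_of_multiset M"
      by (auto simp: permutations_of_multiset_def)
    then have "(\<Sum>ws\<in>{ws \<in> ?L. mset ws = M}. foldr (sand c) ws z)
      = (\<Sum>ws\<in>permutations_of_multiset M. foldr (sand c) (sorted_list_of_multiset M) z)"
      using sand_foldr_mset[OF assms] by (intro sum.cong) (auto simp: permutations_of_multiset_def)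
    also have "\<dots> = env_scale (of_nat (card (permutations_of_multiset M))) (foldr (sand c) (sorted_list_of_multiset M) z)"
      by (simp add: env_scale_of_nat)
    also have "(of_nat (card (permutations_of_multiset M)) :: complex) = fact k / (\<Prod>x\<in>set_mset M. fact (count M x))"
    proof -
      have "of_nat (card (permutations_of_multiset M) * (\<Prod>x\<in>set_mset M. fact (count M x))) = (of_nat (fact k) :: complex)"
        using M by (simp only: card_permutations_of_multiset_aux) simp
      then show ?thesis by (simp add: field_simps)
    qed
    finally show "(\<Sum>ws\<in>{ws \<in> ?L. mset ws = M}. foldr (sand c) ws z) =
      env_scale (fact k / (\<Prod>x\<in>set_mset M. fact (count M x))) (foldr (sand c) (sorted_list_of_multiset M) z)" .
  qed
  finally show ?thesis .
qed

definition strict_words :: "nat \<Rightarrow> nat \<Rightarrow> nat list set" where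
  "strict_words n k = {is. length is = k \<and> sorted_wrt (<) is \<and> set is \<subseteq> {1..n}}"

lemma finite_strict_words: "finite (strict_words n k)"
  by (rule finite_subset[OF _ finite_lists_length_eq[of "{1..n}" k]]) (auto simp: strict_words_def)

lemma foldr_sand_repeated:
  assumes "virtual c" "parity c = 0" "\<not> distinct ws"
  shows "foldr (sand c) ws z = 0"
proof -
  obtain x where x: "count (mset ws) x \<noteq> (if x \<in> set ws then 1 else 0)"
    using assms(3) distinct_count_atmost_1[of ws] by blast
  have "x \<in> set ws"
  proof (rule ccontr)
    assume "x \<notin> set ws"
    then show False using x by (simp add: count_eq_zero_iff)
  qed
  then have "count (mset ws) x \<noteq> 1" using x by simp
  with \<open>x \<in> set ws\<close> have "count (mset ws) x > 1"
    by (metis One_nat_def Suc_lessI count_greater_zero_iff set_mset_mset)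
  then have "{#x, x#} \<subseteq># mset ws" by (auto simp: subseteq_mset_def)
  then obtain m where m: "mset ws = {#x, x#} + m" by (metis subset_mset.add_diff_inverse)
  obtain u where u: "mset u = m" by (metis ex_mset)
  have "foldr (sand c) ws z = foldr (sand c) (x # x # u) z"
    by (rule sand_foldr_mset[OF assms(1)]) (simp add: m u)
  then show ?thesis by (simp add: sand_sand_odd assms(2))
qed

text \<open>A repeated index produces the square of an odd letter. What survives are the k!
  orderings of each increasing word.\<close>

lemma nest_replicate_odd:
  assumes c: "virtual c" "parity c = 0"
  shows "nest n (replicate k c) z = env_scale (fact k) (\<Sum>is\<in>strict_words n k. foldr (sand c) is z)"
proof -
  let ?T = "{M. set_mset M \<subseteq> {1..n} \<and> size M = k}"
  let ?f = "\<lambda>M. env_scale (fact k / (\<Prod>x\<in>set_mset M. fact (count M x))) (foldr (sand c) (sorted_list_of_multiset M) z)"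
  have finT: "finite ?T" by (rule finite_subset[OF _ finite_multisets[of "{1..n}" k]]) auto
  have "sum ?f ?T = sum ?f (mset ` strict_words n k)"
  proof (rule sum.mono_neutral_right[OF finT])
    show "mset ` strict_words n k \<subseteq> ?T" by (auto simp: strict_words_def)
    show "\<forall>M\<in>?T - mset ` strict_words n k. ?f M = 0"
    proof
      fix M assume M: "M \<in> ?T - mset ` strict_words n k"
      have "\<not> distinct (sorted_list_of_multiset M)"
      proof
        have len: "length (sorted_list_of_multiset M) = size M"
          by (metis mset_sorted_list_of_multiset size_mset)
        assume "distinct (sorted_list_of_multiset M)"
        then have "sorted_list_of_multiset M \<in> strict_words n k"
          using M len by (auto simp: strict_words_def strict_sorted_iff)
        then have "mset (sorted_list_of_multiset M) \<in> mset ` strict_words n k" by (rule imageI)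
        then show False using M by (simp only: mset_sorted_list_of_multiset) blast
      qed
      then show "?f M = 0" by (simp add: foldr_sand_repeated[OF c])
    qed
  qed
  also have "\<dots> = (\<Sum>is\<in>strict_words n k. ?f (mset is))"
  proof (rule sum.reindex[unfolded comp_def])
    show "inj_on mset (strict_words n k)"
    proof (rule inj_on_inverseI)
      fix "is" assume "is \<in> strict_words n k"
      then show "sorted_list_of_multiset (mset is) = is"
        by (simp add: strict_words_def strict_sorted_iff sorted_sort_id)
    qed
  qed
  also have "\<dots> = (\<Sum>is\<in>strict_words n k. env_scale (fact k) (foldr (sand c) is z))"
  proof (rule sum.cong[OF refl])
    fix "is" assume "is": "is \<in> strict_words n k"
    then have "distinct is" "sorted is" by (auto simp: strict_words_def strict_sorted_iff)
    then have s: "sorted_list_of_multiset (mset is) = is"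
      by (simp add: sorted_sort_id)
    have "(\<Prod>x\<in>set_mset (mset is). fact (count (mset is) x)) = (1 :: complex)"
    proof (rule prod.neutral, rule ballI)
      fix x assume "x \<in> set_mset (mset is)"
      then have "count (mset is) x = 1"
        using \<open>distinct is\<close> distinct_count_atmost_1[of "is"] by (metis set_mset_mset)
      then show "fact (count (mset is) x) = (1 :: complex)" by (simp only: fact_1)
    qed
    then show "?f (mset is) = env_scale (fact k) (foldr (sand c) is z)"
      by (simp only: s div_by_1)
  qed
  finally show ?thesis by (simp add: nest_replicate[OF c(1)] env.scale_sum_right)
qed

lemma filter_fst_zip:
  "length xs = length ys \<Longrightarrow> length (filter (\<lambda>(a, b). a = c) (zip xs ys)) = count_list xs c"
  by (induction xs ys rule: list_induct2) auto

lemma filter_snd_zip: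
  "length xs = length ys \<Longrightarrow> length (filter (\<lambda>(a, b). b = c) (zip xs ys)) = count_list ys c"
  by (induction xs ys rule: list_induct2) auto

lemma count_list_Prop: "c \<in> virtual_symbols m0 m1 \<Longrightarrow> count_list (map Prop xs) c = 0"
  by (induction xs) (auto simp: virtual_symbols_def)

lemma balanced_sandwich:
  assumes "length is = length cs" "balanced m0 m1 w"
  shows "balanced m0 m1 (zip (map Prop is) cs @ w @ zip cs (map Prop is))"
  using assms by (auto simp: balanced_def filter_fst_zip filter_snd_zip count_list_Prop)

lemma balanced_mset: "mset v = mset w \<Longrightarrow> balanced m0 m1 v \<longleftrightarrow> balanced m0 m1 w"
  unfolding balanced_def by (metis mset_filter size_mset)

lemma sand_word_zip:
  "length is = length cs \<Longrightarrow> sand_word (zip is cs) (e_word w) =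
     e_word (zip (map Prop is) cs @ w @ rev (zip cs (map Prop is)))"
proof -
  assume "length is = length cs"
  then have "map (\<lambda>(i, c). (Prop i, c)) (zip is cs) = zip (map Prop is) cs"
    "map (\<lambda>(i, c). (c, Prop i)) (zip is cs) = zip cs (map Prop is)"
    by (induction "is" cs rule: list_induct2) auto
  then show ?thesis by (simp add: sand_word_e_word)
qed

lemma set_zip_subset: "set (zip xs ys) \<subseteq> set xs \<times> set ys"
  by (auto dest: set_zip_leftD set_zip_rightD)

lemma represents_sand_word:
  assumes "length is = length cs" "set is \<subseteq> {1..n}" "set cs \<subseteq> virtual_symbols m0 m1"
    and "set w \<subseteq> virtual_symbols m0 m1 \<times> virtual_symbols m0 m1" "balanced m0 m1 w"
  shows "represents m0 m1 n (devirt m0 m1 n (sand_word (zip is cs) (e_word w))) (sand_word (zip is cs) (e_word w))"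
  unfolding sand_word_zip[OF assms(1)]
proof (rule represents_devirt)
  have "set (zip (map Prop is) cs) \<subseteq> proper_symbols n \<times> virtual_symbols m0 m1"
    using assms(2,3) set_zip_subset[of "map Prop is" cs] by (fastforce simp: proper_symbols_def)
  moreover have "set (zip cs (map Prop is)) \<subseteq> virtual_symbols m0 m1 \<times> proper_symbols n"
    using assms(2,3) set_zip_subset[of cs "map Prop is"] by (fastforce simp: proper_symbols_def)
  ultimately show "set (zip (map Prop is) cs @ w @ rev (zip cs (map Prop is)))
    \<subseteq> (virtual_symbols m0 m1 \<union> proper_symbols n) \<times> (virtual_symbols m0 m1 \<union> proper_symbols n)"
    using assms(4) by auto
  show "balanced m0 m1 (zip (map Prop is) cs @ w @ rev (zip cs (map Prop is)))"
    using balanced_sandwich[OF assms(1,5)] by (subst balanced_mset[where w = "zip (map Prop is) cs @ w @ zip cs (map Prop is)"]) simp_all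
qed

lemma foldr_sand_eq_sand_word: "foldr (sand c) is z = sand_word (zip is (replicate (length is) c)) z"
  by (induction "is") simp_all

lemma represents_foldr_sand:
  assumes "set is \<subseteq> {1..n}" "c \<in> virtual_symbols m0 m1"
  shows "represents m0 m1 n (devirt m0 m1 n (foldr (sand c) is 1)) (foldr (sand c) is 1)"
proof -
  have "set (replicate (length is) c) \<subseteq> virtual_symbols m0 m1" using assms(2) by auto
  then show ?thesis
    using represents_sand_word[of "is" "replicate (length is) c" n m0 m1 "[]"] assms
    by (simp add: foldr_sand_eq_sand_word balanced_def)
qed

lemma foldr_sand_e_word:
  "foldr (sand c) is 1 = e_word (map (\<lambda>i. (Prop i, c)) is) * e_word (rev (map (\<lambda>i. (c, Prop i)) is))"
  using sand_word_e_word[of "map (\<lambda>i. (i, c)) is" "[]"]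
  by (simp add: sand_word_const e_word_append comp_def)

lemma virtual_in: "c \<in> virtual_symbols m0 m1 \<Longrightarrow> virtual c"
  by (auto simp: virtual_symbols_def virtual_def)

text \<open>In the Capelli product the smallest index sits in the middle, whereas a list of
  sandwiches starts from the outside; hence \<open>rev\<close>.\<close>

lemma capelli_H_sand:
  "capelli_H m0 m1 n k = (\<Sum>is\<in>strict_words n k. devirt m0 m1 n (foldr (sand (Pos 1)) (rev is) 1))"
  by (simp add: capelli_H_def strict_words_def foldr_sand_e_word rev_map)

lemma represents_capelli_H_sum:
  assumes "1 \<le> m0"
  shows "represents m0 m1 n (capelli_H m0 m1 n k) (\<Sum>is\<in>strict_words n k. foldr (sand (Pos 1)) (rev is) 1)"
  unfolding capelli_H_sand
  by (intro represents_sum represents_foldr_sand) (use assms in \<open>auto simp: strict_words_def virtual_symbols_def\<close>)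

lemma represents_capelli_H:
  assumes "1 \<le> m0"
  shows "represents m0 m1 n (capelli_H m0 m1 n k) (env_scale (1 / fact k) (nest n (replicate k (Pos 1)) 1))"
proof -
  note v = virtual_Pos
  have "(\<Sum>is\<in>strict_words n k. foldr (sand (Pos 1)) (rev is) 1) = (\<Sum>is\<in>strict_words n k. foldr (sand (Pos 1)) is 1)"
    by (intro sum.cong sand_foldr_mset[OF v]) simp_all
  also have "\<dots> = env_scale (1 / fact k) (nest n (replicate k (Pos 1)) 1)"
    unfolding nest_replicate_odd[OF v parity.simps(1)] by simp
  finally show ?thesis using represents_capelli_H_sum[OF assms, of m1 n k] by simp
qed

lemma prod_list_powers:
  "prod_list (map (\<lambda>i. e (f i) (g i) ^ h i) is) = e_word (concat (map (\<lambda>i. replicate (h i) (f i, g i)) is))"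
proof (induction "is")
  case (Cons i "is")
  have "e_word (replicate k (a, b)) = e a b ^ k" for k a b
    by (induction k) (simp_all add: e_word_Cons)
  with Cons show ?case by (simp add: e_word_append)
qed simp

lemma represents_nazarov_I:
  assumes "1 \<le> m1"
  shows "represents m0 m1 n (nazarov_I m0 m1 n k) (env_scale (1 / fact k) (nest n (replicate k (Neg 1)) 1))"
proof -
  let ?c = "Neg 1"
  have v: "virtual ?c" by (auto simp: virtual_def)
  let ?T = "{M. set_mset M \<subseteq> {1..n} \<and> size M = k}"
  let ?H = "{h \<in> {1..n} \<rightarrow>\<^sub>E UNIV. (\<Sum>i = 1..n. h i) = k} :: (nat \<Rightarrow> nat) set"
  \<comment> \<open>Exponent tuples correspond to multisets of indices through the word with
    \<open>h i\<close> copies of each i.\<close>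
  define W where "W h = concat (map (\<lambda>i. replicate (h i) i) [1..<n + 1])" for h :: "nat \<Rightarrow> nat"
  have countW: "count (mset (W h)) x = (if x \<in> {1..n} then h x else 0)" for h x
  proof -
    have "count (mset (concat (map (\<lambda>i. replicate (h i) i) js))) x = (if x \<in> set js then h x else 0)"
      if "distinct js" for js
      using that by (induction js) auto
    then show ?thesis unfolding W_def by (auto simp del: upt_Suc)
  qed
  have setW: "set (W h) \<subseteq> {1..n}" for h by (auto simp: W_def)
  have eW: "prod_list (map (\<lambda>i. e (Prop i) ?c ^ h i) (rev [1..<n + 1])) * prod_list (map (\<lambda>i. e ?c (Prop i) ^ h i) [1..<n + 1])
      = foldr (sand ?c) (rev (W h)) 1" for h
    by (simp add: prod_list_powers foldr_sand_e_word W_def rev_concat map_concat rev_map comp_def del: upt_Suc)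
  have sizeW: "size (mset (W h)) = (\<Sum>i = 1..n. h i)" for h
  proof -
    have "length (W h) = sum_list (map h [1..<n + 1])"
      by (simp add: W_def length_concat comp_def del: upt_Suc)
    also have "\<dots> = (\<Sum>i\<in>set [1..<n + 1]. h i)"
      by (rule sum_list_distinct_conv_sum_set) simp
    also have "set [1..<n + 1] = {1..n}" by auto
    finally show ?thesis by simp
  qed
  have "nazarov_I m0 m1 n k =
      (\<Sum>h\<in>?H. env_scale (1 / (\<Prod>i = 1..n. fact (h i))) (devirt m0 m1 n (foldr (sand ?c) (rev (W h)) 1)))"
    unfolding nazarov_I_def eW ..
  moreover have "represents m0 m1 n \<dots> (\<Sum>h\<in>?H. env_scale (1 / (\<Prod>i = 1..n. fact (h i))) (foldr (sand ?c) (rev (W h)) 1))"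
    by (intro represents_sum represents_scale represents_foldr_sand) (use assms setW in \<open>auto simp: virtual_symbols_def\<close>)
  moreover have "(\<Sum>h\<in>?H. env_scale (1 / (\<Prod>i = 1..n. fact (h i))) (foldr (sand ?c) (rev (W h)) 1))
    = (\<Sum>M\<in>?T. env_scale (1 / (\<Prod>x\<in>set_mset M. fact (count M x))) (foldr (sand ?c) (sorted_list_of_multiset M) 1))"
  proof (rule sum.reindex_bij_witness[of _ "\<lambda>M. restrict (count M) {1..n}" "\<lambda>h. mset (W h)"])
    fix h assume h: "h \<in> ?H"
    show "restrict (count (mset (W h))) {1..n} = h"
      using h by (auto simp: countW fun_eq_iff restrict_def PiE_def extensional_def)
    show "mset (W h) \<in> ?T" using h setW sizeW by auto
    \<comment> \<open>Indices that are absent from the word have exponent 0 and contribute 0! =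
      1.\<close>
    have "(\<Prod>i = 1..n. fact (h i)) = (\<Prod>x\<in>set_mset (mset (W h)). fact (count (mset (W h)) x) :: complex)"
    proof (rule prod.mono_neutral_cong_right)
      show "set_mset (mset (W h)) \<subseteq> {1..n}" using setW by simp
      show "\<forall>i\<in>{1..n} - set_mset (mset (W h)). fact (h i) = (1 :: complex)"
      proof
        fix i assume "i \<in> {1..n} - set_mset (mset (W h))"
        then have "count (mset (W h)) i = 0" "i \<in> {1..n}" by (auto simp: count_eq_zero_iff)
        then show "fact (h i) = (1 :: complex)" by (simp add: countW)
      qed
      show "fact (h i) = fact (count (mset (W h)) i)" if "i \<in> set_mset (mset (W h))" for i
        using that setW[of h] by (auto simp: countW)
    qed simp
    moreover have "foldr (sand ?c) (sorted_list_of_multiset (mset (W h))) 1 = foldr (sand ?c) (rev (W h)) 1"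
      by (rule sand_foldr_mset[OF v]) simp
    ultimately show "env_scale (1 / (\<Prod>x\<in>set_mset (mset (W h)). fact (count (mset (W h)) x)))
        (foldr (sand ?c) (sorted_list_of_multiset (mset (W h))) 1)
      = env_scale (1 / (\<Prod>i = 1..n. fact (h i))) (foldr (sand ?c) (rev (W h)) 1)"
      by simp
  next
    fix M assume M: "M \<in> ?T"
    show eq: "mset (W (restrict (count M) {1..n})) = M"
    proof (rule multiset_eqI)
      fix x show "count (mset (W (restrict (count M) {1..n}))) x = count M x"
      proof (cases "x \<in> {1..n}")
        case False
        then have "x \<notin># M" using M by auto
        then show ?thesis using False by (simp add: countW not_in_iff)
      qed (simp add: countW)
    qed
    show "restrict (count M) {1..n} \<in> ?H"
      using M sizeW[of "restrict (count M) {1..n}"] unfolding eq by auto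
  qed
  moreover have "\<dots> = env_scale (1 / fact k) (nest n (replicate k ?c) 1)"
    unfolding nest_replicate[OF v] by (simp add: env.scale_sum_right)
  ultimately show ?thesis by simp
qed

section \<open>Schur elements as nested sums\<close>

fun rev_sgn :: "nat \<Rightarrow> complex" where
  "rev_sgn 0 = 1"
| "rev_sgn (Suc k) = (- 1) ^ k * rev_sgn k"

lemma rev_sgn_sq [simp]: "rev_sgn k * rev_sgn k = 1"
proof (induction k)
  case (Suc k)
  have "rev_sgn (Suc k) * rev_sgn (Suc k) = ((- 1) ^ k * (- 1) ^ k) * (rev_sgn k * rev_sgn k)" by simp
  then show ?case using Suc by (simp flip: power_add mult_2)
qed simp

text \<open>Letters e (Pos s) (Prop i) anticommute, so reversal costs the sign of the reversing
  permutation. A bitableau lists its right-hand block in reading order, a sandwich needs it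
  reversed.\<close>

lemma e_word_rev:
  assumes "set w \<subseteq> range Pos \<times> range Prop"
  shows "e_word (rev w) = env_scale (rev_sgn (length w)) (e_word w)"
proof -
  have move: "e_word w * e a b = env_scale ((- 1) ^ length w) (e a b * e_word w)"
    if "set w \<subseteq> range Pos \<times> range Prop" "a \<in> range Pos" "b \<in> range Prop" for w a b
    using that
  proof (induction w)
    case (Cons l w)
    obtain c d where l: "l = (c, d)" by force
    have s: "e c d * e a b = env_scale (- 1) (e a b * e c d)"
      using Cons.prems e_e[of c d a b] by (auto simp: l ssgn_def)
    have "e_word (l # w) * e a b = e c d * (e_word w * e a b)"
      by (simp add: l e_word_Cons mult.assoc)
    also have "\<dots> = env_scale ((- 1) ^ length w) ((e c d * e a b) * e_word w)"
      using Cons by (simp add: mult.assoc)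
    finally show ?case by (simp add: s l e_word_Cons mult.assoc)
  qed simp
  show ?thesis using assms
  proof (induction w)
    case (Cons l w)
    then show ?case using move[of w "fst l" "snd l"]
      by (cases l) (auto simp: e_word_append e_word_Cons mult.commute)
  qed simp
qed

lemma virtual_word_commutes:
  assumes "set w \<subseteq> Collect virtual \<times> Collect virtual"
  shows "e (Prop i) (Prop j) * e_word w = e_word w * e (Prop i) (Prop j)"
  using assms
proof (induction w)
  case (Cons l w)
  obtain a b where l: "l = (a, b)" by force
  have "e (Prop i) (Prop j) * e a b = e a b * e (Prop i) (Prop j)"
    using Cons.prems e_e[of "Prop i" "Prop j" a b] by (auto simp: l)
  then show ?case using Cons by (simp add: l e_word_Cons) (metis mult.assoc)
qed simp

text \<open>The reading word of a \<open>Cstar\<close> tableau, with the rows given as pairs of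
  length and index so that an induction can split off the first row.\<close>

definition pos_word :: "(nat \<times> nat) list \<Rightarrow> symbol list" where
  "pos_word ps = concat (map (\<lambda>(k, s). replicate k (Pos s)) ps)"

lemma row_strict_Cons:
  "row_strict_tableaux n (k # mu) = (\<lambda>(is, S). is # S) ` (strict_words n k \<times> row_strict_tableaux n mu)"
  by (auto simp: row_strict_tableaux_def strict_words_def image_iff map_eq_Cons_conv subset_iff)

text \<open>Each block of equal symbols contributes the k! orderings of an increasing row. Different
  blocks do not interact, which is why the tableaux satisfy no condition on columns.\<close>

lemma nest_pos_word:
  "nest n (pos_word ps) z = env_scale (\<Prod>k\<leftarrow>map fst ps. fact k)
     (\<Sum>S\<in>row_strict_tableaux n (map fst ps). sand_word (zip (concat S) (pos_word ps)) z)"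
proof (induction ps)
  case Nil
  have "row_strict_tableaux n [] = {[]}" by (auto simp: row_strict_tableaux_def)
  then show ?case by (simp add: pos_word_def)
next
  case (Cons p ps)
  obtain k s where p: "p = (k, s)" by force
  have w: "pos_word (p # ps) = replicate k (Pos s) @ pos_word ps" by (simp add: pos_word_def p)
  note v = virtual_Pos
  let ?R = "row_strict_tableaux n (map fst ps)" and ?c = "\<Prod>k\<leftarrow>map fst ps. fact k :: complex"
  have "nest n (pos_word (p # ps)) z = env_scale (fact k) (\<Sum>is\<in>strict_words n k. foldr (sand (Pos s)) is
      (env_scale ?c (\<Sum>S\<in>?R. sand_word (zip (concat S) (pos_word ps)) z)))"
    unfolding w nest_append nest_replicate_odd[OF v parity.simps(1)] Cons ..
  also have "\<dots> = env_scale (fact k * ?c) (\<Sum>is\<in>strict_words n k. \<Sum>S\<in>?R.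
      sand_word (zip (concat (is # S)) (pos_word (p # ps))) z)"
  proof -
    have "foldr (sand (Pos s)) is (env_scale ?c (\<Sum>S\<in>?R. sand_word (zip (concat S) (pos_word ps)) z))
      = env_scale ?c (\<Sum>S\<in>?R. sand_word (zip (concat (is # S)) (pos_word (p # ps))) z)"
      if "is \<in> strict_words n k" for "is"
    proof -
      have f: "foldr (sand (Pos s)) is (env_scale ?c (\<Sum>S\<in>?R. f S)) = env_scale ?c (\<Sum>S\<in>?R. foldr (sand (Pos s)) is (f S))" for f
        by (induction "is") (simp_all add: sand_scale sand_sum)
      have "zip (concat (is # S)) (pos_word (p # ps)) = zip is (replicate (length is) (Pos s)) @ zip (concat S) (pos_word ps)" for S
        using that by (simp add: w strict_words_def)
      then show ?thesis unfolding f by (simp add: sand_word_append foldr_sand_eq_sand_word)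
    qed
    then show ?thesis by (simp flip: env.scale_sum_right)
  qed
  also have "(\<Sum>is\<in>strict_words n k. \<Sum>S\<in>?R. sand_word (zip (concat (is # S)) (pos_word (p # ps))) z)
     = (\<Sum>(is, S)\<in>strict_words n k \<times> ?R. sand_word (zip (concat (is # S)) (pos_word (p # ps))) z)"
    by (rule sum.cartesian_product)
  also have "\<dots> = (\<Sum>S\<in>row_strict_tableaux n (map fst (p # ps)). sand_word (zip (concat S) (pos_word (p # ps))) z)"
    by (simp add: p row_strict_Cons)
      (subst sum.reindex, auto simp: inj_on_def comp_def case_prod_unfold)
  finally show ?case by (simp add: p)
qed

lemma Cstar_pos_word: "concat (Cstar mu) = pos_word (map (\<lambda>r. (part mu r, r)) [1..<length mu + 1])"
  by (simp add: Cstar_def pos_word_def comp_def del: upt_Suc)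

lemma map_part: "map (part mu) [1..<length mu + 1] = mu"
  by (rule nth_equalityI) (auto simp: Defs.part_def simp del: upt_Suc)

lemma length_concat_Cstar: "length (concat (Cstar mu)) = sum_list mu"
proof -
  have "length (concat (Cstar mu)) = sum_list (map (part mu) [1..<length mu + 1])"
    by (simp add: Cstar_def length_concat comp_def del: upt_Suc)
  then show ?thesis by (simp only: map_part)
qed

lemma length_concat_Dstar: "length (concat (Dstar mu)) = sum_list mu"
proof -
  have "length (concat (Dstar mu)) = sum_list (map (part mu) [1..<length mu + 1])"
    by (simp add: Dstar_def length_concat comp_def del: upt_Suc)
  then show ?thesis by (simp only: map_part)
qed

text \<open>The two middle blocks of a bitableau do not involve \<open>S\<close> and form the core
  of the nested sum. The factor collects the sign of the reversal, the inverse hook product and the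
  row factorials.\<close>

lemma represents_schur_S:
  assumes mu: "mu = conjugate lam" and m0: "length mu \<le> m0" and m1: "\<forall>r. part mu r \<le> m1"
  defines "cs \<equiv> concat (Cstar mu)" and "ds \<equiv> concat (Dstar mu)"
  shows "represents m0 m1 n (schur_S m0 m1 n lam)
    (env_scale (rev_sgn (length cs) / (of_nat (hook_product mu) * (\<Prod>k\<leftarrow>mu. fact k)))
       (nest n cs (e_word (zip cs ds @ zip ds cs))))"
    and "set cs \<subseteq> virtual_symbols m0 m1"
    and "set (zip cs ds @ zip ds cs) \<subseteq> virtual_symbols m0 m1 \<times> virtual_symbols m0 m1"
proof -
  let ?z = "e_word (zip cs ds @ zip ds cs)"
  show cs: "set cs \<subseteq> virtual_symbols m0 m1"
    using m0 by (auto simp: cs_def Cstar_def virtual_symbols_def simp del: upt_Suc)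
  have ds: "set ds \<subseteq> virtual_symbols m0 m1"
  proof
    fix x assume "x \<in> set ds"
    then obtain r s where x: "x = Neg s" "1 \<le> s" "s \<le> part mu r"
      by (auto simp: ds_def Dstar_def less_Suc_eq_le simp del: upt_Suc)
    then have "s \<le> m1" using m1 order_trans by blast
    then show "x \<in> virtual_symbols m0 m1" using x by (simp add: virtual_symbols_def)
  qed
  have len: "length cs = length ds" "length cs = sum_list mu"
    by (simp_all add: cs_def ds_def length_concat_Cstar length_concat_Dstar)
  show w: "set (zip cs ds @ zip ds cs) \<subseteq> virtual_symbols m0 m1 \<times> virtual_symbols m0 m1"
    using cs ds set_zip_subset[of cs ds] set_zip_subset[of ds cs] by auto
  have bal: "balanced m0 m1 (zip cs ds @ zip ds cs)"
    using len by (simp add: balanced_def filter_fst_zip filter_snd_zip)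
  have tableau: "represents m0 m1 n (double_bitableau m0 m1 n mu S S)
      (env_scale (rev_sgn (length cs)) (sand_word (zip (concat S) cs) ?z))"
    if S: "S \<in> row_strict_tableaux n mu" for S
  proof -
    let ?ss = "map Prop (concat S)"
    have lS: "length (concat S) = length cs"
      using S len by (simp add: row_strict_tableaux_def length_concat)
    have sS: "set (concat S) \<subseteq> {1..n}" using S by (auto simp: row_strict_tableaux_def)
    then have pS: "set ?ss \<subseteq> proper_symbols n" by (auto simp: proper_symbols_def)
    have arg: "e_tab (map (map Prop) S) (Cstar mu) * e_tab (Cstar mu) (Dstar mu)
        * e_tab (Dstar mu) (Cstar mu) * e_tab (Cstar mu) (map (map Prop) S)
      = e_word (zip ?ss cs @ (zip cs ds @ zip ds cs) @ zip cs ?ss)"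
      by (simp add: e_tab_def cs_def ds_def e_word_append mult.assoc map_concat)
    have "set (zip ?ss cs) \<subseteq> proper_symbols n \<times> virtual_symbols m0 m1"
      using set_zip_subset[of ?ss cs] Sigma_mono[OF pS cs] by (rule order_trans)
    moreover have "set (zip cs ?ss) \<subseteq> virtual_symbols m0 m1 \<times> proper_symbols n"
      using set_zip_subset[of cs ?ss] Sigma_mono[OF cs pS] by (rule order_trans)
    ultimately have "set (zip ?ss cs @ (zip cs ds @ zip ds cs) @ zip cs ?ss)
      \<subseteq> (virtual_symbols m0 m1 \<union> proper_symbols n) \<times> (virtual_symbols m0 m1 \<union> proper_symbols n)"
      using w by auto
    then have "represents m0 m1 n (double_bitableau m0 m1 n mu S S)
        (e_word (zip ?ss cs @ (zip cs ds @ zip ds cs) @ zip cs ?ss))"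
      unfolding double_bitableau_def arg using balanced_sandwich[OF lS bal] by (rule represents_devirt)
    moreover have "set (rev (zip cs ?ss)) \<subseteq> range Pos \<times> range Prop"
    proof -
      have "set cs \<subseteq> range Pos" by (auto simp: cs_def Cstar_def)
      moreover have "set ?ss \<subseteq> range Prop" by auto
      ultimately show ?thesis unfolding set_rev using set_zip_subset[of cs ?ss] by (meson Sigma_mono order_trans)
    qed
    then have "e_word (zip cs ?ss) = env_scale (rev_sgn (length cs)) (e_word (rev (zip cs ?ss)))"
      using e_word_rev[of "rev (zip cs ?ss)"] lS by simp
    then have "e_word (zip ?ss cs @ (zip cs ds @ zip ds cs) @ zip cs ?ss)
        = env_scale (rev_sgn (length cs)) (sand_word (zip (concat S) cs) ?z)"
      unfolding sand_word_zip[OF lS] by (simp add: e_word_append)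
    ultimately show ?thesis by simp
  qed
  let ?p = "\<Prod>k\<leftarrow>mu. fact k :: complex"
  have p: "?p \<noteq> 0" by (induction mu) auto
  have "map fst (map (\<lambda>r. (part mu r, r)) [1..<length mu + 1]) = mu"
    using map_part[of mu] by (simp add: comp_def del: upt_Suc)
  then have "nest n cs ?z = env_scale ?p (\<Sum>S\<in>row_strict_tableaux n mu. sand_word (zip (concat S) cs) ?z)"
    unfolding cs_def Cstar_pos_word nest_pos_word by simp
  then have "env_scale (rev_sgn (length cs) / (of_nat (hook_product mu) * ?p)) (nest n cs ?z)
    = env_scale (1 / of_nat (hook_product mu)) (\<Sum>S\<in>row_strict_tableaux n mu.
        env_scale (rev_sgn (length cs)) (sand_word (zip (concat S) cs) ?z))"
    using p by (simp only: env.scale_sum_right[symmetric] env.scale_scale) (simp add: field_simps)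
  then show "represents m0 m1 n (schur_S m0 m1 n lam)
    (env_scale (rev_sgn (length cs) / (of_nat (hook_product mu) * ?p)) (nest n cs ?z))"
    unfolding schur_S_def mu[symmetric] by (simp only:) (intro represents_scale represents_sum tableau)
qed

lemma length_conjugate: "length (conjugate lam) = part lam 1"
  by (simp add: conjugate_def)

text \<open>With this, a bound on the first row alone provides enough negative symbols for every row
  of \<open>Dstar\<close>.\<close>

lemma part_conjugate_mono: "part (conjugate lam) r \<le> part (conjugate lam) 1"
proof (cases "r \<in> {1..length (conjugate lam)}")
  case True
  have p: "part (conjugate lam) j = card {i \<in> {1..length lam}. j \<le> part lam i}"
    if "j \<in> {1..length (conjugate lam)}" for j
  proof -
    have "part (conjugate lam) j = conjugate lam ! (j - 1)"
      using that unfolding Defs.part_def[of "conjugate lam" j] by (rule if_P)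
    moreover have "j - 1 < length [1..<part lam 1 + 1]" "[1..<part lam 1 + 1] ! (j - 1) = j"
      using that by (auto simp: length_conjugate simp del: upt_Suc)
    ultimately show ?thesis by (simp add: conjugate_def del: upt_Suc)
  qed
  have "1 \<in> {1..length (conjugate lam)}" using True by simp
  then show ?thesis unfolding p[OF True] p[OF \<open>1 \<in> _\<close>]
    using True by (auto intro!: card_mono)
next
  case False
  then have "part (conjugate lam) r = 0"
    unfolding Defs.part_def[of "conjugate lam" r] by (rule if_not_P)
  then show ?thesis by simp
qed

lemma nazarov_I_family:
  assumes "1 \<le> m1"
  shows "nazarov_I m0 m1 n k \<in> zeta n"
    "nazarov_I m0 m1 (n + 1) k - nazarov_I m0 m1 n k \<in> ideal_I_0 (n + 1)"
  using nest_family[of m0 m1 "\<lambda>n. nazarov_I m0 m1 n k", OF represents_nazarov_I[OF assms]]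
  by (auto simp: virtual_def)

lemma capelli_H_family:
  assumes "1 \<le> m0"
  shows "capelli_H m0 m1 n k \<in> zeta n"
    "capelli_H m0 m1 (n + 1) k - capelli_H m0 m1 n k \<in> ideal_I_0 (n + 1)"
  using nest_family[of m0 m1 "\<lambda>n. capelli_H m0 m1 n k", OF represents_capelli_H[OF assms]]
  by (auto simp: virtual_def)

lemma schur_S_family:
  assumes "part lam 1 \<le> m0" "part (conjugate lam) 1 \<le> m1"
  shows "schur_S m0 m1 n lam \<in> zeta n"
    "schur_S m0 m1 (n + 1) lam - schur_S m0 m1 n lam \<in> ideal_I_0 (n + 1)"
proof -
  have m0: "length (conjugate lam) \<le> m0" using assms(1) by (simp add: length_conjugate)
  have m1: "\<forall>r. part (conjugate lam) r \<le> m1" using assms(2) part_conjugate_mono order_trans by blast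
  note r = represents_schur_S[OF refl m0 m1]
  note f = nest_family[of m0 m1 "\<lambda>n. schur_S m0 m1 n lam", OF r(1)]
  have cs: "\<forall>c\<in>set (concat (Cstar (conjugate lam))). virtual c"
    using r(2) virtual_in by blast
  have z: "e (Prop i) (Prop j) * e_word w = e_word w * e (Prop i) (Prop j)"
    if "set w \<subseteq> virtual_symbols m0 m1 \<times> virtual_symbols m0 m1" for w i j
    by (rule virtual_word_commutes) (use that virtual_in in blast)
  show "schur_S m0 m1 n lam \<in> zeta n" "schur_S m0 m1 (n + 1) lam - schur_S m0 m1 n lam \<in> ideal_I_0 (n + 1)"
    using f[OF cs z[OF r(3)]] by auto
qed

lemma veps_even [simp]: "\<not> odd_var u \<Longrightarrow> veps u v = 1" "\<not> odd_var v \<Longrightarrow> veps u v = 1"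
  by (simp_all add: veps_def)

lemma not_odd_cols [simp]: "a \<in> cols n \<Longrightarrow> b \<in> cols n \<Longrightarrow> \<not> odd_var (a, b)"
  using not_odd_var_cols[of "(a, b)" n] by simp

lemma ssgn_cols [simp]: "a \<in> cols n \<Longrightarrow> b \<in> cols n \<Longrightarrow> ssgn a b c d = 1"
  by (auto simp: cols_def)

section \<open>Central elements are invariant polynomials\<close>

text \<open>The right polarization, the counterpart of \<open>pol\<close> for columns: it replaces
  column i by column j.\<close>

definition rpol :: "nat \<Rightarrow> symbol \<Rightarrow> symbol \<Rightarrow> vec \<Rightarrow> vec" where
  "rpol n i j f = (\<lambda>m. \<Sum>a\<in>cols n. cr (a, j) (an (a, i) f) m)"

lemma lin_rpol: "lin (rpol n i j)"
  unfolding rpol_def by (intro lin_setsum lin_comp[OF lin_cr] lin_an)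

lemma an_rpol:
  assumes "i \<in> cols n" "j \<in> cols n" "p \<in> cols n" "q \<in> cols n"
  shows "an (p, q) (rpol n i j f) = (\<lambda>m. (if q = j then an (p, i) f m else 0) + rpol n i j (an (p, q) f) m)"
proof
  fix m
  have *: "an (p, q) (cr (a, j) (an (a, i) f)) m =
      (if a = p then if q = j then an (p, i) f m else 0 else 0) + cr (a, j) (an (a, i) (an (p, q) f)) m"
    if "a \<in> cols n" for a
    unfolding an_cr an_an[of "(p, q)"] using that assms by auto
  show "an (p, q) (rpol n i j f) m = (if q = j then an (p, i) f m else 0) + rpol n i j (an (p, q) f) m"
    unfolding rpol_def lin_sum[OF lin_an] using assms by (simp add: * sum.distrib)
qed

lemma rpol_cr:
  assumes "i \<in> cols n" "j \<in> cols n" "k \<in> cols n" "l \<in> cols n"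
  shows "rpol n i j (cr (k, l) f) = (\<lambda>m. (if i = l then cr (k, j) f m else 0) + cr (k, l) (rpol n i j f) m)"
proof
  fix m
  have *: "cr (a, j) (an (a, i) (cr (k, l) f)) m =
      (if a = k then if i = l then cr (k, j) f m else 0 else 0) + cr (k, l) (cr (a, j) (an (a, i) f)) m"
    if "a \<in> cols n" for a
  proof -
    have "cr (a, j) (an (a, i) (cr (k, l) f)) m =
      cr (a, j) (\<lambda>m. if (a, i) = (k, l) then f m else 0) m + cr (a, j) (cr (k, l) (an (a, i) f)) m"
      unfolding an_cr using that assms by (simp add: lin_add[OF lin_cr])
    also have "cr (a, j) (\<lambda>m. if (a, i) = (k, l) then f m else 0) m = (if a = k then if i = l then cr (k, j) f m else 0 else 0)"
      using lin_zero[OF lin_cr, of "(a, j)"] by auto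
    also have "cr (a, j) (cr (k, l) (an (a, i) f)) m = cr (k, l) (cr (a, j) (an (a, i) f)) m"
      using fun_cong[OF cr_cr[of "(a, j)" "(k, l)"]] that assms by simp
    finally show ?thesis .
  qed
  show "rpol n i j (cr (k, l) f) m = (if i = l then cr (k, j) f m else 0) + cr (k, l) (rpol n i j f) m"
    unfolding rpol_def lin_sum[OF lin_cr] using assms by (simp add: * sum.distrib)
qed

text \<open>The infinitesimal form of the fact that left and right matrix multiplication commute:
  the two corrections, at a = l and a = k, are equal and cancel in the sum over a.\<close>

lemma pol_rpol:
  assumes "i \<in> cols n" "j \<in> cols n" "k \<in> cols n" "l \<in> cols n"
  shows "pol n k l (rpol n i j f) m = rpol n i j (pol n k l f) m"
proof -
  have *: "pol n k l (cr (a, j) (an (a, i) f)) m = (if a = l then cr (k, j) (an (l, i) f) m else 0)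
      + cr (a, j) (an (a, i) (pol n k l f)) m - (if a = k then cr (k, j) (an (l, i) f) m else 0)"
    if a: "a \<in> cols n" for a
  proof -
    have "pol n k l (an (a, i) f) = (\<lambda>m. an (a, i) (pol n k l f) m - (if a = k then an (l, i) f m else 0))"
      using assms a by (simp add: an_pol[OF assms(1)] fun_eq_iff)
    then have "cr (a, j) (pol n k l (an (a, i) f)) m = cr (a, j) (an (a, i) (pol n k l f)) m
        - cr (a, j) (\<lambda>m. if a = k then an (l, i) f m else 0) m"
      by (simp only: lin_diff[OF lin_cr])
    also have "cr (a, j) (\<lambda>m. if a = k then an (l, i) f m else 0) m = (if a = k then cr (k, j) (an (l, i) f) m else 0)"
      using lin_zero[OF lin_cr, of "(a, j)"] by auto
    finally show ?thesis
      unfolding pol_cr[OF assms(2)] using assms by auto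
  qed
  have "pol n k l (rpol n i j f) m = (\<Sum>a\<in>cols n. pol n k l (cr (a, j) (an (a, i) f)) m)"
    by (simp only: rpol_def lin_sum[OF lin_pol])
  also have "\<dots> = rpol n i j (pol n k l f) m"
    using assms by (simp add: * sum.distrib sum_subtractf rpol_def)
  finally show ?thesis .
qed

text \<open>Under \<open>x \<mapsto> act n x vac\<close>, right multiplication by \<open>e i j\<close> becomes this operator.\<close>

definition right_op :: "nat \<Rightarrow> symbol \<Rightarrow> symbol \<Rightarrow> vec \<Rightarrow> vec" where
  "right_op n i j f = (\<lambda>m. cr (i, j) f m + rpol n i j f m)"

text \<open>Both operators come from commuting polarizations by the same formal conjugation with the
  exponential of the sum of the Y(j,j).\<close>

lemma E_right_op:
  assumes "i \<in> cols n" "j \<in> cols n" "k \<in> cols n" "l \<in> cols n"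
  shows "E n k l (right_op n i j f) = right_op n i j (E n k l f)"
proof
  fix m
  have "cr (k, l) (cr (i, j) f) m = cr (i, j) (cr (k, l) f) m"
    using fun_cong[OF cr_cr[of "(k, l)" "(i, j)"]] assms by simp
  moreover have "pol n k l (cr (i, j) f) m = (if i = l then cr (k, j) f m else 0) + cr (i, j) (pol n k l f) m"
    using assms by (simp add: pol_cr[OF assms(2)])
  ultimately show "E n k l (right_op n i j f) m = right_op n i j (E n k l f) m"
    using assms(4)
    by (simp add: E_def right_op_def lin_add[OF lin_cr] lin_add[OF lin_pol] lin_add[OF lin_rpol]
      rpol_cr[OF assms] pol_rpol[OF assms])
qed

lemma right_op_vac: "right_op n i j vac = cr (i, j) vac"
  by (simp add: right_op_def rpol_def lin_zero[OF lin_cr])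

lemma act_right_op:
  assumes "x \<in> U_gl n" "i \<in> cols n" "j \<in> cols n"
  shows "act n x (right_op n i j f) = right_op n i j (act n x f)"
proof -
  have lin: "lin (right_op n i j)"
    unfolding right_op_def by (intro lin_plus lin_cr lin_rpol)
  have word: "act_word n w (right_op n i j f) = right_op n i j (act_word n w f)"
    if "set w \<subseteq> cols n \<times> cols n" for w
    using that
  proof (induction w)
    case (Cons l w)
    then show ?case using assms by (cases l) (simp add: act_word_Cons E_right_op)
  qed simp
  show ?thesis using assms(1) unfolding U_gl_def' U_on_span
  proof (induction rule: env.span_induct_alt)
    case base
    then show ?case by (simp add: lin_zero[OF lin])
  next
    case (step c x y)
    then have "act n x (right_op n i j f) = right_op n i j (act n x f)"
      using word by (auto simp: act_e_word)
    then show ?case using step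
      by (simp add: act_add act_scale lin_add[OF lin] lin_scale[OF lin])
  qed
qed

text \<open>Infinitesimal conjugation of the matrix Y by a matrix unit.\<close>

definition ad :: "nat \<Rightarrow> symbol \<Rightarrow> symbol \<Rightarrow> vec \<Rightarrow> vec" where
  "ad n i j f = (\<lambda>m. pol n i j f m - rpol n i j f m)"

lemma lin_ad: "lin (ad n i j)"
  unfolding ad_def by (intro lin_minus lin_pol lin_rpol)

definition invariant :: "nat \<Rightarrow> vec \<Rightarrow> bool" where
  "invariant n f \<longleftrightarrow> (\<forall>i\<in>cols n. \<forall>j\<in>cols n. ad n i j f = (\<lambda>m. 0))"

text \<open>Left and right multiplication by e i j agree on a central element, and the creation
  terms Y(i,j) on the two sides cancel.\<close>

lemma zeta_invariant:
  assumes "z \<in> zeta n"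
  shows "invariant n (act n z vac)"
  unfolding invariant_def
proof (intro ballI)
  fix i j assume ij: "i \<in> cols n" "j \<in> cols n"
  then have "e i j \<in> U_gl n" unfolding U_gl_def' by (intro e_in_U_on)
  then have "act n (e i j * z) vac = act n (z * e i j) vac" "z \<in> U_gl n"
    using assms by (auto simp: zeta_def)
  then have "E n i j (act n z vac) = right_op n i j (act n z vac)"
    using ij act_right_op[of z n i j vac] by (simp add: act_mult act_e E_vac right_op_vac)
  then show "ad n i j (act n z vac) = (\<lambda>m. 0)"
    using ij by (simp add: E_def right_op_def ad_def fun_eq_iff)
qed

lemma ad_an:
  assumes "i \<in> cols n" "j \<in> cols n" "p \<in> cols n" "q \<in> cols n"
  shows "ad n i j (an (p, q) f) = (\<lambda>m. an (p, q) (ad n i j f) m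
    - (if p = i then an (j, q) f m else 0) + (if q = j then an (p, i) f m else 0))"
  using assms an_pol[OF assms(4), of p i j f]
  by (auto simp: ad_def lin_diff[OF lin_an] an_rpol fun_eq_iff)

section \<open>Values and partial derivatives of polynomials\<close>

definition fin_supp :: "vec \<Rightarrow> bool" where
  "fin_supp f \<longleftrightarrow> finite {m. f m \<noteq> 0}"

lemma fin_supp_supported: "finite V \<Longrightarrow> supported f V d \<Longrightarrow> fin_supp f"
  unfolding fin_supp_def by (rule finite_subset[OF _ finite_multisets[of V d]]) (auto simp: supported_def)

lemma fin_supp_zero [simp]: "fin_supp (\<lambda>m. 0)"
  by (simp add: fin_supp_def)

lemma fin_supp_vac [simp]: "fin_supp vac"
  unfolding fin_supp_def by (rule finite_subset[of _ "{{#}}"]) (auto simp: vac_def)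

lemma fin_supp_lincomb: "fin_supp f \<Longrightarrow> fin_supp g \<Longrightarrow> fin_supp (\<lambda>m. f m + c * g m)"
  unfolding fin_supp_def by (rule finite_subset[of _ "{m. f m \<noteq> 0} \<union> {m. g m \<noteq> 0}"]) auto

lemma fin_supp_add: "fin_supp f \<Longrightarrow> fin_supp g \<Longrightarrow> fin_supp (\<lambda>m. f m + g m)"
  using fin_supp_lincomb[of f g 1] by simp

lemma fin_supp_sum: "(\<And>i. i \<in> I \<Longrightarrow> fin_supp (f i)) \<Longrightarrow> fin_supp (\<lambda>m. \<Sum>i\<in>I. f i m)"
  by (induction I rule: infinite_finite_induct) (auto intro: fin_supp_add)

lemma cr_support: "{m. cr v f m \<noteq> 0} \<subseteq> add_mset v ` {m. f m \<noteq> 0}"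
proof
  fix m assume "m \<in> {m. cr v f m \<noteq> 0}"
  then have "v \<in># m" "f (m - {#v#}) \<noteq> 0" using cr_nonzero by auto
  then show "m \<in> add_mset v ` {m. f m \<noteq> 0}"
    by (intro image_eqI[of _ _ "m - {#v#}"]) auto
qed

lemma fin_supp_cr: "fin_supp f \<Longrightarrow> fin_supp (cr v f)"
  unfolding fin_supp_def by (rule finite_subset[OF cr_support]) simp

lemma fin_supp_an: "fin_supp f \<Longrightarrow> fin_supp (an v f)"
  unfolding fin_supp_def
proof (rule finite_subset[of _ "(\<lambda>m. m - {#v#}) ` {m. f m \<noteq> 0}"], rule subsetI)
  fix m assume "m \<in> {m. an v f m \<noteq> 0}"
  then have "f (add_mset v m) \<noteq> 0" by (auto simp: an_def)
  then show "m \<in> (\<lambda>m. m - {#v#}) ` {m. f m \<noteq> 0}"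
    by (intro image_eqI[of _ _ "add_mset v m"]) auto
qed simp

lemma fin_supp_pol: "fin_supp f \<Longrightarrow> fin_supp (pol n a b f)"
  unfolding pol_def by (intro fin_supp_sum fin_supp_cr fin_supp_an)

lemma fin_supp_rpol: "fin_supp f \<Longrightarrow> fin_supp (rpol n a b f)"
  unfolding rpol_def by (intro fin_supp_sum fin_supp_cr fin_supp_an)

text \<open>The value of a polynomial at the point \<open>Y\<close>. A sum over an infinite support
  is 0 by convention, so linearity needs \<open>fin_supp\<close>.\<close>

definition ev :: "(var \<Rightarrow> complex) \<Rightarrow> vec \<Rightarrow> complex" where
  "ev Y f = (\<Sum>m | f m \<noteq> 0. f m * (\<Prod>v\<in>#m. Y v))"

lemma ev_superset: "finite S \<Longrightarrow> {m. f m \<noteq> 0} \<subseteq> S \<Longrightarrow> ev Y f = (\<Sum>m\<in>S. f m * (\<Prod>v\<in>#m. Y v))"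
  unfolding ev_def by (rule sum.mono_neutral_left) auto

lemma ev_zero [simp]: "ev Y (\<lambda>m. 0) = 0"
  by (simp add: ev_def)

lemma ev_vac [simp]: "ev Y vac = 1"
  by (subst ev_superset[of "{{#}}"]) (auto simp: vac_def)

lemma ev_lincomb:
  assumes "fin_supp f" "fin_supp g"
  shows "ev Y (\<lambda>m. f m + c * g m) = ev Y f + c * ev Y g"
proof -
  let ?S = "{m. f m \<noteq> 0} \<union> {m. g m \<noteq> 0}"
  have S: "finite ?S" using assms by (simp add: fin_supp_def)
  have "ev Y (\<lambda>m. f m + c * g m) = (\<Sum>m\<in>?S. (f m + c * g m) * (\<Prod>v\<in>#m. Y v))"
    "ev Y f = (\<Sum>m\<in>?S. f m * (\<Prod>v\<in>#m. Y v))" "ev Y g = (\<Sum>m\<in>?S. g m * (\<Prod>v\<in>#m. Y v))"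
    by (rule ev_superset[OF S], force)+
  then show ?thesis by (simp add: algebra_simps sum.distrib sum_distrib_left)
qed

lemma ev_add: "fin_supp f \<Longrightarrow> fin_supp g \<Longrightarrow> ev Y (\<lambda>m. f m + g m) = ev Y f + ev Y g"
  using ev_lincomb[of f g Y 1] by simp

lemma ev_diff: "fin_supp f \<Longrightarrow> fin_supp g \<Longrightarrow> ev Y (\<lambda>m. f m - g m) = ev Y f - ev Y g"
  using ev_lincomb[of f g Y "-1"] by simp

lemma ev_scale: "fin_supp f \<Longrightarrow> ev Y (\<lambda>m. c * f m) = c * ev Y f"
  using ev_lincomb[of "\<lambda>m. 0" f Y c] by simp

lemma ev_sum: "(\<And>i. i \<in> I \<Longrightarrow> fin_supp (f i)) \<Longrightarrow> ev Y (\<lambda>m. \<Sum>i\<in>I. f i m) = (\<Sum>i\<in>I. ev Y (f i))"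
  by (induction I rule: infinite_finite_induct) (simp_all add: ev_add fin_supp_sum)

lemma ev_cr:
  assumes "\<not> odd_var v" "fin_supp f"
  shows "ev Y (cr v f) = Y v * ev Y f"
proof -
  have "ev Y (cr v f) = (\<Sum>m\<in>add_mset v ` {m. f m \<noteq> 0}. cr v f m * (\<Prod>v\<in>#m. Y v))"
    by (rule ev_superset[OF _ cr_support]) (use assms in \<open>simp add: fin_supp_def\<close>)
  also have "\<dots> = (\<Sum>m | f m \<noteq> 0. Y v * (f m * (\<Prod>v\<in>#m. Y v)))"
    by (subst sum.reindex) (auto simp: inj_on_def cr_add_mset assms(1) intro!: sum.cong)
  finally show ?thesis by (simp add: ev_def sum_distrib_left)
qed

lemma ev_an_derivative:
  assumes v: "\<not> odd_var v" and f: "fin_supp f"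
  shows "((\<lambda>t. ev (Y(v := t)) f) has_field_derivative ev (Y(v := t)) (an v f)) (at t)"
proof -
  let ?mon = "\<lambda>t m. \<Prod>u\<in>#m. (Y(v := t)) u"
  have mon: "((\<lambda>t. ?mon t m) has_field_derivative of_nat (count m v) * ?mon t (m - {#v#})) (at t)" for m
  proof (induction m)
    case (add x m)
    show ?case
    proof (cases "x = v")
      case True
      have "v \<in># m \<Longrightarrow> t * ?mon t (m - {#v#}) = ?mon t m"
        by (metis (no_types, lifting) fun_upd_same image_mset_add_mset insert_DiffM prod_mset.add_mset)
      then have "?mon t m + of_nat (count m v) * ?mon t (m - {#v#}) * t = of_nat (count (add_mset x m) v) * ?mon t (add_mset x m - {#v#})"
        using True by (cases "v \<in># m") (simp_all add: algebra_simps not_in_iff)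
      moreover have "((\<lambda>t. t * ?mon t m) has_field_derivative (1 * ?mon t m + of_nat (count m v) * ?mon t (m - {#v#}) * t)) (at t)"
        by (rule DERIV_mult[OF DERIV_ident add])
      ultimately show ?thesis using True by simp
    next
      case False
      have "((\<lambda>t. Y x * ?mon t m) has_field_derivative (Y x * (of_nat (count m v) * ?mon t (m - {#v#})))) (at t)"
        by (rule DERIV_cmult[OF add])
      moreover have "of_nat (count (add_mset x m) v) * ?mon t (add_mset x m - {#v#}) = Y x * (of_nat (count m v) * ?mon t (m - {#v#}))"
      proof (cases "v \<in># m")
        case True
        then show ?thesis using False by (simp add: algebra_simps)
      qed (simp add: False not_in_iff)
      ultimately show ?thesis using False by (simp add: mult.left_commute)
    qed
  qed simp
  have "((\<lambda>t. \<Sum>m | f m \<noteq> 0. f m * ?mon t m) has_field_derivative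
      (\<Sum>m | f m \<noteq> 0. f m * (of_nat (count m v) * ?mon t (m - {#v#})))) (at t)"
    by (intro DERIV_sum DERIV_cmult mon)
  moreover have "ev (Y(v := t)) (an v f) = (\<Sum>m | f m \<noteq> 0. f m * (of_nat (count m v) * ?mon t (m - {#v#})))"
  proof -
    have "(\<Sum>m | f m \<noteq> 0. f m * (of_nat (count m v) * ?mon t (m - {#v#})))
      = (\<Sum>m | f m \<noteq> 0 \<and> v \<in># m. f m * (of_nat (count m v) * ?mon t (m - {#v#})))"
      using f by (intro sum.mono_neutral_right) (auto simp: fin_supp_def not_in_iff)
    also have "\<dots> = (\<Sum>m | an v f m \<noteq> 0. an v f m * ?mon t m)"
      by (rule sum.reindex_bij_witness[of _ "add_mset v" "\<lambda>m. m - {#v#}"])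
        (auto simp: an_def ancoef_def v simp flip: of_nat_Suc)
    finally show ?thesis by (simp add: ev_def)
  qed
  ultimately show ?thesis unfolding ev_def by (simp only:)
qed

text \<open>
  The slice of companion matrices: ones below the diagonal, an arbitrary last column \<open>c\<close>.
  Conjugating by an infinitesimal matrix unit moves in all directions transversal to it, so
  an invariant polynomial is determined by its values on the slice.
\<close>

fun slice :: "nat \<Rightarrow> (nat \<Rightarrow> complex) \<Rightarrow> var \<Rightarrow> complex" where
  "slice n c (Prop a, Prop b) = (if b = n then c a else if a = b + 1 then 1 else 0)"
| "slice n c v = 0"

text \<open>Linear combinations of k-th partial derivatives of \<open>F\<close>. Combinations are
  included so that each order is stable under \<open>ad\<close>.\<close>

inductive derived :: "nat \<Rightarrow> vec \<Rightarrow> nat \<Rightarrow> vec \<Rightarrow> bool" for n F where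
  self: "derived n F 0 F"
| zero: "derived n F k (\<lambda>m. 0)"
| lincomb: "derived n F k g \<Longrightarrow> derived n F k h \<Longrightarrow> derived n F k (\<lambda>m. g m + c * h m)"
| deriv: "derived n F k h \<Longrightarrow> p \<in> cols n \<Longrightarrow> q \<in> cols n \<Longrightarrow> derived n F (Suc k) (an (p, q) h)"

lemma derived_fin: "derived n F k h \<Longrightarrow> fin_supp F \<Longrightarrow> fin_supp h"
  by (induction rule: derived.induct) (auto intro: fin_supp_lincomb fin_supp_an)

text \<open>The commutator of \<open>ad\<close> with a partial derivative is a combination of
  partial derivatives of the same order, and \<open>F\<close> itself is killed.\<close>

lemma derived_ad:
  assumes "invariant n F" "i \<in> cols n" "j \<in> cols n"
  shows "derived n F k h \<Longrightarrow> derived n F k (ad n i j h)"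
proof (induction rule: derived.induct)
  case self
  then show ?case using assms by (auto simp: invariant_def intro: derived.zero)
next
  case (zero k)
  then show ?case by (simp add: lin_zero[OF lin_ad] derived.zero)
next
  case (lincomb k g h c)
  then show ?case
    using lin_ad[of n i j] by (simp add: lin_def derived.lincomb)
next
  case (deriv k h p q)
  have 1: "derived n F (Suc k) (\<lambda>m. if p = i then an (j, q) h m else 0)"
    "derived n F (Suc k) (\<lambda>m. if q = j then an (p, i) h m else 0)"
    using derived.zero derived.deriv[OF deriv.hyps(1) assms(3) deriv.hyps(3)]
      derived.deriv[OF deriv.hyps(1) deriv.hyps(2) assms(2)] by (cases "p = i"; cases "q = j"; simp)+
  have "derived n F (Suc k) (\<lambda>m. (an (p, q) (ad n i j h) m + (- 1) * (if p = i then an (j, q) h m else 0))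
     + 1 * (if q = j then an (p, i) h m else 0))"
    using deriv by (intro derived.lincomb derived.deriv 1) auto
  then show ?case unfolding ad_an[OF assms(2,3) deriv(2,3)] by simp
qed

lemma ev_pol: "fin_supp f \<Longrightarrow> i \<in> cols n \<Longrightarrow> ev Y (pol n i j f) = (\<Sum>b\<in>cols n. Y (i, b) * ev Y (an (j, b) f))"
  unfolding pol_def by (subst ev_sum) (auto simp: fin_supp_cr fin_supp_an ev_cr intro!: sum.cong)

lemma ev_rpol: "fin_supp f \<Longrightarrow> j \<in> cols n \<Longrightarrow> ev Y (rpol n i j f) = (\<Sum>a\<in>cols n. Y (a, j) * ev Y (an (a, i) f))"
  unfolding rpol_def by (subst ev_sum) (auto simp: fin_supp_cr fin_supp_an ev_cr intro!: sum.cong)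

lemma slice_update: "b = n \<Longrightarrow> (slice n c)((Prop a, Prop b) := t) = slice n (c(a := t))"
proof
  fix v assume "b = n"
  then show "((slice n c)((Prop a, Prop b) := t)) v = slice n (c(a := t)) v"
    by (cases v; cases "fst v"; cases "snd v") auto
qed

text \<open>Row i of a companion matrix consists of a 1 left of the diagonal, absent for i = 1, and
  the free entry in the last column.\<close>

lemma sum_slice_row:
  assumes "i \<in> {1..n}"
  shows "(\<Sum>b\<in>cols n. slice n c (Prop i, b) * g b) =
    (if 2 \<le> i then g (Prop (i - 1)) else 0) + c i * g (Prop n)"
proof -
  have "(\<Sum>b\<in>cols n. slice n c (Prop i, b) * g b) = (\<Sum>b\<in>{1..n}. slice n c (Prop i, Prop b) * g (Prop b))"
    unfolding cols_def by (subst sum.reindex) (auto simp: inj_on_def)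
  also have "\<dots> = (\<Sum>b\<in>{1..n}. (if b = i - 1 then if 2 \<le> i then g (Prop (i - 1)) else 0 else 0) + (if b = n then c i * g (Prop n) else 0))"
    using assms by (intro sum.cong) auto
  also have "\<dots> = (if 2 \<le> i then g (Prop (i - 1)) else 0) + c i * g (Prop n)"
    using assms by (auto simp: sum.distrib)
  finally show ?thesis .
qed

text \<open>Vanishing passes from order k to order k + 1. Derivatives in the last column are tangent
  to the slice. For the other columns use that \<open>ad n i j h\<close> has order k and vanishes on
  the slice: once the derivatives in columns i and n are known to be 0, all that is left of it is
  the derivative at (j, i - 1). So the columns are settled from n downwards.\<close>

lemma derived_vanishes:
  assumes inv: "invariant n F" and F: "fin_supp F" and van: "\<And>c. ev (slice n c) F = 0"
  shows "derived n F k h \<Longrightarrow> ev (slice n c) h = 0"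
proof (induction k arbitrary: h c rule: less_induct)
  case (less k)
  from less.prems less.IH show ?case
  proof (induction arbitrary: c rule: derived.induct)
    case self
    then show ?case using van by simp
  next
    case (zero k)
    then show ?case by simp
  next
    case (lincomb k g h c')
    then show ?case using derived_fin[OF _ F] by (simp add: ev_lincomb)
  next
    case (deriv k h p q)
    have h: "ev (slice n c) h = 0" "i \<in> cols n \<Longrightarrow> j \<in> cols n \<Longrightarrow> ev (slice n c) (ad n i j h) = 0" for c i j
      using deriv.prems[OF lessI] deriv.hyps(1) derived_ad[OF inv _ _ deriv.hyps(1)] by auto
    have fin: "fin_supp h" by (rule derived_fin[OF deriv.hyps(1) F])
    have last: "ev (slice n c) (an (p, Prop n) h) = 0" if p: "p \<in> cols n" for p
    proof -
      obtain a where a: "p = Prop a" "a \<in> {1..n}" using p by (auto simp: cols_def)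
      have "Prop n \<in> cols n" using a by (auto simp: cols_def)
      then have "\<not> odd_var (p, Prop n)" using p by simp
      then have "((\<lambda>t. ev ((slice n c)((p, Prop n) := t)) h) has_field_derivative
          ev ((slice n c)((p, Prop n) := c a)) (an (p, Prop n) h)) (at (c a))"
        using fin by (rule ev_an_derivative)
      then have "((\<lambda>t. 0) has_field_derivative ev (slice n c) (an (p, Prop n) h)) (at (c a))"
        by (simp add: a(1) slice_update h(1))
      then show ?thesis using DERIV_unique DERIV_const by blast
    qed
    have col: "\<forall>p\<in>cols n. ev (slice n c) (an (p, Prop (n - d)) h) = 0" if "d < n" for d
      using that
    proof (induction d)
      case 0
      then show ?case using last by simp
    next
      case (Suc d)
      let ?i = "n - d"
      have i: "?i \<in> {1..n}" "2 \<le> ?i" "?i - 1 = n - Suc d" and ic: "Prop ?i \<in> cols n"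
        using Suc.prems by (auto simp: cols_def)
      show ?case
      proof
        fix j assume j: "j \<in> cols n"
        have "0 = ev (slice n c) (ad n (Prop ?i) j h)" using h(2)[OF ic j] by simp
        also have "\<dots> = ev (slice n c) (pol n (Prop ?i) j h) - ev (slice n c) (rpol n (Prop ?i) j h)"
          unfolding ad_def by (rule ev_diff) (simp_all add: fin fin_supp_pol fin_supp_rpol)
        \<comment> \<open>Only derivatives in column \<open>n - d\<close> occur here, and these
          vanish by the induction hypothesis.\<close>
        also have "ev (slice n c) (rpol n (Prop ?i) j h) = 0"
          unfolding ev_rpol[OF fin j] using Suc by simp
        also have "ev (slice n c) (pol n (Prop ?i) j h) = ev (slice n c) (an (j, Prop (n - Suc d)) h)"
          unfolding ev_pol[OF fin ic] sum_slice_row[OF i(1)] using last[OF j] i by simp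
        finally show "ev (slice n c) (an (j, Prop (n - Suc d)) h) = 0" by simp
      qed
    qed
    obtain b where b: "q = Prop b" "b \<in> {1..n}" using deriv.hyps(3) by (auto simp: cols_def)
    then show ?case using col[of "n - b"] deriv.hyps(2) by simp
  qed
qed

lemma foldr_an_coeff:
  assumes "\<forall>v\<in>set ws. \<not> odd_var v"
  shows "\<exists>k. k \<noteq> 0 \<and> foldr an ws F m = k * F (mset ws + m)"
  using assms
proof (induction ws arbitrary: m)
  case Nil
  show ?case by (rule exI[of _ 1]) simp
next
  case (Cons v ws)
  then obtain k where k: "k \<noteq> 0" "foldr an ws F (add_mset v m) = k * F (mset ws + add_mset v m)"
    using Cons.IH[of "add_mset v m"] Cons.prems by auto
  have "ancoef v m = of_nat (Suc (count m v))" using Cons.prems by (simp add: ancoef_def)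
  then have "ancoef v m * k \<noteq> 0" using k(1) by (simp only: of_nat_neq_0 mult_eq_0_iff) simp
  moreover have "foldr an (v # ws) F m = ancoef v m * k * F (mset (v # ws) + m)"
    using k(2) by (simp add: an_def)
  ultimately show ?case by blast
qed

text \<open>Differentiating along all variables of one monomial of \<open>F\<close> leaves, by
  homogeneity, a constant that is a nonzero multiple of its coefficient. A constant that vanishes on
  the slice is 0.\<close>

lemma invariant_slice_zero:
  assumes inv: "invariant n F" and hom: "\<And>m. F m \<noteq> 0 \<Longrightarrow> set_mset m \<subseteq> cols n \<times> cols n \<and> size m = d"
    and van: "\<And>c. ev (slice n c) F = 0"
  shows "F m = 0"
proof (rule ccontr)
  assume nz: "F m \<noteq> 0"
  have "supported F (cols n \<times> cols n) d" using hom by (simp add: supported_def)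
  then have F: "fin_supp F" by (rule fin_supp_supported[rotated]) simp
  define ws where "ws = word_of m"
  have ws: "set ws \<subseteq> cols n \<times> cols n" using hom[OF nz] by (simp add: ws_def)
  then have odd: "\<forall>v\<in>set ws. \<not> odd_var v" using not_odd_var_cols by blast
  have "derived n F (length ws) (foldr an ws F)"
    using ws by (induction ws) (auto intro: derived.self derived.deriv)
  then have ev: "ev (slice n c) (foldr an ws F) = 0" for c
    by (rule derived_vanishes[OF inv F van])
  obtain k where k: "k \<noteq> 0" "foldr an ws F {#} = k * F m"
    using foldr_an_coeff[OF odd, of F "{#}"] by (auto simp: ws_def)
  have "foldr an ws F = (\<lambda>m'. k * F m * vac m')"
  proof
    fix m'
    show "foldr an ws F m' = k * F m * vac m'"
    proof (cases "m' = {#}")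
      case False
      obtain k' where "foldr an ws F m' = k' * F (m + m')"
        using foldr_an_coeff[OF odd, of F m'] by (auto simp: ws_def)
      moreover have "F (m + m') = 0"
        using hom[OF nz] hom[of "m + m'"] False by auto
      ultimately show ?thesis using False by (simp add: vac_def)
    qed (simp add: k vac_def)
  qed
  then have "ev (slice n c) (foldr an ws F) = k * F m" for c
    by (simp add: ev_scale)
  then show False using ev k nz by simp
qed

section \<open>Leading homogeneous parts\<close>

definition deg_part :: "nat \<Rightarrow> vec \<Rightarrow> vec" where
  "deg_part d f m = (if size m = d then f m else 0)"

lemma lin_deg_part: "lin (deg_part d)"
  by (rule linI) (simp add: deg_part_def)

lemma deg_part_vac: "deg_part 0 vac = vac"
  by (auto simp: deg_part_def vac_def)

lemma fin_supp_deg_part: "fin_supp f \<Longrightarrow> fin_supp (deg_part d f)"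
  unfolding fin_supp_def by (rule finite_subset[of _ "{m. f m \<noteq> 0}"]) (auto simp: deg_part_def)

lemma supported_mono: "supported f V d \<Longrightarrow> d \<le> d' \<Longrightarrow> supported f V d'"
  by (force simp: supported_def)

lemma deg_part_above: "supported f V d \<Longrightarrow> d < d' \<Longrightarrow> deg_part d' f = (\<lambda>m. 0)"
  by (force simp: supported_def deg_part_def fun_eq_iff)

lemma deg_part_E:
  assumes "supported f V d" "b \<in> cols n"
  shows "deg_part (Suc d) (E n a b f) = cr (a, b) (deg_part d f)"
proof
  fix m
  show "deg_part (Suc d) (E n a b f) m = cr (a, b) (deg_part d f) m"
  proof (cases "size m = Suc d")
    case True
    have "pol n a b f m = 0"
    proof (rule ccontr)
      assume "pol n a b f m \<noteq> 0"
      then obtain j where j: "(a, j) \<in># m" "f (add_mset (b, j) (m - {#(a, j)#})) \<noteq> 0"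
        by (rule pol_nonzero)
      then have "size (add_mset (b, j) (m - {#(a, j)#})) = Suc d" using True by (metis size_add_mset insert_DiffM)
      then show False using assms(1) j(2) by (auto simp: supported_def)
    qed
    then show ?thesis using True assms(2) by (auto simp: deg_part_def E_def cr_def size_Diff_singleton)
  next
    case False
    have "cr (a, b) (deg_part d f) m = 0"
    proof (rule ccontr)
      assume "cr (a, b) (deg_part d f) m \<noteq> 0"
      then have "(a, b) \<in># m" "size (m - {#(a, b)#}) = d"
        using cr_nonzero[of "(a, b)" "deg_part d f" m] by (auto simp: deg_part_def split: if_splits)
      then have "size m = Suc d" by (metis size_add_mset insert_DiffM)
      then show False using False by simp
    qed
    then show ?thesis using False by (simp add: deg_part_def)
  qed
qed

lemma supported_act_word_on:
  assumes "set w \<subseteq> cols n \<times> cols n" "supported f (cols n \<times> cols n) d"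
  shows "supported (act_word n w f) (cols n \<times> cols n) (length w + d)"
  using assms(1)
proof (induction w)
  case (Cons l w)
  then show ?case by (cases l) (auto simp: act_word_Cons intro!: supported_E)
qed (simp add: assms(2))

lemma ev_deg_part_act_word:
  assumes w: "set w \<subseteq> cols n \<times> cols n" and f: "supported f (cols n \<times> cols n) d" and le: "length w \<le> r"
  shows "ev Y (deg_part (r + d) (act_word n w f)) = (if length w = r then \<Prod>v\<leftarrow>w. Y v else 0) * ev Y (deg_part d f)"
proof (cases "length w = r")
  case True
  have "ev Y (deg_part (length w + d) (act_word n w f)) = (\<Prod>v\<leftarrow>w. Y v) * ev Y (deg_part d f)"
    using w
  proof (induction w)
    case (Cons l w)
    obtain a b where l: "l = (a, b)" by force
    have s: "supported (act_word n w f) (cols n \<times> cols n) (length w + d)"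
      using Cons.prems by (intro supported_act_word_on f) auto
    then have "fin_supp (act_word n w f)" by (rule fin_supp_supported[rotated]) simp
    then have "fin_supp (deg_part (length w + d) (act_word n w f))" by (rule fin_supp_deg_part)
    then show ?case
      using Cons deg_part_E[OF s, of b n a] not_odd_cols[of a n b] by (simp add: l act_word_Cons ev_cr)
  qed simp
  then show ?thesis using True by simp
next
  case False
  then show ?thesis
    using le deg_part_above[OF supported_act_word_on[OF w f], of "r + d"] by simp
qed

text \<open>Leading parts multiply: in top degree each letter acts as multiplication by its
  variable. Words shorter than \<open>r\<close> contribute 0 to both sides.\<close>

lemma U_le_act:
  assumes "x \<in> U_le n r" and f: "supported f (cols n \<times> cols n) d"
  shows "supported (act n x f) (cols n \<times> cols n) (r + d)"
    and "ev Y (deg_part (r + d) (act n x f)) = ev Y (deg_part r (act n x vac)) * ev Y (deg_part d f)"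
proof -
  have fin: "supported g (cols n \<times> cols n) k \<Longrightarrow> fin_supp (deg_part k' g)" for g k k'
    by (rule fin_supp_deg_part, rule fin_supp_supported[rotated]) auto
  have "supported (act n x f) (cols n \<times> cols n) (r + d) \<and> supported (act n x vac) (cols n \<times> cols n) r \<and>
    ev Y (deg_part (r + d) (act n x f)) = ev Y (deg_part r (act n x vac)) * ev Y (deg_part d f)"
    using assms(1) unfolding U_le_def
  proof (induction rule: env.span_induct_alt)
    case base
    show ?case by (simp add: supported_def deg_part_def)
  next
    case (step c x y)
    then obtain w where x: "x = e_word w" and w: "set w \<subseteq> cols n \<times> cols n" "length w \<le> r" by auto
    have sw: "supported (act_word n w f) (cols n \<times> cols n) (r + d)" "supported (act_word n w vac) (cols n \<times> cols n) r"
      using supported_mono[OF supported_act_word_on[OF w(1) f]] w(2)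
        supported_mono[OF supported_act_word_on[OF w(1) supported_vac[of _ 0]]] by auto
    have "ev Y (deg_part r (act_word n w vac)) = (if length w = r then \<Prod>v\<leftarrow>w. Y v else 0)"
      using ev_deg_part_act_word[OF w(1) supported_vac[of _ 0] w(2), of Y] by (simp add: deg_part_vac)
    then have e: "ev Y (deg_part (r + d) (act_word n w f)) = ev Y (deg_part r (act_word n w vac)) * ev Y (deg_part d f)"
      using ev_deg_part_act_word[OF w(1) f w(2), of Y] by simp
    have lt: "deg_part k (\<lambda>m. c * g m + h m) = (\<lambda>m. deg_part k h m + c * deg_part k g m)" for k g h
      by (simp add: deg_part_def fun_eq_iff)
    have s: "supported (\<lambda>m. c * g m + h m) V k" if "supported g V k" "supported h V k" for g h V k
      using that unfolding supported_def by (metis add.right_neutral mult_zero_right add.left_neutral)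
    have ih: "supported (act n y f) (cols n \<times> cols n) (r + d)" "supported (act n y vac) (cols n \<times> cols n) r"
      "ev Y (deg_part (r + d) (act n y f)) = ev Y (deg_part r (act n y vac)) * ev Y (deg_part d f)"
      using step.IH by auto
    show ?case
      unfolding x act_add act_scale act_e_word lt
        ev_lincomb[OF fin[OF ih(1)] fin[OF sw(1)]] ev_lincomb[OF fin[OF ih(2)] fin[OF sw(2)]]
      using ih sw by (simp add: s e distrib_right)
  qed
  then show "supported (act n x f) (cols n \<times> cols n) (r + d)"
    "ev Y (deg_part (r + d) (act n x f)) = ev Y (deg_part r (act n x vac)) * ev Y (deg_part d f)"
    by auto
qed

section \<open>Capelli elements on the slice\<close>

lemma fin_supp_E: "fin_supp f \<Longrightarrow> fin_supp (E n a b f)"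
  unfolding E_def by (cases "b \<in> cols n") (auto intro: fin_supp_add fin_supp_cr fin_supp_pol)

lemma fin_supp_act_word: "fin_supp f \<Longrightarrow> fin_supp (act_word n w f)"
proof (induction w)
  case (Cons l w)
  then show ?case by (cases l) (simp add: act_word_Cons fin_supp_E)
qed simp

definition creators :: "symbol \<Rightarrow> nat list \<Rightarrow> vec" where
  "creators c is = foldr (\<lambda>i. cr (c, Prop i)) is vac"

lemma creators_simps [simp]:
  "creators c [] = vac" "creators c (i # is) = cr (c, Prop i) (creators c is)"
  by (simp_all add: creators_def)

lemma creators_nonzero: "creators c is m \<noteq> 0 \<Longrightarrow> (\<forall>v\<in>#m. fst v = c) \<and> size m = length is"
proof (induction "is" arbitrary: m)
  case Nil
  then show ?case by (simp add: vac_def split: if_splits)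
next
  case (Cons i "is")
  then have "(c, Prop i) \<in># m" "creators c is (m - {#(c, Prop i)#}) \<noteq> 0"
    using cr_nonzero[of "(c, Prop i)" "creators c is" m] by auto
  moreover from this(1) obtain m' where "m = add_mset (c, Prop i) m'" by (metis mset_add)
  ultimately show ?case using Cons.IH[of m'] by auto
qed

lemma fin_supp_creators: "fin_supp (creators c is)"
  by (induction "is") (simp_all add: fin_supp_cr)

text \<open>The only row present is the virtual row c, so there is no row i to polarize and each
  letter just creates.\<close>

lemma act_word_creators:
  assumes "virtual c" "set is \<subseteq> {1..n}"
  shows "act_word n (map (\<lambda>i. (c, Prop i)) is) vac = creators c is"
  using assms(2)
proof (induction "is")
  case (Cons i "is")
  have "pol n c (Prop i) (creators c is) m = 0" for m
  proof (rule ccontr)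
    assume "pol n c (Prop i) (creators c is) m \<noteq> 0"
    then show False
    proof (cases rule: pol_nonzero)
      case (1 j)
      then show False using creators_nonzero[OF 1(3)] assms(1) by auto
    qed
  qed
  then show ?case using Cons by (simp add: act_word_Cons E_def cols_def image_iff)
qed simp

text \<open>Moves variables from the virtual row \<open>c\<close> to the rows \<open>js\<close>. For
  \<open>parity c = 0\<close> the variables Y(c,j) anticommute, and the image of
  \<open>creators c is\<close> with as many columns as rows is, up to sign, the minor with rows
  \<open>js\<close> and columns \<open>is\<close>.\<close>

definition lower :: "nat \<Rightarrow> symbol \<Rightarrow> nat list \<Rightarrow> vec \<Rightarrow> vec" where
  "lower n c js f = act_word n (map (\<lambda>i. (Prop i, c)) js) f"

lemma lin_lower: "lin (lower n c js)"
  unfolding lower_def by (rule lin_act_word)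

lemma virtual_not_cols: "virtual c \<Longrightarrow> c \<notin> cols n"
  by (auto simp: virtual_def cols_def)

lemma E_virtual: "virtual c \<Longrightarrow> E n a c f = pol n a c f"
  by (simp add: E_def virtual_not_cols)

lemma lower_cr:
  assumes "virtual c" "l \<in> cols n"
  shows "lower n c js (cr (Prop j, l) f) = cr (Prop j, l) (lower n c js f)"
proof (induction js)
  case (Cons i js)
  have "ssgn (Prop i) c (Prop j) l = 1" using assms(2) by (auto simp: cols_def)
  then have "pol n (Prop i) c (cr (Prop j, l) g) = cr (Prop j, l) (pol n (Prop i) c g)" for g
    using pol_cr[OF assms(2), of "Prop i" c "Prop j" g] assms(1) by simp
  then show ?case using Cons assms(1) by (simp add: lower_def act_word_Cons E_virtual)
qed (simp add: lower_def)

lemma fin_supp_lower: "fin_supp f \<Longrightarrow> fin_supp (lower n c js f)"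
  unfolding lower_def by (rule fin_supp_act_word)

text \<open>Laplace expansion along row j, whose letter acts first. The remaining letters only
  consume row c and therefore commute with the new variable Y(j,l).\<close>

lemma ev_lower_snoc:
  assumes c: "virtual c" and j: "j \<in> {1..n}" and f: "fin_supp f"
  shows "ev Y (lower n c (js @ [j]) f) = (\<Sum>l\<in>cols n. Y (Prop j, l) * ev Y (lower n c js (an (c, l) f)))"
proof -
  have "lower n c (js @ [j]) f = lower n c js (\<lambda>m. \<Sum>l\<in>cols n. cr (Prop j, l) (an (c, l) f) m)"
    by (simp add: lower_def act_word_append act_word_Cons E_virtual[OF c] pol_def)
  also have "\<dots> = (\<lambda>m. \<Sum>l\<in>cols n. cr (Prop j, l) (lower n c js (an (c, l) f)) m)"
    using c by (simp add: lin_sum[OF lin_lower] lower_cr)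
  finally have "ev Y (lower n c (js @ [j]) f) = (\<Sum>l\<in>cols n. ev Y (cr (Prop j, l) (lower n c js (an (c, l) f))))"
    by (simp add: ev_sum fin_supp_cr fin_supp_lower fin_supp_an f)
  also have "\<dots> = (\<Sum>l\<in>cols n. Y (Prop j, l) * ev Y (lower n c js (an (c, l) f)))"
  proof (rule sum.cong[OF refl])
    fix l assume "l \<in> cols n"
    moreover have "Prop j \<in> cols n" using j by (simp add: cols_def)
    ultimately have "\<not> odd_var (Prop j, l)" by simp
    then show "ev Y (cr (Prop j, l) (lower n c js (an (c, l) f))) = Y (Prop j, l) * ev Y (lower n c js (an (c, l) f))"
      by (rule ev_cr) (intro fin_supp_lower fin_supp_an f)
  qed
  finally show ?thesis .
qed

lemma ev_lower_slice:
  assumes "virtual c" "j \<in> {1..n}" "fin_supp f"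
  shows "ev (slice n d) (lower n c (js @ [j]) f) =
    (if 2 \<le> j then ev (slice n d) (lower n c js (an (c, Prop (j - 1)) f)) else 0)
      + d j * ev (slice n d) (lower n c js (an (c, Prop n) f))"
  unfolding ev_lower_snoc[OF assms] by (rule sum_slice_row[OF assms(2)])

lemma lower_zero [simp]: "lower n c js (\<lambda>m. 0) = (\<lambda>m. 0)"
  by (rule lin_zero[OF lin_lower])

lemma an_creators_notin: "l \<notin> set is \<Longrightarrow> an (c, Prop l) (creators c is) = (\<lambda>m. 0)"
  by (induction "is") (auto simp: an_cr lin_zero[OF lin_cr])

lemma an_creators_hd: "l \<notin> set is \<Longrightarrow> an (c, Prop l) (creators c (l # is)) = creators c is"
  by (simp add: an_cr an_creators_notin lin_zero[OF lin_cr])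

lemma an_creators_last:
  assumes "parity c = 0" "l \<notin> set is"
  shows "an (c, Prop l) (creators c (is @ [l])) = (\<lambda>m. (- 1) ^ length is * creators c is m)"
  using assms(2)
proof (induction "is")
  case Nil
  then show ?case by (simp add: an_cr lin_zero[OF lin_cr])
next
  case (Cons i "is")
  have "veps (c, Prop l) (c, Prop i) = - 1" using assms(1) by (simp add: veps_def odd_var_def)
  then show ?case using Cons by (simp add: an_cr lin_scale[OF lin_cr])
qed

text \<open>
  Each row of a companion matrix meets only its left neighbour and the last column, so the
  minors below vanish unless the rows are consecutive.
\<close>

lemma ev_lower_shifted:
  assumes c: "virtual c"
    and "sorted_wrt (<) (l # L)" "set (l # L) \<subseteq> {1..n}"
  shows "ev (slice n d) (lower n c (rev L) (creators c (butlast (l # L)))) =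
    (if l # L = [l..<l + length L + 1] then 1 else 0)"
  using assms(2,3)
proof (induction L arbitrary: l)
  case Nil
  then show ?case by (simp add: lower_def)
next
  case (Cons k L)
  let ?B = "butlast (k # L)"
  have k: "k \<in> {1..n}" "l < k" "2 \<le> k" "1 \<le> l" using Cons.prems by auto
  \<comment> \<open>Each column of this minor is smaller than its last row, so column n is absent
    and the free entries \<open>d\<close> do not enter.\<close>
  have "n \<notin> set (l # ?B)"
  proof
    assume n: "n \<in> set (l # ?B)"
    have "n < last (k # L)"
    proof -
      have "sorted_wrt (<) ((l # ?B) @ [last (k # L)])"
        using Cons.prems(1) by (metis append_butlast_last_id append_Cons list.distinct(1))
      then show ?thesis using n unfolding sorted_wrt_append by auto
    qed
    moreover have "last (k # L) \<in> {1..n}" using Cons.prems(2) last_in_set[of "k # L"] by auto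
    ultimately show False by simp
  qed
  then have n0: "an (c, Prop n) (creators c (l # ?B)) = (\<lambda>m. 0)" by (rule an_creators_notin)
  have lB: "x < y" if "x < k" "y \<in> set ?B" for x y
  proof -
    have "y \<in> set (k # L)" using that(2) by (rule in_set_butlastD)
    then show ?thesis using that(1) Cons.prems(1) by auto
  qed
  have "ev (slice n d) (lower n c (rev (k # L)) (creators c (butlast (l # k # L)))) =
    ev (slice n d) (lower n c (rev L) (an (c, Prop (k - 1)) (creators c (l # ?B))))"
  proof -
    have b: "butlast (l # k # L) = l # ?B" by simp
    have "ev (slice n d) (lower n c (rev L @ [k]) (creators c (l # ?B))) =
      ev (slice n d) (lower n c (rev L) (an (c, Prop (k - 1)) (creators c (l # ?B)))) + d k * ev (slice n d) (lower n c (rev L) (\<lambda>m. 0))"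
      using k(3) by (simp only: ev_lower_slice[OF c k(1) fin_supp_creators] n0 if_True)
    then show ?thesis unfolding b by simp
  qed
  also have "\<dots> = (if l # k # L = [l..<l + length (k # L) + 1] then 1 else 0)"
  \<comment> \<open>Row k can use only column k - 1, and l is the only column of the minor below
    k.\<close>
  proof (cases "k - 1 = l")
    case True
    then have "k = l + 1" using k by simp
    have "l \<notin> set ?B" using lB[of l l] k by auto
    then have "an (c, Prop (k - 1)) (creators c (l # ?B)) = creators c ?B"
      unfolding True by (rule an_creators_hd)
    moreover have "l # k # L = [l..<l + length (k # L) + 1] \<longleftrightarrow> k # L = [k..<k + length L + 1]"
      by (subst upt_conv_Cons) (auto simp: \<open>k = l + 1\<close>)
    ultimately show ?thesis using Cons.IH[of k] Cons.prems by simp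
  next
    case False
    have "k - 1 \<notin> set (l # ?B)" using lB[of "k - 1" "k - 1"] k False by auto
    then have "an (c, Prop (k - 1)) (creators c (l # ?B)) = (\<lambda>m. 0)" by (rule an_creators_notin)
    moreover have "l # k # L \<noteq> [l..<l + length (k # L) + 1]"
    proof
      assume "l # k # L = [l..<l + length (k # L) + 1]"
      then have "(l # k # L) ! 1 = [l..<l + length (k # L) + 1] ! 1" by simp
      then show False using False k by (simp del: upt_Suc)
    qed
    ultimately show ?thesis by (simp add: lin_zero[OF lin_lower])
  qed
  finally show ?case .
qed

text \<open>The left neighbour l - 1 of the first row l is not a column of the minor, so row l must
  use the last column, and n must occur in \<open>L\<close>. Picking the last of the k columns costs
  (-1)^(k - 1). In the remaining minor the columns lag one step behind the rows, as in
  \<open>ev_lower_shifted\<close>.\<close>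

lemma ev_lower_principal:
  assumes c: "virtual c" "parity c = 0"
    and L: "sorted_wrt (<) L" "set L \<subseteq> {1..n}" "length L = k" "1 \<le> k"
  shows "ev (slice n d) (lower n c (rev L) (creators c L)) =
    (if L = [n + 1 - k..<n + 1] then (- 1) ^ (k - 1) * d (n + 1 - k) else 0)"
proof -
  obtain l M where lM: "L = l # M" using L(3,4) by (cases L) auto
  have l: "l \<in> {1..n}" using L(2) lM by auto
  have "l - 1 \<notin> set L" using L(1) l lM by auto
  then have l0: "an (c, Prop (l - 1)) (creators c L) = (\<lambda>m. 0)" by (rule an_creators_notin)
  have e: "ev (slice n d) (lower n c (rev L) (creators c L)) =
      d l * ev (slice n d) (lower n c (rev M) (an (c, Prop n) (creators c L)))"
  proof -
    have "ev (slice n d) (lower n c (rev L) (creators c L)) = ev (slice n d) (lower n c (rev M @ [l]) (creators c L))"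
      by (simp only: lM rev.simps(2))
    also have "\<dots> = d l * ev (slice n d) (lower n c (rev M) (an (c, Prop n) (creators c L)))"
      unfolding ev_lower_slice[OF c(1) l fin_supp_creators] l0 by simp
    finally show ?thesis .
  qed
  show ?thesis
  proof (cases "n \<in> set L")
    case False
    then have "L \<noteq> [n + 1 - k..<n + 1]" using L(4) l by auto
    then show ?thesis unfolding e an_creators_notin[OF False] by (simp add: lin_zero[OF lin_lower])
  next
    case True
    have ne: "L \<noteq> []" using lM by simp
    have bl: "L = butlast L @ [last L]" using ne by simp
    have lt: "x < last L" if "x \<in> set (butlast L)" for x
      using L(1) that by (subst (asm) bl) (simp add: sorted_wrt_append)
    have "last L \<in> {1..n}" using L(2) ne last_in_set by blast
    moreover have "n \<in> set (butlast L) \<or> n = last L" using True by (subst (asm) bl) auto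
    ultimately have last: "last L = n" using lt[of n] by auto
    have "n \<notin> set (butlast L)" using lt[of n] last by auto
    then have "an (c, Prop n) (creators c L) = (\<lambda>m. (- 1) ^ (k - 1) * creators c (butlast L) m)"
      using an_creators_last[OF c(2), of n "butlast L"] bl last L(3) by simp
    then have "ev (slice n d) (lower n c (rev L) (creators c L)) =
        d l * ((- 1) ^ (k - 1) * (if L = [l..<l + length M + 1] then 1 else 0))"
      unfolding e using ev_lower_shifted[OF c(1), of l M n d] L(1,2)
      by (simp add: lin_scale[OF lin_lower] ev_scale fin_supp_lower fin_supp_creators lM)
    moreover have "L = [l..<l + length M + 1] \<longleftrightarrow> L = [n + 1 - k..<n + 1]"
    proof
      assume a: "L = [l..<l + length M + 1]"
      then have "last L = l + length M" by simp
      then have "l + length M = n" "l = n + 1 - k" using last L(3) lM by auto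
      then show "L = [n + 1 - k..<n + 1]" using a by simp
    next
      assume a: "L = [n + 1 - k..<n + 1]"
      then have "hd L = n + 1 - k" using ne by (metis hd_upt upt_eq_Nil_conv not_less)
      then have "l = n + 1 - k" "length M = k - 1" using L(3) lM by auto
      moreover have "k \<le> n" using L(2,3) a l \<open>l = n + 1 - k\<close> by auto
      ultimately show "L = [l..<l + length M + 1]" using a L(4) by simp
    qed
    moreover have "l = n + 1 - k" if "L = [n + 1 - k..<n + 1]"
    proof -
      have "hd L = n + 1 - k" using that ne by (metis hd_upt upt_eq_Nil_conv not_less)
      then show ?thesis using lM by simp
    qed
    ultimately show ?thesis by auto
  qed
qed

text \<open>A virtual \<open>c\<close> is no column, so these letters only polarize, and this
  preserves the degree.\<close>

lemma lower_homogeneous: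
  assumes "virtual c" "\<And>m. f m \<noteq> 0 \<Longrightarrow> size m = k"
  shows "lower n c js f m \<noteq> 0 \<Longrightarrow> size m = k"
proof (induction js arbitrary: m)
  case Nil
  then show ?case using assms(2) by (simp add: lower_def)
next
  case (Cons j js)
  then have "pol n (Prop j) c (lower n c js f) m \<noteq> 0"
    by (simp add: lower_def act_word_Cons E_virtual[OF assms(1)])
  then show ?case
  proof (cases rule: pol_nonzero)
    case (1 l)
    then have "size (add_mset (c, l) (m - {#(Prop j, l)#})) = k" by (intro Cons.IH)
    then show ?thesis using 1(2) by (metis insert_DiffM size_add_mset)
  qed
qed

lemma U_gl_support:
  assumes "y \<in> U_gl n" "act n y vac m \<noteq> 0"
  shows "set_mset m \<subseteq> cols n \<times> cols n"
proof -
  have "\<forall>m. act n y vac m \<noteq> 0 \<longrightarrow> set_mset m \<subseteq> cols n \<times> cols n"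
    using assms(1) unfolding U_gl_def' U_on_span
  proof (induction rule: env.span_induct_alt)
    case (step c x y)
    then obtain w where x: "x = e_word w" "set w \<subseteq> cols n \<times> cols n" by auto
    show ?case
    proof (intro allI impI)
      fix m assume "act n (env_scale c x + y) vac m \<noteq> 0"
      then have "act_word n w vac m \<noteq> 0 \<or> act n y vac m \<noteq> 0"
        by (auto simp: act_add act_scale x act_e_word)
      then show "set_mset m \<subseteq> cols n \<times> cols n"
        using step supported_act_word[OF x(2), of n] by (auto simp: supported_def)
    qed
  qed simp
  then show ?thesis using assms(2) by blast
qed

text \<open>The filtration degree is visible in the image at 1: \<open>U_le_surj\<close> gives a
  preimage in the right degree, and injectivity identifies it with \<open>y\<close>.\<close>

lemma U_leI:
  assumes y: "y \<in> U_gl n" and "\<And>m. act n y vac m \<noteq> 0 \<Longrightarrow> size m \<le> d"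
  shows "y \<in> U_le n d"
proof -
  have "supported (act n y vac) (cols n \<times> cols n) d"
    using U_gl_support[OF y] assms(2) by (auto simp: supported_def)
  then obtain z where z: "z \<in> U_le n d" "act n z vac = act n y vac" by (rule U_le_surj)
  then have "z = y" using U_gl_inj[of z n y] U_le_subset y by blast
  then show ?thesis using z by simp
qed

lemma act_capelli_H:
  assumes "1 \<le> m0"
  shows "act n (capelli_H m0 m1 n k) vac =
    (\<lambda>m. \<Sum>is\<in>strict_words n k. lower n (Pos 1) (rev is) (creators (Pos 1) is) m)"
proof -
  note v = virtual_Pos
  have "act n (foldr (sand (Pos 1)) (rev is) 1) vac = lower n (Pos 1) (rev is) (creators (Pos 1) is)"
    if "is \<in> strict_words n k" for "is"
    unfolding foldr_sand_e_word act_mult act_e_word rev_map[symmetric] rev_rev_ident lower_def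
    using act_word_creators[OF v, of "is" n] that by (simp add: strict_words_def)
  then show ?thesis
    unfolding represents_act[OF represents_capelli_H_sum[OF assms]] act_sum by simp
qed

lemma capelli_H_homogeneous:
  assumes "1 \<le> m0" "act n (capelli_H m0 m1 n k) vac m \<noteq> 0"
  shows "size m = k"
proof -
  note v = virtual_Pos
  obtain ws where ws: "ws \<in> strict_words n k" "lower n (Pos 1) (rev ws) (creators (Pos 1) ws) m \<noteq> 0"
    using assms(2) unfolding act_capelli_H[OF assms(1)] by (meson sum.not_neutral_contains_not_neutral)
  show ?thesis
    by (rule lower_homogeneous[OF v _ ws(2)]) (use creators_nonzero ws(1) in \<open>auto simp: strict_words_def\<close>)
qed

lemma capelli_H_U_le:
  assumes "1 \<le> m0"
  shows "capelli_H m0 m1 n k \<in> U_le n k"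
proof (rule U_leI)
  show "capelli_H m0 m1 n k \<in> U_gl n"
    using represents_capelli_H[OF assms] by (simp add: represents_def)
qed (use capelli_H_homogeneous[OF assms] in auto)

text \<open>The leading part of a Capelli element is the sum of the principal k-minors, up to sign a
  coefficient of the characteristic polynomial. On the slice only the minor on the last k indices
  survives.\<close>

lemma ev_capelli_H:
  assumes "1 \<le> m0" "1 \<le> k" "k \<le> n"
  shows "ev (slice n d) (deg_part k (act n (capelli_H m0 m1 n k) vac)) = (- 1) ^ (k - 1) * d (n + 1 - k)"
proof -
  note v = virtual_Pos
  have "deg_part k (act n (capelli_H m0 m1 n k) vac) = act n (capelli_H m0 m1 n k) vac"
    using capelli_H_homogeneous[OF assms(1), of n m1 k] by (auto simp: deg_part_def fun_eq_iff)
  then have "ev (slice n d) (deg_part k (act n (capelli_H m0 m1 n k) vac)) =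
      (\<Sum>is\<in>strict_words n k. ev (slice n d) (lower n (Pos 1) (rev is) (creators (Pos 1) is)))"
    unfolding act_capelli_H[OF assms(1)] by (simp add: ev_sum fin_supp_lower fin_supp_creators)
  also have "\<dots> = (\<Sum>is\<in>strict_words n k. if is = [n + 1 - k..<n + 1] then (- 1) ^ (k - 1) * d (n + 1 - k) else 0)"
    by (rule sum.cong[OF refl], rule ev_lower_principal[OF v])
      (use assms(2) in \<open>auto simp: strict_words_def\<close>)
  also have "\<dots> = (- 1) ^ (k - 1) * d (n + 1 - k)"
  proof -
    have "[n + 1 - k..<n + 1] \<in> strict_words n k"
      using assms(2,3) by (auto simp: strict_words_def simp del: upt_Suc)
    then show ?thesis using finite_strict_words[of n k] by simp
  qed
  finally show ?thesis .
qed

section \<open>The Capelli elements generate the center\<close>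

text \<open>The Euler operator of a single variable.\<close>

lemma cr_an_even: "\<not> odd_var v \<Longrightarrow> cr v (an v f) m = of_nat (count m v) * f m"
proof (cases "v \<in># m")
  case True
  assume "\<not> odd_var v"
  moreover obtain m' where "m = add_mset v m'" using True by (metis mset_add)
  ultimately show ?thesis by (simp add: cr_add_mset an_def ancoef_def)
next
  case False
  then show ?thesis by (simp add: cr_notin not_in_iff)
qed

lemma count_image_fst:
  "set_mset m \<subseteq> A \<times> B \<Longrightarrow> finite B \<Longrightarrow> (\<Sum>b\<in>B. count m (a, b)) = count (image_mset fst m) a"
proof (induction m)
  case (add v m)
  have "(\<Sum>b\<in>B. count (add_mset v m) (a, b)) = (\<Sum>b\<in>B. count m (a, b) + (if b = snd v then if fst v = a then 1 else 0 else 0))"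
    by (rule sum.cong) (auto simp: prod_eq_iff)
  then show ?case using add by (auto simp: sum.distrib)
qed simp

lemma count_image_snd:
  "set_mset m \<subseteq> A \<times> B \<Longrightarrow> finite A \<Longrightarrow> (\<Sum>a\<in>A. count m (a, b)) = count (image_mset snd m) b"
proof (induction m)
  case (add v m)
  have "(\<Sum>a\<in>A. count (add_mset v m) (a, b)) = (\<Sum>a\<in>A. count m (a, b) + (if a = fst v then if snd v = b then 1 else 0 else 0))"
    by (rule sum.cong) (auto simp: prod_eq_iff)
  then show ?case using add by (auto simp: sum.distrib)
qed simp

text \<open>As a difference of sums of Euler operators, \<open>ad n i i\<close> multiplies a
  monomial by the number of its variables in row i minus the number in column i.\<close>

lemma invariant_weight_zero:
  assumes "invariant n F" "F m \<noteq> 0" "set_mset m \<subseteq> cols n \<times> cols n"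
  shows "image_mset fst m = image_mset snd m"
proof (rule multiset_eqI)
  fix i
  show "count (image_mset fst m) i = count (image_mset snd m) i"
  proof (cases "i \<in> cols n")
    case True
    have "pol n i i F m = (\<Sum>j\<in>cols n. of_nat (count m (i, j)) * F m)"
      unfolding pol_def by (intro sum.cong refl cr_an_even not_odd_cols[OF True])
    also have "\<dots> = of_nat (count (image_mset fst m) i) * F m"
      using count_image_fst[OF assms(3)] by (simp flip: sum_distrib_right of_nat_sum)
    finally have 1: "pol n i i F m = of_nat (count (image_mset fst m) i) * F m" .
    have "rpol n i i F m = (\<Sum>j\<in>cols n. of_nat (count m (j, i)) * F m)"
      unfolding rpol_def by (intro sum.cong refl cr_an_even not_odd_cols[OF _ True])
    also have "\<dots> = of_nat (count (image_mset snd m) i) * F m"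
      using count_image_snd[OF assms(3)] by (simp flip: sum_distrib_right of_nat_sum)
    finally have 2: "rpol n i i F m = of_nat (count (image_mset snd m) i) * F m" .
    have "ad n i i F = (\<lambda>m. 0)" using assms(1) True by (simp add: invariant_def)
    then have "pol n i i F m - rpol n i i F m = 0" unfolding ad_def by (rule fun_cong)
    then show ?thesis using assms(2) by (simp add: 1 2)
  next
    case False
    then have "i \<notin># image_mset fst m" "i \<notin># image_mset snd m" using assms(3) by auto
    then show ?thesis by (simp only: not_in_iff)
  qed
qed

lemma cr_an_deg_part: "cr u (an v (deg_part d f)) m = (if size m = d then cr u (an v f) m else 0)"
proof (cases "u \<in># m")
  case True
  then have "size (add_mset v (m - {#u#})) = size m" by (metis insert_DiffM size_add_mset)
  then show ?thesis by (auto simp: cr_def an_def deg_part_def)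
qed (simp add: cr_notin)

lemma pol_deg_part: "pol n a b (deg_part d f) = deg_part d (pol n a b f)"
  by (rule ext) (simp add: pol_def cr_an_deg_part, simp add: deg_part_def)

lemma rpol_deg_part: "rpol n i j (deg_part d f) = deg_part d (rpol n i j f)"
  by (rule ext) (simp add: rpol_def cr_an_deg_part, simp add: deg_part_def)

lemma invariant_deg_part: "invariant n f \<Longrightarrow> invariant n (deg_part d f)"
  unfolding invariant_def ad_def pol_deg_part rpol_deg_part
  by (auto simp: deg_part_def fun_eq_iff)

definition on_slice :: "nat \<Rightarrow> var \<Rightarrow> bool" where
  "on_slice n v \<longleftrightarrow> (\<exists>a\<in>{1..n}. \<exists>b\<in>{1..n}. v = (Prop a, Prop b) \<and> (b = n \<or> a = b + 1))"

lemma slice_off: "v \<in> cols n \<times> cols n \<Longrightarrow> \<not> on_slice n v \<Longrightarrow> slice n c v = 0"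
  by (auto simp: on_slice_def cols_def)

fun index :: "symbol \<Rightarrow> nat" where
  "index (Prop a) = a"
| "index _ = 0"

text \<open>The degree of the Capelli element whose leading part is the coordinate \<open>v\<close>
  of the slice, up to sign: n + 1 - a for the entry (a, n). The constant entries below the diagonal
  get 0.\<close>

definition slice_weight :: "nat \<Rightarrow> var \<Rightarrow> nat" where
  "slice_weight n v = (if snd v = Prop n then n + 1 - index (fst v) else 0)"

lemma slice_weight_index: "on_slice n v \<Longrightarrow> slice_weight n v + index (fst v) = index (snd v) + 1"
  by (auto simp: on_slice_def slice_weight_def)

text \<open>On the slice, a weight is 1 plus column index minus row index. If the rows and the
  columns of a monomial have the same content, the indices cancel. Single weights may differ from 1,
  but their sum is the degree.\<close>

lemma slice_weight_sum:
  assumes "\<forall>v\<in>set ws. on_slice n v" "image_mset fst (mset ws) = image_mset snd (mset ws)"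
  shows "(\<Sum>v\<leftarrow>ws. slice_weight n v) = length ws"
proof -
  have "(\<Sum>v\<leftarrow>ws. slice_weight n v) + (\<Sum>v\<leftarrow>ws. index (fst v)) = (\<Sum>v\<leftarrow>ws. index (snd v)) + length ws"
    using assms(1)
  proof (induction ws)
    case (Cons v ws)
    then show ?case using slice_weight_index[of n v] by simp
  qed simp
  moreover have "(\<Sum>v\<leftarrow>ws. index (fst v)) = (\<Sum>v\<leftarrow>ws. index (snd v))"
    using arg_cong[OF assms(2), of "\<lambda>M. sum_mset (image_mset index M)"]
    by (simp add: image_mset.compositionality comp_def flip: sum_mset_sum_list mset_map)
  ultimately show ?thesis by simp
qed

section \<open>The center as an algebra and its Capelli generators\<close>

lemma zeta_one: "1 \<in> zeta n"
  by (auto simp: zeta_def U_gl_def one_in_U_on)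

lemma zeta_add: "x \<in> zeta n \<Longrightarrow> y \<in> zeta n \<Longrightarrow> x + y \<in> zeta n"
  by (auto simp: zeta_def U_gl_def distrib_left distrib_right intro: env.subspace_add[OF subspace_U_on])

lemma zeta_scale: "x \<in> zeta n \<Longrightarrow> env_scale c x \<in> zeta n"
  by (auto simp: zeta_def U_gl_def intro: env.subspace_scale[OF subspace_U_on])

lemma zeta_mult: "x \<in> zeta n \<Longrightarrow> y \<in> zeta n \<Longrightarrow> x * y \<in> zeta n"
proof -
  assume x: "x \<in> zeta n" and y: "y \<in> zeta n"
  have "x * y * u = u * (x * y)" if u: "u \<in> U_gl n" for u
  proof -
    have xu: "x * u = u * x" and yu: "y * u = u * y" using x y u unfolding zeta_def by blast+
    have "x * y * u = x * (y * u)" by (rule mult.assoc)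
    also have "\<dots> = x * u * y" unfolding yu by (rule mult.assoc[symmetric])
    also have "\<dots> = u * (x * y)" unfolding xu by (rule mult.assoc)
    finally show ?thesis .
  qed
  moreover have "x * y \<in> U_gl n"
    using x y unfolding zeta_def U_gl_def by (intro U_on_mult) blast+
  ultimately show ?thesis unfolding zeta_def by blast
qed

lemma zeta_zero: "0 \<in> zeta n"
  using zeta_scale[OF zeta_one, where c = 0] by simp

lemma zeta_diff: "x \<in> zeta n \<Longrightarrow> y \<in> zeta n \<Longrightarrow> x - y \<in> zeta n"
  using zeta_add[of x n "env_scale (- 1) y"] zeta_scale[of y n "- 1"] by simp

lemma U_le_mult: "x \<in> U_le n r \<Longrightarrow> y \<in> U_le n s \<Longrightarrow> x * y \<in> U_le n (r + s)"
  unfolding U_le_def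
proof (erule (1) span_mult_closed)
  fix u v
  assume "u \<in> {e_word w | w. set w \<subseteq> cols n \<times> cols n \<and> length w \<le> r}"
    "v \<in> {e_word w | w. set w \<subseteq> cols n \<times> cols n \<and> length w \<le> s}"
  then obtain w w' where "u * v = e_word (w @ w')" "set (w @ w') \<subseteq> cols n \<times> cols n" "length (w @ w') \<le> r + s"
    by (auto simp: e_word_append)
  then show "u * v \<in> env.span {e_word w | w. set w \<subseteq> cols n \<times> cols n \<and> length w \<le> r + s}"
    by (intro env.span_base) blast
qed

lemma U_le_one: "1 \<in> U_le n 0"
proof -
  have "1 \<in> {e_word w | w. set w \<subseteq> cols n \<times> cols n \<and> length w \<le> 0}"
    by (rule CollectI, rule exI[of _ "[]"]) simp
  then show ?thesis unfolding U_le_def by (rule env.span_base)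
qed

lemma subspace_U_le: "env.subspace (U_le n d)"
  by (simp add: U_le_def env.subspace_span)

definition capelli_algebra :: "nat \<Rightarrow> nat \<Rightarrow> nat \<Rightarrow> env set" where
  "capelli_algebra m0 m1 n = subalgebra_gen {capelli_H m0 m1 n k | k. k \<in> {1..n}}"

lemma capelli_algebra_subset:
  assumes "1 \<le> m0" "z \<in> capelli_algebra m0 m1 n"
  shows "z \<in> zeta n"
  using assms(2) unfolding capelli_algebra_def
  by (induction rule: subalgebra_gen.induct)
    (auto intro: zeta_one zeta_add zeta_mult zeta_scale capelli_H_family(1)[OF assms(1)])

text \<open>The central substitute for the variable \<open>v\<close>; the sign undoes the one in
  \<open>ev_capelli_H\<close>, and the subdiagonal entries 1 become the unit.\<close>

definition slice_capelli :: "nat \<Rightarrow> nat \<Rightarrow> nat \<Rightarrow> var \<Rightarrow> env" where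
  "slice_capelli m0 m1 n v = (if snd v = Prop n
     then env_scale ((- 1) ^ (slice_weight n v - 1)) (capelli_H m0 m1 n (slice_weight n v)) else 1)"

lemma U_le_vac:
  assumes "x \<in> U_le n r"
  shows "supported (act n x vac) (cols n \<times> cols n) r" "fin_supp (act n x vac)"
proof -
  show s: "supported (act n x vac) (cols n \<times> cols n) r"
    using U_le_act(1)[OF assms supported_vac[of _ 0]] by simp
  show "fin_supp (act n x vac)"
    by (rule fin_supp_supported[OF _ s]) simp
qed

lemma slice_capelli:
  assumes m0: "1 \<le> m0" and v: "on_slice n v"
  shows "slice_capelli m0 m1 n v \<in> U_le n (slice_weight n v)" (is ?U)
    and "slice_capelli m0 m1 n v \<in> capelli_algebra m0 m1 n" (is ?A)
    and "ev (slice n c) (deg_part (slice_weight n v) (act n (slice_capelli m0 m1 n v) vac)) = slice n c v" (is ?E)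
proof -
  obtain a b where ab: "v = (Prop a, Prop b)" "a \<in> {1..n}" "b \<in> {1..n}" "b = n \<or> a = b + 1"
    using v by (auto simp: on_slice_def)
  show ?U ?A
    using env.subspace_scale[OF subspace_U_le capelli_H_U_le[OF m0]] U_le_one ab
    by (auto simp: slice_capelli_def slice_weight_def capelli_algebra_def intro!: subalgebra_gen.intros(1,2,5))
  show ?E
  proof (cases "b = n")
    case True
    let ?k = "n + 1 - a"
    have w: "slice_weight n v = ?k" using ab True by (simp add: slice_weight_def)
    have k: "1 \<le> ?k" "?k \<le> n" "n + 1 - ?k = a" using ab by auto
    have fin: "fin_supp (deg_part ?k (act n (capelli_H m0 m1 n ?k) vac))"
      by (intro fin_supp_deg_part U_le_vac(2)[OF capelli_H_U_le[OF m0]])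
    have s: "slice_capelli m0 m1 n v = env_scale ((- 1) ^ (?k - 1)) (capelli_H m0 m1 n ?k)"
      unfolding slice_capelli_def w using ab True by simp
    have "ev (slice n c) (deg_part ?k (act n (slice_capelli m0 m1 n v) vac))
        = (- 1) ^ (?k - 1) * ((- 1) ^ (?k - 1) * c (n + 1 - ?k))"
      unfolding s act_scale lin_scale[OF lin_deg_part] ev_scale[OF fin] ev_capelli_H[OF m0 k(1,2)] ..
    also have "\<dots> = c a" unfolding k(3) by (simp flip: mult.assoc power_add mult_2)
    finally show ?thesis unfolding w using ab True by simp
  next
    case False
    then show ?thesis using ab by (simp add: slice_capelli_def slice_weight_def deg_part_vac)
  qed
qed

lemma slice_capelli_prod:
  assumes m0: "1 \<le> m0" and "\<forall>v\<in>set ws. on_slice n v"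
  shows "(\<Prod>v\<leftarrow>ws. slice_capelli m0 m1 n v) \<in> U_le n (\<Sum>v\<leftarrow>ws. slice_weight n v) \<and>
    (\<Prod>v\<leftarrow>ws. slice_capelli m0 m1 n v) \<in> capelli_algebra m0 m1 n \<and>
    ev (slice n c) (deg_part (\<Sum>v\<leftarrow>ws. slice_weight n v) (act n (\<Prod>v\<leftarrow>ws. slice_capelli m0 m1 n v) vac))
      = (\<Prod>v\<leftarrow>ws. slice n c v)"
  using assms(2)
proof (induction ws)
  case Nil
  show ?case by (simp add: U_le_one capelli_algebra_def subalgebra_gen.one deg_part_vac)
next
  case (Cons v ws)
  let ?p = "\<Prod>v\<leftarrow>ws. slice_capelli m0 m1 n v" and ?w = "\<Sum>v\<leftarrow>ws. slice_weight n v"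
  have IH: "?p \<in> U_le n ?w" "?p \<in> capelli_algebra m0 m1 n"
    "ev (slice n c) (deg_part ?w (act n ?p vac)) = (\<Prod>v\<leftarrow>ws. slice n c v)"
    using Cons by auto
  have "on_slice n v" using Cons.prems by simp
  note v = slice_capelli[OF m0 this]
  show ?case
    using U_le_mult[OF v(1) IH(1)] v(2) IH(2) U_le_act(2)[OF v(1) U_le_vac(1)[OF IH(1)], of "slice n c"] v(3) IH(3)
    by (simp add: act_mult capelli_algebra_def subalgebra_gen.mult)
qed

lemma capelli_algebra_sum:
  "(\<And>i. i \<in> I \<Longrightarrow> x i \<in> capelli_algebra m0 m1 n) \<Longrightarrow> (\<Sum>i\<in>I. x i) \<in> capelli_algebra m0 m1 n"
  unfolding capelli_algebra_def
  by (induction I rule: infinite_finite_induct) (auto intro: subalgebra_gen_zero subalgebra_gen.add)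

text \<open>
  Subtracting from a central element a polynomial in the Capelli elements that agrees with its
  leading part on the slice lowers the degree.
\<close>

lemma zeta_subset_capelli_algebra:
  assumes m0: "1 \<le> m0" and "z \<in> zeta n"
  shows "z \<in> capelli_algebra m0 m1 n"
proof -
  have main: "\<forall>z \<in> zeta n. (\<forall>m. act n z vac m \<noteq> 0 \<longrightarrow> size m < d) \<longrightarrow> z \<in> capelli_algebra m0 m1 n" for d
  proof (induction d)
    case 0
    show ?case
    proof (intro ballI impI)
      fix z assume "z \<in> zeta n" "\<forall>m. act n z vac m \<noteq> 0 \<longrightarrow> size m < 0"
      then have "act n z vac = act n 0 vac" "z \<in> U_gl n" "0 \<in> U_gl n"
        using zeta_zero by (auto simp: zeta_def)
      then have "z = 0" using U_gl_inj by blast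
      then show "z \<in> capelli_algebra m0 m1 n" by (simp add: capelli_algebra_def subalgebra_gen_zero)
    qed
  next
    case (Suc d)
    show ?case
    proof (intro ballI impI)
      fix z assume z: "z \<in> zeta n" and deg: "\<forall>m. act n z vac m \<noteq> 0 \<longrightarrow> size m < Suc d"
      let ?F = "deg_part d (act n z vac)"
      have zle: "z \<in> U_le n d" using z deg by (intro U_leI) (auto simp: zeta_def)
      have invF: "invariant n ?F" by (intro invariant_deg_part zeta_invariant z)
      have finF: "finite {m. ?F m \<noteq> 0}"
        using fin_supp_deg_part[OF U_le_vac(2)[OF zle]] by (simp add: fin_supp_def)
      have F: "set_mset m \<subseteq> cols n \<times> cols n" "size m = d" if "?F m \<noteq> 0" for m
        using that U_le_vac(1)[OF zle] by (auto simp: deg_part_def supported_def split: if_splits)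
      \<comment> \<open>A monomial with a variable off the slice has value 0 there, and is replaced
        by 0.\<close>
      define g where "g m = (if \<forall>v\<in>#m. on_slice n v then \<Prod>v\<leftarrow>word_of m. slice_capelli m0 m1 n v else 0)" for m
      have g: "g m \<in> U_le n d" "g m \<in> capelli_algebra m0 m1 n"
        "ev (slice n c) (deg_part d (act n (g m) vac)) = (\<Prod>v\<in>#m. slice n c v)" if m: "?F m \<noteq> 0" for m c
      proof -
        have "g m \<in> U_le n d \<and> g m \<in> capelli_algebra m0 m1 n \<and>
          ev (slice n c) (deg_part d (act n (g m) vac)) = (\<Prod>v\<in>#m. slice n c v)"
        proof (cases "\<forall>v\<in>#m. on_slice n v")
          case True
          \<comment> \<open>Invariance makes the weights add up to d, so the product of Capelli
            elements lands in the right filtration degree.\<close>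
          have "image_mset fst m = image_mset snd m"
            by (rule invariant_weight_zero[OF invF m F(1)[OF m]])
          then have "(\<Sum>v\<leftarrow>word_of m. slice_weight n v) = d"
            using slice_weight_sum[of "word_of m" n] True F(2)[OF m] by simp
          moreover have "(\<Prod>v\<leftarrow>word_of m. slice n c v) = (\<Prod>v\<in>#m. slice n c v)"
            by (metis mset_map mset_word_of prod_mset_prod_list)
          moreover have "\<forall>v\<in>set (word_of m). on_slice n v" using True by simp
          ultimately show ?thesis using slice_capelli_prod[OF m0, of "word_of m" n m1 c] True by (simp add: g_def)
        next
          case False
          then obtain v where v: "v \<in># m" "\<not> on_slice n v" by blast
          then have "slice n c v = 0" using F(1)[OF m] by (intro slice_off) auto
          then have "(\<Prod>v\<in>#m. slice n c v) = 0" using v(1) by (auto simp: prod_mset_zero_iff)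
          moreover have "g m = 0" using False unfolding g_def by (rule if_not_P)
          ultimately show ?thesis
            by (simp add: env.subspace_0[OF subspace_U_le] capelli_algebra_def subalgebra_gen_zero lin_zero[OF lin_deg_part])
        qed
        then show "g m \<in> U_le n d" "g m \<in> capelli_algebra m0 m1 n"
          "ev (slice n c) (deg_part d (act n (g m) vac)) = (\<Prod>v\<in>#m. slice n c v)" by auto
      qed
      define y where "y = (\<Sum>m | ?F m \<noteq> 0. env_scale (?F m) (g m))"
      have yA: "y \<in> capelli_algebra m0 m1 n"
        unfolding y_def using g(2) by (intro capelli_algebra_sum) (auto simp: capelli_algebra_def intro: subalgebra_gen.scale)
      have yz: "y \<in> zeta n" by (rule capelli_algebra_subset[OF m0 yA])
      have yle: "y \<in> U_le n d"
        unfolding y_def using g(1) by (intro env.subspace_sum[OF subspace_U_le] env.subspace_scale[OF subspace_U_le]) auto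
      have evy: "ev (slice n c) (deg_part d (act n y vac)) = ev (slice n c) ?F" for c
      proof -
        have fin: "fin_supp (deg_part d (act n (g m) vac))" if "?F m \<noteq> 0" for m
          using g(1)[OF that] by (intro fin_supp_deg_part U_le_vac(2))
        have "deg_part d (act n y vac) = (\<lambda>m'. \<Sum>m | ?F m \<noteq> 0. ?F m * deg_part d (act n (g m) vac) m')"
          by (simp only: y_def act_sum act_scale lin_sum[OF lin_deg_part] lin_scale[OF lin_deg_part])
        moreover have "fin_supp (\<lambda>m'. ?F m * deg_part d (act n (g m) vac) m')" if "?F m \<noteq> 0" for m
          using fin_supp_lincomb[OF fin_supp_zero fin[OF that]] by simp
        ultimately have "ev (slice n c) (deg_part d (act n y vac)) =
            (\<Sum>m | ?F m \<noteq> 0. ev (slice n c) (\<lambda>m'. ?F m * deg_part d (act n (g m) vac) m'))"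
          by (simp only:) (rule ev_sum, blast)
        also have "\<dots> = (\<Sum>m | ?F m \<noteq> 0. ?F m * (\<Prod>v\<in>#m. slice n c v))"
          by (rule sum.cong[OF refl]) (simp add: ev_scale[OF fin] g(3))
        finally show ?thesis by (simp only: ev_def)
      qed
      let ?G = "deg_part d (act n (z - y) vac)"
      have zyz: "z - y \<in> zeta n" by (rule zeta_diff[OF z yz])
      have zyle: "z - y \<in> U_le n d" by (rule env.subspace_diff[OF subspace_U_le zle yle])
      have "?G m = 0" for m
      proof (rule invariant_slice_zero[where F = ?G])
        show "invariant n ?G" by (intro invariant_deg_part zeta_invariant zyz)
        show "set_mset m \<subseteq> cols n \<times> cols n \<and> size m = d" if "?G m \<noteq> 0" for m
          using that U_le_vac(1)[OF zyle] by (auto simp: deg_part_def supported_def split: if_splits)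
        show "ev (slice n c) ?G = 0" for c
          using evy[of c] fin_supp_deg_part[OF U_le_vac(2)[OF zle], of d] fin_supp_deg_part[OF U_le_vac(2)[OF yle], of d]
          by (simp add: act_diff lin_diff[OF lin_deg_part] ev_diff)
      qed
      then have "\<forall>m. act n (z - y) vac m \<noteq> 0 \<longrightarrow> size m < d"
        using U_le_vac(1)[OF zyle] unfolding supported_def deg_part_def
        by (metis nat_less_le)
      then have "z - y \<in> capelli_algebra m0 m1 n" using Suc zyz by blast
      then have "(z - y) + y \<in> capelli_algebra m0 m1 n"
        using yA unfolding capelli_algebra_def by (rule subalgebra_gen.add)
      then show "z \<in> capelli_algebra m0 m1 n" by simp
    qed
  qed
  have zU: "z \<in> U_gl n" using assms(2) by (simp add: zeta_def)
  obtain d where "\<forall>m. act n z vac m \<noteq> 0 \<longrightarrow> size m < d"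
  proof -
    have "\<exists>d. z \<in> U_le n d"
      using zU unfolding U_gl_def' U_on_span
    proof (induction rule: env.span_induct_alt)
      case base
      show ?case using env.subspace_0[OF subspace_U_le] by blast
    next
      case (step c x y)
      then obtain w d where "x = e_word w" "set w \<subseteq> cols n \<times> cols n" "y \<in> U_le n d" by auto
      then have "x \<in> U_le n (length w)" unfolding U_le_def by (intro env.span_base) blast
      then have "x \<in> U_le n (length w + d)" "y \<in> U_le n (length w + d)"
        using U_le_mono[of "length w" "length w + d" n] U_le_mono[of d "length w + d" n] \<open>y \<in> U_le n d\<close> by auto
      then have "env_scale c x + y \<in> U_le n (length w + d)"
        by (intro env.subspace_add[OF subspace_U_le] env.subspace_scale[OF subspace_U_le])
      then show ?case by blast
    qed
    then obtain d where "z \<in> U_le n d" by blast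
    then have "\<forall>m. act n z vac m \<noteq> 0 \<longrightarrow> size m < Suc d"
      using U_le_vac(1)[of z n d] by (auto simp: supported_def less_Suc_eq_le)
    then show ?thesis using that by blast
  qed
  then show ?thesis using main assms(2) by blast
qed

section \<open>The projection of centers\<close>

text \<open>The graph of the projection, expressed through evaluation at 1, where compatibility with
  the algebra operations is easy to check.\<close>

definition restricts :: "nat \<Rightarrow> env \<Rightarrow> env \<Rightarrow> bool" where
  "restricts n z x \<longleftrightarrow> z \<in> zeta (n + 1) \<and> x \<in> zeta n \<and> act n z vac = act n x vac"

lemma zeta_subset_U_gl: "x \<in> zeta n \<Longrightarrow> x \<in> U_gl n"
  by (simp add: zeta_def)

lemma restricts_unique: "restricts n z x \<Longrightarrow> restricts n z y \<Longrightarrow> x = y"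
  by (rule U_gl_inj[of _ n]) (auto simp: restricts_def zeta_subset_U_gl)

lemma restrictsI:
  assumes "z \<in> zeta (n + 1)" "x \<in> zeta n" "z - x \<in> ideal_I_0 (n + 1)"
  shows "restricts n z x"
proof -
  have "act n (z - x) vac = (\<lambda>m. 0)"
    using assms(3) act_col_ideal unfolding ideal_I_0_def ideal_I_eq by blast
  then show ?thesis using assms(1,2) by (simp add: restricts_def act_diff fun_eq_iff)
qed

lemma restricts_one: "restricts n 1 1"
  by (simp add: restricts_def zeta_one)

lemma restricts_add: "restricts n z x \<Longrightarrow> restricts n w y \<Longrightarrow> restricts n (z + w) (x + y)"
  by (simp add: restricts_def zeta_add act_add)

lemma restricts_scale: "restricts n z x \<Longrightarrow> restricts n (env_scale c z) (env_scale c x)"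
  by (simp add: restricts_def zeta_scale act_scale)

text \<open>At 1 one has z w = z y = y z = y x. The middle step uses that z is central in
  U(gl(n+1)), which contains y.\<close>

lemma restricts_mult:
  assumes "restricts n z x" "restricts n w y"
  shows "restricts n (z * w) (x * y)"
proof -
  have z: "z \<in> zeta (n + 1)" "x \<in> zeta n" "act n z vac = act n x vac"
    and w: "w \<in> zeta (n + 1)" "y \<in> zeta n" "act n w vac = act n y vac"
    using assms by (simp_all add: restricts_def)
  have yU: "y \<in> U_gl n" and yU': "y \<in> U_gl (n + 1)"
    using w(2) U_gl_mono[of n "n + 1"] by (auto simp: zeta_def)
  have zy: "z * y = y * z" and xy: "x * y = y * x"
    using z(1,2) yU yU' unfolding zeta_def by blast+
  have "act n (z * w) vac = act n (z * y) vac" by (simp only: act_mult w(3))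
  also have "\<dots> = act n (y * x) vac" unfolding zy by (simp only: act_mult z(3))
  finally show ?thesis using z w by (simp add: restricts_def zeta_mult xy)
qed

lemma restricts_capelli_H:
  "1 \<le> m0 \<Longrightarrow> restricts n (capelli_H m0 m1 (n + 1) k) (capelli_H m0 m1 n k)"
  by (intro restrictsI capelli_H_family)

text \<open>There is no increasing word of more than n indices in 1..n. This turns the prescribed
  value 0 for the top Capelli element into an instance of the general rule.\<close>

lemma capelli_H_above: "n < k \<Longrightarrow> capelli_H m0 m1 n k = 0"
proof -
  assume "n < k"
  have "strict_words n k = {}"
  proof (rule ccontr)
    assume "strict_words n k \<noteq> {}"
    then obtain ws where "length ws = k" "sorted_wrt (<) ws" "set ws \<subseteq> {1..n}"
      by (auto simp: strict_words_def)
    then have "k \<le> n" using card_mono[of "{1..n}" "set ws"] by (simp add: strict_sorted_iff distinct_card)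
    then show False using \<open>n < k\<close> by simp
  qed
  then show ?thesis by (simp add: capelli_H_sand)
qed

text \<open>The elements with a projection are closed under the algebra operations, so the Capelli
  generators suffice; this is where generation of the center is needed.\<close>

lemma restricts_ex:
  fixes m0 :: nat
  assumes m0: "1 \<le> m0" and z: "z \<in> zeta (n + 1)"
  shows "\<exists>x. restricts n z x"
  using zeta_subset_capelli_algebra[OF m0 z, of 0] unfolding capelli_algebra_def
proof (induction rule: subalgebra_gen.induct)
  case (gen z)
  then show ?case using restricts_capelli_H[OF m0] by blast
qed (use restricts_one restricts_add restricts_mult restricts_scale in blast)+

lemma restricts_surj:
  fixes m0 :: nat
  assumes m0: "1 \<le> m0" and x: "x \<in> zeta n"
  shows "\<exists>z. restricts n z x"
  using zeta_subset_capelli_algebra[OF m0 x, of 0] unfolding capelli_algebra_def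
proof (induction rule: subalgebra_gen.induct)
  case (gen z)
  then show ?case using restricts_capelli_H[OF m0] by blast
qed (use restricts_one restricts_add restricts_mult restricts_scale in blast)+

lemma capelli_pi_eq:
  assumes m0: "1 \<le> m0" and zx: "restricts n z x"
  shows "capelli_pi m0 m1 n z = x"
proof -
  \<comment> \<open>A function by \<open>restricts_unique\<close>, defined on the whole center by
    \<open>restricts_ex\<close>; \<open>restrict\<close> makes it extensional, as the definite
    description demands.\<close>
  define p where "p = restrict (\<lambda>z. THE x. restricts n z x) (zeta (n + 1))"
  have p: "p z = x" if "restricts n z x" for z x
  proof -
    have "(THE x. restricts n z x) = x"
      using that restricts_unique by (intro the_equality) auto
    moreover have "z \<in> zeta (n + 1)" using that by (simp add: restricts_def)
    ultimately show ?thesis unfolding p_def restrict_apply by (simp only: if_True)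
  qed
  have pr: "restricts n z (p z)" if "z \<in> zeta (n + 1)" for z
    using restricts_ex[OF m0 that] p by blast
  have epi: "algebra_epi (zeta (n + 1)) (zeta n) p"
    unfolding algebra_epi_def
  proof (intro conjI ballI allI)
    show "p ` zeta (n + 1) = zeta n"
    proof (intro equalityI subsetI)
      fix y assume "y \<in> p ` zeta (n + 1)"
      then obtain w where "w \<in> zeta (n + 1)" "y = p w" by blast
      then show "y \<in> zeta n" using pr[of w] by (simp add: restricts_def)
    next
      fix y assume "y \<in> zeta n"
      then obtain w where "restricts n w y" using restricts_surj[OF m0] by blast
      then have "p w = y" "w \<in> zeta (n + 1)" by (auto simp: p restricts_def)
      then show "y \<in> p ` zeta (n + 1)" by blast
    qed
    show "p 1 = 1" by (rule p[OF restricts_one])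
    show "p (u + w) = p u + p w" if "u \<in> zeta (n + 1)" "w \<in> zeta (n + 1)" for u w
      by (intro p restricts_add pr that)
    show "p (u * w) = p u * p w" if "u \<in> zeta (n + 1)" "w \<in> zeta (n + 1)" for u w
      by (intro p restricts_mult pr that)
    show "p (env_scale c u) = env_scale c (p u)" if "u \<in> zeta (n + 1)" for c u
      by (intro p restricts_scale pr that)
  qed
  have pH: "p (capelli_H m0 m1 (n + 1) k) = capelli_H m0 m1 n k" for k
    by (rule p[OF restricts_capelli_H[OF m0]])
  let ?P = "\<lambda>g. g \<in> extensional (zeta (n + 1)) \<and> algebra_epi (zeta (n + 1)) (zeta n) g \<and>
        (\<forall>k\<in>{1..n}. g (capelli_H m0 m1 (n + 1) k) = capelli_H m0 m1 n k) \<and>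
        g (capelli_H m0 m1 (n + 1) (n + 1)) = 0"
  have "capelli_pi m0 m1 n = p"
    unfolding capelli_pi_def
  proof (rule the_equality)
    have "p (capelli_H m0 m1 (n + 1) (n + 1)) = 0"
      unfolding pH by (rule capelli_H_above) simp
    then show "?P p"
      using epi pH by (simp add: p_def)
  next
    fix g
    assume g: "?P g"
    then have hom: "g 1 = 1"
      "\<And>u w. u \<in> zeta (n + 1) \<Longrightarrow> w \<in> zeta (n + 1) \<Longrightarrow> g (u + w) = g u + g w \<and> g (u * w) = g u * g w"
      "\<And>c u. u \<in> zeta (n + 1) \<Longrightarrow> g (env_scale c u) = env_scale c (g u)"
      unfolding algebra_epi_def by blast+
    show "g = p"
    proof (rule extensionalityI[of _ "zeta (n + 1)"])
      fix u assume "u \<in> zeta (n + 1)"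
      then have "u \<in> capelli_algebra m0 m1 (n + 1)" by (rule zeta_subset_capelli_algebra[OF m0])
      \<comment> \<open>Every competitor \<open>g\<close> follows the relation
        \<open>restricts\<close> on the generators and hence on the algebra they generate.
        Membership in the center is carried along because \<open>hom\<close> applies only
        there.\<close>
      then have "u \<in> zeta (n + 1) \<and> restricts n u (g u)"
        unfolding capelli_algebra_def
      proof (induction rule: subalgebra_gen.induct)
        case one
        show ?case by (simp add: hom(1) zeta_one restricts_one)
      next
        case (gen u)
        then obtain k where k: "k \<in> {1..n + 1}" "u = capelli_H m0 m1 (n + 1) k" by blast
        have "g u = capelli_H m0 m1 n k"
        \<comment> \<open>For the top index the prescribed value 0 equals
          \<open>capelli_H m0 m1 n (n + 1)\<close>.\<close>
        proof (cases "k = n + 1")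
          case True
          then show ?thesis using g k capelli_H_above[of n k] by simp
        next
          case False
          then have "k \<in> {1..n}" using k by auto
          then show ?thesis using g k by blast
        qed
        then show ?case using restricts_capelli_H[OF m0, of n m1 k] capelli_H_family(1)[OF m0] k by simp
      next
        case (add u w)
        then show ?case using hom(2)[of u w] by (simp add: zeta_add restricts_add)
      next
        case (mult u w)
        then show ?case using hom(2)[of u w] by (simp add: zeta_mult restricts_mult)
      next
        case (scale u c)
        then show ?case using hom(3)[of u c] by (simp add: zeta_scale restricts_scale)
      qed
      then show "g u = p u" using p by metis
    qed (use g in \<open>auto simp: p_def\<close>)
  qed
  then show ?thesis using p[OF zx] by simp
qed

theorem proposition5p8:
  fixes n k m0 m1 :: nat and lam :: "nat list"
  assumes "1 \<le> n" and "1 \<le> k"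
    and "is_partition lam" and "part (conjugate lam) 1 \<le> n"
    and "1 \<le> m0" and "part lam 1 \<le> m0"
    and "1 \<le> m1" and "part (conjugate lam) 1 \<le> m1"
  shows "(nazarov_I m0 m1 n k \<in> zeta n
          \<and> nazarov_I m0 m1 (n + 1) k - nazarov_I m0 m1 n k \<in> ideal_I_0 (n + 1)
          \<and> olshanski_decomposition n (nazarov_I m0 m1 (n + 1) k) (nazarov_I m0 m1 n k)
              (nazarov_I m0 m1 (n + 1) k - nazarov_I m0 m1 n k)
          \<and> capelli_pi m0 m1 n (nazarov_I m0 m1 (n + 1) k) = nazarov_I m0 m1 n k)
       \<and> (schur_S m0 m1 n lam \<in> zeta n
          \<and> schur_S m0 m1 (n + 1) lam - schur_S m0 m1 n lam \<in> ideal_I_0 (n + 1)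
          \<and> olshanski_decomposition n (schur_S m0 m1 (n + 1) lam) (schur_S m0 m1 n lam)
              (schur_S m0 m1 (n + 1) lam - schur_S m0 m1 n lam)
          \<and> capelli_pi m0 m1 n (schur_S m0 m1 (n + 1) lam) = schur_S m0 m1 n lam)"
proof -
  \<comment> \<open>All four claims about a family follow from centrality at both levels and from
    the difference lying in the ideal, so the Nazarov and Schur elements are settled
    together.\<close>
  have "x \<in> zeta n \<and> z - x \<in> ideal_I_0 (n + 1) \<and> olshanski_decomposition n z x (z - x) \<and> capelli_pi m0 m1 n z = x"
    if "z \<in> zeta (n + 1)" "x \<in> zeta n" "z - x \<in> ideal_I_0 (n + 1)" for z x
    using that capelli_pi_eq[OF assms(5) restrictsI[OF that]] zeta_subset_U_gl[OF that(2)]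
    by (simp add: olshanski_decomposition_def)
  then show ?thesis
    using nazarov_I_family[OF assms(7)] schur_S_family[OF assms(6,8)] by simp
qed

end
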